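(* Let $\{F_i\}_{i\in\mathbb{N}}$ be a countable collection of finite groups, and let $\Lambda=\bigoplus_{i\in\mathbb{N}}F_i$. Then $\Lambda$ is an $R$-semiduality group of dimension $1$ for any principal ideal domain $R$ in which $|F_i|$ is invertible for every $i$. (So, for example, any countable sum of finite groups is a $\mathbb{Q}$-semiduality group.)
   Context: For a commutative ring $R$, a group $\Lambda$ is an $R$-semiduality group of dimension $d$ if: (i) $\mathrm{cd}_R(\Lambda)\le d$, where $\mathrm{cd}_R$ denotes cohomological dimension over $R$; (ii) $\Lambda$ is of type $FP_{d-1}$ over $R$; (iii) $H^k(\Lambda;R\Lambda)=0$ if $k\ne d$; (iv) $H^d(\Lambda;R\Lambda)$ is a flat $R$-module.
   Formalization: The formal theorem adds that infinitely many of the F_i are nontrivial, i.e. that Λ is infinite; otherwise Λ is finite, H^0(Λ;RΛ) is isomorphic to R and nonzero, and condition (iii) fails for d = 1. *)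

theory Defs
  imports
    "HOL-Algebra.Module"
    "HOL-Algebra.Product_Groups"
    "HOL-Algebra.Free_Abelian_Groups"
    "HOL-Algebra.Generated_Groups"
    "HOL-Algebra.Ring_Divisibility"
    "HOL-Library.Extended_Nat"
begin

text \<open>A record of type \<^typ>\<open>('a, 'm) module\<close> also has the ring fields \<open>mult\<close> and \<open>one\<close>. They play
  no role for modules and are left unspecified in the module records built below.\<close>


section \<open>Left modules over a ring that need not be commutative\<close>

locale left_module = A?: ring A + M?: abelian_group M
  for A :: "('a, 'x) ring_scheme" and M :: "('a, 'm) module" (structure) +
  assumes smult_closed:
      "\<lbrakk>a \<in> carrier A; x \<in> carrier M\<rbrakk> \<Longrightarrow> a \<odot>\<^bsub>M\<^esub> x \<in> carrier M"
    and smult_l_distr: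
      "\<lbrakk>a \<in> carrier A; b \<in> carrier A; x \<in> carrier M\<rbrakk> \<Longrightarrow>
        (a \<oplus>\<^bsub>A\<^esub> b) \<odot>\<^bsub>M\<^esub> x = a \<odot>\<^bsub>M\<^esub> x \<oplus>\<^bsub>M\<^esub> b \<odot>\<^bsub>M\<^esub> x"
    and smult_r_distr:
      "\<lbrakk>a \<in> carrier A; x \<in> carrier M; y \<in> carrier M\<rbrakk> \<Longrightarrow>
        a \<odot>\<^bsub>M\<^esub> (x \<oplus>\<^bsub>M\<^esub> y) = a \<odot>\<^bsub>M\<^esub> x \<oplus>\<^bsub>M\<^esub> a \<odot>\<^bsub>M\<^esub> y"
    and smult_assoc:
      "\<lbrakk>a \<in> carrier A; b \<in> carrier A; x \<in> carrier M\<rbrakk> \<Longrightarrow>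
        (a \<otimes>\<^bsub>A\<^esub> b) \<odot>\<^bsub>M\<^esub> x = a \<odot>\<^bsub>M\<^esub> (b \<odot>\<^bsub>M\<^esub> x)"
    and smult_one:
      "x \<in> carrier M \<Longrightarrow> \<one>\<^bsub>A\<^esub> \<odot>\<^bsub>M\<^esub> x = x"

definition linear_maps ::
    "('a, 'x) ring_scheme \<Rightarrow> ('a, 'm) module \<Rightarrow> ('a, 'n) module \<Rightarrow> ('m \<Rightarrow> 'n) set" where
  "linear_maps A M N = {f \<in> carrier M \<rightarrow> carrier N.
     (\<forall>x\<in>carrier M. \<forall>y\<in>carrier M. f (x \<oplus>\<^bsub>M\<^esub> y) = f x \<oplus>\<^bsub>N\<^esub> f y) \<and>
     (\<forall>a\<in>carrier A. \<forall>x\<in>carrier M. f (a \<odot>\<^bsub>M\<^esub> x) = a \<odot>\<^bsub>N\<^esub> f x)}"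

definition regular_module :: "('a, 'x) ring_scheme \<Rightarrow> ('a, 'a) module" where
  "regular_module A = \<lparr>carrier = carrier A, monoid.mult = undefined, monoid.one = undefined,
     zero = \<zero>\<^bsub>A\<^esub>, add = (\<oplus>\<^bsub>A\<^esub>), smult = (\<otimes>\<^bsub>A\<^esub>)\<rparr>"

definition free_module :: "('a, 'x) ring_scheme \<Rightarrow> 's set \<Rightarrow> ('a, 's \<Rightarrow> 'a) module" where
  "free_module A S = \<lparr>
     carrier = {f. (\<forall>s. f s \<in> carrier A) \<and> (\<forall>s. s \<notin> S \<longrightarrow> f s = \<zero>\<^bsub>A\<^esub>) \<and> finite {s. f s \<noteq> \<zero>\<^bsub>A\<^esub>}},
     monoid.mult = undefined, monoid.one = undefined,
     zero = (\<lambda>s. \<zero>\<^bsub>A\<^esub>), add = (\<lambda>f g s. f s \<oplus>\<^bsub>A\<^esub> g s),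
     smult = (\<lambda>a f s. a \<otimes>\<^bsub>A\<^esub> f s)\<rparr>"

text \<open>Projective means: a direct summand of a free module. Bases in the type \<open>'m\<close> suffice, because
  a direct summand \<open>M\<close> of any free module is one of the free module with basis \<^term>\<open>carrier M\<close>.\<close>

definition projective_module :: "('a, 'x) ring_scheme \<Rightarrow> ('a, 'm) module \<Rightarrow> bool" where
  "projective_module A M \<longleftrightarrow> left_module A M \<and>
     (\<exists>(S :: 'm set) i p. i \<in> linear_maps A M (free_module A S) \<and>
        p \<in> linear_maps A (free_module A S) M \<and> (\<forall>x\<in>carrier M. p (i x) = x))"

definition finitely_generated_module :: "('a, 'x) ring_scheme \<Rightarrow> ('a, 'm) module \<Rightarrow> bool" where
  "finitely_generated_module A M \<longleftrightarrow>
     (\<exists>S. finite S \<and> S \<subseteq> carrier M \<and>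
        (\<forall>x\<in>carrier M. \<exists>c \<in> S \<rightarrow> carrier A. x = (\<Oplus>\<^bsub>M\<^esub>s\<in>S. c s \<odot>\<^bsub>M\<^esub> s)))"

definition zero_module :: "('a, 'm) module \<Rightarrow> bool" where
  "zero_module M \<longleftrightarrow> carrier M = {\<zero>\<^bsub>M\<^esub>}"

definition quotient_module :: "('a, 'm) module \<Rightarrow> 'm set \<Rightarrow> ('a, 'm set) module" where
  "quotient_module M N = \<lparr>carrier = a_rcosets\<^bsub>M\<^esub> N, monoid.mult = undefined, monoid.one = undefined,
     zero = N, add = (<+>\<^bsub>M\<^esub>), smult = (\<lambda>a X. \<Union>x\<in>X. N +>\<^bsub>M\<^esub> (a \<odot>\<^bsub>M\<^esub> x))\<rparr>"

text \<open>A projective resolution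
  \<open>\<dots> \<rightarrow> P 2 \<rightarrow> P 1 \<rightarrow> P 0 \<rightarrow> M \<rightarrow> 0\<close> with differentials \<open>d n : P (n + 1) \<rightarrow> P n\<close> and
  augmentation \<open>\<epsilon>\<close>.\<close>

definition projective_resolution ::
    "('a, 'x) ring_scheme \<Rightarrow> ('a, 'm) module \<Rightarrow> (nat \<Rightarrow> ('a, 'p) module) \<Rightarrow>
      (nat \<Rightarrow> 'p \<Rightarrow> 'p) \<Rightarrow> ('p \<Rightarrow> 'm) \<Rightarrow> bool" where
  "projective_resolution A M P d \<epsilon> \<longleftrightarrow>
     left_module A M \<and>
     (\<forall>n. projective_module A (P n)) \<and>
     \<epsilon> \<in> linear_maps A (P 0) M \<and>
     (\<forall>n. d n \<in> linear_maps A (P (Suc n)) (P n)) \<and>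
     \<epsilon> ` carrier (P 0) = carrier M \<and>
     d 0 ` carrier (P 1) = a_kernel (P 0) M \<epsilon> \<and>
     (\<forall>n. d (Suc n) ` carrier (P (Suc (Suc n))) = a_kernel (P (Suc n)) (P n) (d n))"


section \<open>Flat modules over a commutative ring\<close>

definition tensor_relations ::
    "('r, 'x) ring_scheme \<Rightarrow> ('r, 'm) module \<Rightarrow> ('r, 'n) module \<Rightarrow> ('m \<times> 'n \<Rightarrow>\<^sub>0 int) set" where
  "tensor_relations R M N =
     {frag_of (x \<oplus>\<^bsub>M\<^esub> x', y) - frag_of (x, y) - frag_of (x', y) | x x' y.
        x \<in> carrier M \<and> x' \<in> carrier M \<and> y \<in> carrier N} \<union>
     {frag_of (x, y \<oplus>\<^bsub>N\<^esub> y') - frag_of (x, y) - frag_of (x, y') | x y y'.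
        x \<in> carrier M \<and> y \<in> carrier N \<and> y' \<in> carrier N} \<union>
     {frag_of (r \<odot>\<^bsub>M\<^esub> x, y) - frag_of (x, r \<odot>\<^bsub>N\<^esub> y) | r x y.
        r \<in> carrier R \<and> x \<in> carrier M \<and> y \<in> carrier N}"

definition tensor_kernel ::
    "('r, 'x) ring_scheme \<Rightarrow> ('r, 'm) module \<Rightarrow> ('r, 'n) module \<Rightarrow> ('m \<times> 'n \<Rightarrow>\<^sub>0 int) set" where
  "tensor_kernel R M N =
     generate (free_Abelian_group (carrier M \<times> carrier N)) (tensor_relations R M N)"

definition tensor_product ::
    "('r, 'x) ring_scheme \<Rightarrow> ('r, 'm) module \<Rightarrow> ('r, 'n) module \<Rightarrow> ('m \<times> 'n \<Rightarrow>\<^sub>0 int) set monoid" where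
  "tensor_product R M N =
     free_Abelian_group (carrier M \<times> carrier N) Mod tensor_kernel R M N"

text \<open>The homomorphism \<open>M \<otimes> N \<rightarrow> M \<otimes> N'\<close> induced by \<open>f : N \<rightarrow> N'\<close>, on cosets.\<close>

definition tensor_map ::
    "('r, 'x) ring_scheme \<Rightarrow> ('r, 'm) module \<Rightarrow> ('r, 'n) module \<Rightarrow> ('n \<Rightarrow> 'n) \<Rightarrow>
      ('m \<times> 'n \<Rightarrow>\<^sub>0 int) set \<Rightarrow> ('m \<times> 'n \<Rightarrow>\<^sub>0 int) set" where
  "tensor_map R M N' f X =
     (\<Union>t\<in>X. tensor_kernel R M N'
        #>\<^bsub>free_Abelian_group (carrier M \<times> carrier N')\<^esub> frag_extend (\<lambda>(x, y). frag_of (x, f y)) t)"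

text \<open>Tensoring with \<open>M\<close> preserves injectivity of linear maps. HOL cannot quantify over types inside
  a definition, so the type \<open>'n\<close> that carries the test modules is a parameter. A theorem in which
  \<open>'n\<close> is a type variable is about all test modules.\<close>

definition flat_module ::
    "'n itself \<Rightarrow> ('r, 'x) ring_scheme \<Rightarrow> ('r, 'm) module \<Rightarrow> bool" where
  "flat_module (T :: 'n itself) R M \<longleftrightarrow> module R M \<and>
     (\<forall>(N :: ('r, 'n) module) (N' :: ('r, 'n) module) f.
        module R N \<and> module R N' \<and> f \<in> linear_maps R N N' \<and> inj_on f (carrier N) \<longrightarrow>
        inj_on (tensor_map R M N' f) (carrier (tensor_product R M N)))"


section \<open>Group rings and group cohomology\<close>

definition ring_single :: "('r, 'x) ring_scheme \<Rightarrow> 'g \<Rightarrow> 'r \<Rightarrow> 'g \<Rightarrow> 'r" where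
  "ring_single R g r = (\<lambda>h. if h = g then r else \<zero>\<^bsub>R\<^esub>)"

definition group_ring ::
    "('r, 'x) ring_scheme \<Rightarrow> ('g, 'y) monoid_scheme \<Rightarrow> ('g \<Rightarrow> 'r) ring" where
  "group_ring R G = \<lparr>
     carrier = {a. (\<forall>g. a g \<in> carrier R) \<and> (\<forall>g. g \<notin> carrier G \<longrightarrow> a g = \<zero>\<^bsub>R\<^esub>) \<and>
                   finite {g. a g \<noteq> \<zero>\<^bsub>R\<^esub>}},
     monoid.mult = (\<lambda>a b g. if g \<in> carrier G
               then (\<Oplus>\<^bsub>R\<^esub>h\<in>{h. a h \<noteq> \<zero>\<^bsub>R\<^esub>}. a h \<otimes>\<^bsub>R\<^esub> b (inv\<^bsub>G\<^esub> h \<otimes>\<^bsub>G\<^esub> g))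
               else \<zero>\<^bsub>R\<^esub>),
     monoid.one = ring_single R \<one>\<^bsub>G\<^esub> \<one>\<^bsub>R\<^esub>,
     zero = (\<lambda>g. \<zero>\<^bsub>R\<^esub>),
     add = (\<lambda>a b g. a g \<oplus>\<^bsub>R\<^esub> b g)\<rparr>"

text \<open>\<open>R\<close> with trivial action of \<open>G\<close>: the group ring acts through its augmentation.\<close>

definition trivial_module ::
    "('r, 'x) ring_scheme \<Rightarrow> ('g, 'y) monoid_scheme \<Rightarrow> ('g \<Rightarrow> 'r, 'r) module" where
  "trivial_module R G = \<lparr>carrier = carrier R, monoid.mult = undefined, monoid.one = undefined,
     zero = \<zero>\<^bsub>R\<^esub>, add = (\<oplus>\<^bsub>R\<^esub>),
     smult = (\<lambda>a x. (\<Oplus>\<^bsub>R\<^esub>g\<in>{g. a g \<noteq> \<zero>\<^bsub>R\<^esub>}. a g) \<otimes>\<^bsub>R\<^esub> x)\<rparr>"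

text \<open>Inhomogeneous cochains with values in a module \<open>M\<close> over the group ring. The elements of \<open>G^n\<close>
  are lists of length \<open>n\<close>, and cochains vanish off \<open>G^n\<close>.\<close>

definition group_tuples :: "('g, 'y) monoid_scheme \<Rightarrow> nat \<Rightarrow> 'g list set" where
  "group_tuples G n = {gs. length gs = n \<and> set gs \<subseteq> carrier G}"

definition cochains ::
    "('g, 'y) monoid_scheme \<Rightarrow> ('a, 'm) module \<Rightarrow> nat \<Rightarrow> ('g list \<Rightarrow> 'm) set" where
  "cochains G M n = {f. (\<forall>gs\<in>group_tuples G n. f gs \<in> carrier M) \<and>
     (\<forall>gs. gs \<notin> group_tuples G n \<longrightarrow> f gs = \<zero>\<^bsub>M\<^esub>)}"

definition alternating_sign :: "('a, 'm) module \<Rightarrow> nat \<Rightarrow> 'm \<Rightarrow> 'm" where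
  "alternating_sign M i x = (if even i then x else \<ominus>\<^bsub>M\<^esub> x)"

text \<open>\<open>(\<delta> f)(g\<^sub>1, \<dots>, g\<^sub>n\<^sub>+\<^sub>1) = g\<^sub>1 f(g\<^sub>2, \<dots>, g\<^sub>n\<^sub>+\<^sub>1) + \<Sum>\<^sub>i (-1)\<^sup>i f(\<dots>, g\<^sub>i g\<^sub>i\<^sub>+\<^sub>1, \<dots>) + (-1)\<^sup>n\<^sup>+\<^sup>1 f(g\<^sub>1, \<dots>, g\<^sub>n)\<close>
  with \<open>i\<close> from \<open>1\<close> to \<open>n\<close>; list positions start at \<open>0\<close>, hence the shift by one.\<close>

definition coboundary ::
    "('r, 'x) ring_scheme \<Rightarrow> ('g, 'y) monoid_scheme \<Rightarrow> ('g \<Rightarrow> 'r, 'm) module \<Rightarrow> nat \<Rightarrow>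
      ('g list \<Rightarrow> 'm) \<Rightarrow> 'g list \<Rightarrow> 'm" where
  "coboundary R G M n f = (\<lambda>gs. if gs \<in> group_tuples G (Suc n) then
       ring_single R (hd gs) \<one>\<^bsub>R\<^esub> \<odot>\<^bsub>M\<^esub> f (tl gs)
       \<oplus>\<^bsub>M\<^esub> (\<Oplus>\<^bsub>M\<^esub>i\<in>{..<n}. alternating_sign M (Suc i)
            (f (take i gs @ [gs ! i \<otimes>\<^bsub>G\<^esub> gs ! Suc i] @ drop (i + 2) gs)))
       \<oplus>\<^bsub>M\<^esub> alternating_sign M (Suc n) (f (butlast gs))
     else \<zero>\<^bsub>M\<^esub>)"

definition cocycles ::
    "('r, 'x) ring_scheme \<Rightarrow> ('g, 'y) monoid_scheme \<Rightarrow> ('g \<Rightarrow> 'r, 'm) module \<Rightarrow> nat \<Rightarrow>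
      ('g list \<Rightarrow> 'm) set" where
  "cocycles R G M n = {f \<in> cochains G M n. coboundary R G M n f = (\<lambda>gs. \<zero>\<^bsub>M\<^esub>)}"

definition coboundaries ::
    "('r, 'x) ring_scheme \<Rightarrow> ('g, 'y) monoid_scheme \<Rightarrow> ('g \<Rightarrow> 'r, 'm) module \<Rightarrow> nat \<Rightarrow>
      ('g list \<Rightarrow> 'm) set" where
  "coboundaries R G M n = (case n of 0 \<Rightarrow> {\<lambda>gs. \<zero>\<^bsub>M\<^esub>}
     | Suc k \<Rightarrow> coboundary R G M k ` cochains G M k)"

definition cocycle_module ::
    "('r, 'x) ring_scheme \<Rightarrow> ('g, 'y) monoid_scheme \<Rightarrow> ('g \<Rightarrow> 'r, 'm) module \<Rightarrow> nat \<Rightarrow>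
      ('r, 'g list \<Rightarrow> 'm) module" where
  "cocycle_module R G M n = \<lparr>carrier = cocycles R G M n, monoid.mult = undefined, monoid.one = undefined,
     zero = (\<lambda>gs. \<zero>\<^bsub>M\<^esub>), add = (\<lambda>f f' gs. f gs \<oplus>\<^bsub>M\<^esub> f' gs),
     smult = (\<lambda>r f gs. if gs \<in> group_tuples G n then ring_single R \<one>\<^bsub>G\<^esub> r \<odot>\<^bsub>M\<^esub> f gs else \<zero>\<^bsub>M\<^esub>)\<rparr>"

definition group_cohomology ::
    "('r, 'x) ring_scheme \<Rightarrow> ('g, 'y) monoid_scheme \<Rightarrow> ('g \<Rightarrow> 'r, 'm) module \<Rightarrow> nat \<Rightarrow>
      ('r, ('g list \<Rightarrow> 'm) set) module" where
  "group_cohomology R G M n = quotient_module (cocycle_module R G M n) (coboundaries R G M n)"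


section \<open>Finiteness properties and semiduality groups\<close>

text \<open>The modules of a resolution are carried by the type \<^typ>\<open>'g list \<Rightarrow> 'r\<close>. This loses no
  generality. The bar resolution, whose \<open>n\<close>-th term is free over \<open>R\<close> with basis \<open>G^(n+1)\<close>, lives in
  this type, and so do the kernels of its truncations, which are projective in all degrees from the
  projective dimension on. Unless \<open>R\<close> is the zero ring, the type also
  has at least as many elements as \<open>R\<close>, \<open>G\<close> and the natural numbers. Hence it carries every module
  over the group ring generated by at most that many elements, and a resolution with finitely
  generated terms in degrees up to \<open>n\<close> can be replaced by one made of such modules.\<close>

definition cohomological_dimension ::
    "('r, 'x) ring_scheme \<Rightarrow> ('g, 'y) monoid_scheme \<Rightarrow> enat" where
  "cohomological_dimension R G = Inf {enat n | n.
     \<exists>(P :: nat \<Rightarrow> ('g \<Rightarrow> 'r, 'g list \<Rightarrow> 'r) module) d \<epsilon>.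
       projective_resolution (group_ring R G) (trivial_module R G) P d \<epsilon> \<and>
       (\<forall>i>n. zero_module (P i))}"

definition type_FP :: "('r, 'x) ring_scheme \<Rightarrow> ('g, 'y) monoid_scheme \<Rightarrow> nat \<Rightarrow> bool" where
  "type_FP R G n \<longleftrightarrow>
     (\<exists>(P :: nat \<Rightarrow> ('g \<Rightarrow> 'r, 'g list \<Rightarrow> 'r) module) d \<epsilon>.
       projective_resolution (group_ring R G) (trivial_module R G) P d \<epsilon> \<and>
       (\<forall>i\<le>n. finitely_generated_module (group_ring R G) (P i)))"

text \<open>For \<open>d = 0\<close> the condition \<open>FP\<^sub>d\<^sub>-\<^sub>1\<close> is void. The type argument is the one of
  \<^const>\<open>flat_module\<close>.\<close>

definition semiduality_group ::
    "'n itself \<Rightarrow> ('r, 'x) ring_scheme \<Rightarrow> ('g, 'y) monoid_scheme \<Rightarrow> nat \<Rightarrow> bool" where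
  "semiduality_group T R G d \<longleftrightarrow> cring R \<and> group G \<and>
     cohomological_dimension R G \<le> enat d \<and>
     (0 < d \<longrightarrow> type_FP R G (d - 1)) \<and>
     (\<forall>k. k \<noteq> d \<longrightarrow> zero_module (group_cohomology R G (regular_module (group_ring R G)) k)) \<and>
     flat_module T R (group_cohomology R G (regular_module (group_ring R G)) d)"

definition rational_ring :: "rat ring" where
  "rational_ring = \<lparr>carrier = UNIV, monoid.mult = (*), monoid.one = 1, zero = 0, add = (+)\<rparr>"

end

theory Submission
  imports Defs
begin

text \<open>The sum \<open>\<Lambda>\<close> is an infinite increasing union of finite normal subgroups \<open>K n\<close> whose orders are
  invertible in \<open>R\<close>. The averaging idempotents of the \<open>K n\<close> split the augmentation ideal of \<open>R\<Lambda>\<close> into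
  countably many direct summands of \<open>R\<Lambda>\<close>, so it is projective and gives a resolution of \<open>R\<close> of
  length one. Cohomology in degree at least two vanishes because a cocycle bounds on every \<open>K n\<close> and
  the bounding cochains can be glued; in degree zero it vanishes because \<open>\<Lambda>\<close> is infinite.
  In degree one it is torsion-free: if \<open>r f\<close> is the coboundary of \<open>a \<in> R\<Lambda>\<close>, comparing coefficients far
  away from the support of \<open>a\<close> shows that \<open>r\<close> divides \<open>a\<close>. Over a principal ideal domain torsion-free
  modules are flat, since finitely many of their elements lie in a finitely generated submodule,
  and a generating family of minimal size of such a submodule is a basis.\<close>

section \<open>Torsion-free modules over a principal ideal domain are flat\<close>

text \<open>The infinitely many nontrivial factors are essential: for a finite group the sum of all
  group elements is a nonzero invariant in the group ring, so degree-zero cohomology would survive.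
  Cohomology is defined by inhomogeneous cochains, cohomological dimension by projective
  resolutions. The two are never compared, so the resolution of length one says nothing about
  cohomology above degree one, which gets its own gluing argument. Gluing needs the difference of
  two bounding cochains to be bounded again, and that works only in positive degree; this is why
  degree one escapes. Flatness is tested on formal sums modulo relations: a proof that such a sum
  vanishes mentions finitely many left entries, so coordinate forms on one submodule with a basis
  turn the question into one about the right factor. The terms of the resolution must have the type
  of functions on words, hence the copies of the group ring and of the augmentation ideal supported
  on one-letter words.\<close>

lemma (in principal_domain) bezout_coefficients:
  assumes a: "a \<in> carrier R" "a \<noteq> \<zero>" and b: "b \<in> carrier R"
  obtains g s t u v where "g \<in> carrier R" "s \<in> carrier R" "t \<in> carrier R" "u \<in> carrier R" "v \<in> carrier R"
    "g \<noteq> \<zero>" "a = g \<otimes> s" "b = g \<otimes> t" "u \<otimes> s \<oplus> v \<otimes> t = \<one>"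
proof -
  have "ideal (PIdl a <+>\<^bsub>R\<^esub> PIdl b) R"
    by (rule add_ideals[OF cgenideal_ideal[OF a(1)] cgenideal_ideal[OF b]])
  then obtain g where g: "g \<in> carrier R" "PIdl a <+>\<^bsub>R\<^esub> PIdl b = PIdl g"
    using exists_gen by blast
  have "g \<in> PIdl a <+>\<^bsub>R\<^esub> PIdl b"
    using cgenideal_self[OF g(1)] g(2) by simp
  then obtain u v where uv: "u \<in> carrier R" "v \<in> carrier R" "g = u \<otimes> a \<oplus> v \<otimes> b"
    unfolding set_add_def' cgenideal_def by auto
  have "a \<in> PIdl g"
    unfolding g(2)[symmetric] set_add_def'
    using cgenideal_self[OF a(1)] additive_subgroup.zero_closed[OF ideal.axioms(1)[OF cgenideal_ideal[OF b]]] a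
    by force
  then obtain s where s: "s \<in> carrier R" "a = g \<otimes> s"
    unfolding cgenideal_def using m_comm[OF g(1)] by auto
  have "b \<in> PIdl g"
    unfolding g(2)[symmetric] set_add_def'
    using cgenideal_self[OF b] additive_subgroup.zero_closed[OF ideal.axioms(1)[OF cgenideal_ideal[OF a(1)]]] b
    by force
  then obtain t where t: "t \<in> carrier R" "b = g \<otimes> t"
    unfolding cgenideal_def using m_comm[OF g(1)] by auto
  have g0: "g \<noteq> \<zero>" using s a by auto
  \<comment> \<open>Multiplied by \<open>g\<close>, the identity sought reads
    \<open>u a + v b = g\<close>, which is how \<open>u\<close> and \<open>v\<close> were chosen;
    the nonzero \<open>g\<close> is then cancelled.\<close>
  have "g \<otimes> (u \<otimes> s \<oplus> v \<otimes> t) = u \<otimes> (g \<otimes> s) \<oplus> v \<otimes> (g \<otimes> t)"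
    using g(1) uv(1,2) s(1) t(1) by algebra
  also have "\<dots> = g \<otimes> \<one>" unfolding s(2)[symmetric] t(2)[symmetric] uv(3)[symmetric] using g(1) by simp
  finally have "u \<otimes> s \<oplus> v \<otimes> t = \<one>"
    using m_lcancel[OF g0 g(1)] uv(1,2) s(1) t(1) by simp
  then show thesis using that g(1) s t uv(1,2) g0 by blast
qed

section \<open>Spans of finite families in a module\<close>

definition (in module) span :: "'c set \<Rightarrow> 'c set" where
  "span S = \<Inter> {H. submodule H R M \<and> S \<subseteq> H}"

context module
begin

lemma submodule_zero: "submodule H R M \<Longrightarrow> \<zero>\<^bsub>M\<^esub> \<in> H"
  using submodule.axioms(1) subgroup.one_closed by fastforce

lemma span_base: "x \<in> S \<Longrightarrow> x \<in> span S"
  by (auto simp: span_def)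

lemma span_minimal: "submodule H R M \<Longrightarrow> S \<subseteq> H \<Longrightarrow> span S \<subseteq> H"
  by (auto simp: span_def)

lemma span_closed: "S \<subseteq> carrier M \<Longrightarrow> span S \<subseteq> carrier M"
  by (rule span_minimal[OF carrier_is_submodule])

lemma span_submodule:
  assumes "S \<subseteq> carrier M"
  shows "submodule (span S) R M"
proof (rule submoduleI)
  show "span S \<subseteq> carrier M" using span_closed[OF assms] .
qed (auto simp: span_def intro: submodule_zero submoduleE)

text \<open>Generators form a family indexed by \<open>I\<close>, not a set: the Bezout
  transformations may make two of them equal, and the count that must decrease later is that of the
  indices. Negation is scaling by minus one.\<close>

lemma combinations_submodule:
  assumes I: "finite I" and b: "b \<in> I \<rightarrow> carrier M"
  shows "submodule {\<Oplus>\<^bsub>M\<^esub>i\<in>I. c i \<odot>\<^bsub>M\<^esub> b i | c. c \<in> I \<rightarrow> carrier R} R M"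
proof (rule submoduleI)
  let ?C = "{\<Oplus>\<^bsub>M\<^esub>i\<in>I. c i \<odot>\<^bsub>M\<^esub> b i | c. c \<in> I \<rightarrow> carrier R}"
  have comb: "(\<Oplus>\<^bsub>M\<^esub>i\<in>I. c i \<odot>\<^bsub>M\<^esub> b i) \<in> ?C" if "c \<in> I \<rightarrow> carrier R" for c using that by blast
  have bc: "b i \<in> carrier M" if "i \<in> I" for i using b that by auto
  have z: "(\<Oplus>\<^bsub>M\<^esub>i\<in>I. \<zero>\<^bsub>R\<^esub> \<odot>\<^bsub>M\<^esub> b i) = \<zero>\<^bsub>M\<^esub>"
    by (rule M.add.finprod_one_eqI) (simp add: bc)
  show "?C \<subseteq> carrier M"
    using bc by (auto simp: Pi_iff intro!: M.finsum_closed)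
  show "\<zero>\<^bsub>M\<^esub> \<in> ?C" using z by force
  fix x assume "x \<in> ?C"
  then obtain c where c: "c \<in> I \<rightarrow> carrier R" "x = (\<Oplus>\<^bsub>M\<^esub>i\<in>I. c i \<odot>\<^bsub>M\<^esub> b i)" by auto
  have sm: "r \<odot>\<^bsub>M\<^esub> x \<in> ?C" if r: "r \<in> carrier R" for r
  proof -
    have "r \<odot>\<^bsub>M\<^esub> x = (\<Oplus>\<^bsub>M\<^esub>i\<in>I. r \<odot>\<^bsub>M\<^esub> (c i \<odot>\<^bsub>M\<^esub> b i))"
      unfolding c(2) by (rule finsum_smult_ldistr) (use I r c bc in auto)
    also have "\<dots> = (\<Oplus>\<^bsub>M\<^esub>i\<in>I. (r \<otimes>\<^bsub>R\<^esub> c i) \<odot>\<^bsub>M\<^esub> b i)"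
      by (rule M.finsum_cong') (use r c bc in \<open>auto simp: smult_assoc1 Pi_iff\<close>)
    finally have "r \<odot>\<^bsub>M\<^esub> x = (\<Oplus>\<^bsub>M\<^esub>i\<in>I. (r \<otimes>\<^bsub>R\<^esub> c i) \<odot>\<^bsub>M\<^esub> b i)" .
    moreover have "(\<lambda>i. r \<otimes>\<^bsub>R\<^esub> c i) \<in> I \<rightarrow> carrier R" using r c by auto
    ultimately show ?thesis using comb[of "\<lambda>i. r \<otimes>\<^bsub>R\<^esub> c i"] by simp
  qed
  then show "r \<odot>\<^bsub>M\<^esub> x \<in> ?C" if r: "r \<in> carrier R" for r using that .
  have "x \<in> carrier M" using bc c by (auto simp: Pi_iff intro!: M.finsum_closed)
  then have "\<ominus>\<^bsub>M\<^esub> x = (\<ominus>\<^bsub>R\<^esub> \<one>\<^bsub>R\<^esub>) \<odot>\<^bsub>M\<^esub> x" by (simp add: smult_l_minus)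
  then show "\<ominus>\<^bsub>M\<^esub> x \<in> ?C" using sm[of "\<ominus>\<^bsub>R\<^esub> \<one>\<^bsub>R\<^esub>"] by simp
  fix y assume "y \<in> ?C"
  then obtain d where d: "d \<in> I \<rightarrow> carrier R" "y = (\<Oplus>\<^bsub>M\<^esub>i\<in>I. d i \<odot>\<^bsub>M\<^esub> b i)" by auto
  have "x \<oplus>\<^bsub>M\<^esub> y = (\<Oplus>\<^bsub>M\<^esub>i\<in>I. c i \<odot>\<^bsub>M\<^esub> b i \<oplus>\<^bsub>M\<^esub> d i \<odot>\<^bsub>M\<^esub> b i)"
    unfolding c(2) d(2) by (rule M.finsum_addf[symmetric]) (use c d bc in \<open>auto simp: Pi_iff\<close>)
  also have "\<dots> = (\<Oplus>\<^bsub>M\<^esub>i\<in>I. (c i \<oplus>\<^bsub>R\<^esub> d i) \<odot>\<^bsub>M\<^esub> b i)"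
    by (rule M.finsum_cong') (use c d bc in \<open>auto simp: smult_l_distr Pi_iff\<close>)
  finally have "x \<oplus>\<^bsub>M\<^esub> y = (\<Oplus>\<^bsub>M\<^esub>i\<in>I. (c i \<oplus>\<^bsub>R\<^esub> d i) \<odot>\<^bsub>M\<^esub> b i)" .
  moreover have "(\<lambda>i. c i \<oplus>\<^bsub>R\<^esub> d i) \<in> I \<rightarrow> carrier R" using c d by auto
  ultimately show "x \<oplus>\<^bsub>M\<^esub> y \<in> ?C" using comb[of "\<lambda>i. c i \<oplus>\<^bsub>R\<^esub> d i"] by simp
qed

text \<open>Kronecker coefficients show that the submodule of combinations contains every
  \<open>b j\<close>, so minimality of the span applies.\<close>

lemma span_combination:
  assumes I: "finite I" and b: "b \<in> I \<rightarrow> carrier M" and x: "x \<in> span (b ` I)"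
  obtains c where "c \<in> I \<rightarrow> carrier R" "x = (\<Oplus>\<^bsub>M\<^esub>i\<in>I. c i \<odot>\<^bsub>M\<^esub> b i)"
proof -
  let ?C = "{\<Oplus>\<^bsub>M\<^esub>i\<in>I. c i \<odot>\<^bsub>M\<^esub> b i | c. c \<in> I \<rightarrow> carrier R}"
  have comb: "(\<Oplus>\<^bsub>M\<^esub>i\<in>I. c i \<odot>\<^bsub>M\<^esub> b i) \<in> ?C" if "c \<in> I \<rightarrow> carrier R" for c using that by blast
  have bc: "b i \<in> carrier M" if "i \<in> I" for i using b that by auto
  have "b j \<in> ?C" if j: "j \<in> I" for j
  proof -
    have "(\<Oplus>\<^bsub>M\<^esub>i\<in>I. (if i = j then \<one>\<^bsub>R\<^esub> else \<zero>\<^bsub>R\<^esub>) \<odot>\<^bsub>M\<^esub> b i) = (\<Oplus>\<^bsub>M\<^esub>i\<in>I. if j = i then b i else \<zero>\<^bsub>M\<^esub>)"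
      by (rule M.finsum_cong') (use bc in auto)
    also have "\<dots> = b j" by (rule M.finsum_singleton) (use j I b in auto)
    finally have "b j = (\<Oplus>\<^bsub>M\<^esub>i\<in>I. (if i = j then \<one>\<^bsub>R\<^esub> else \<zero>\<^bsub>R\<^esub>) \<odot>\<^bsub>M\<^esub> b i)" by simp
    moreover have "(\<lambda>i. if i = j then \<one>\<^bsub>R\<^esub> else \<zero>\<^bsub>R\<^esub>) \<in> I \<rightarrow> carrier R" by auto
    ultimately show ?thesis using comb[of "\<lambda>i. if i = j then \<one>\<^bsub>R\<^esub> else \<zero>\<^bsub>R\<^esub>"] by simp
  qed
  then have "x \<in> ?C" using span_minimal[OF combinations_submodule[OF I b]] x by blast
  then show thesis using that by auto
qed

end

text \<open>A nontrivial relation is turned by elementary Bezout transformations into one with a single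
  nonzero coefficient; torsion-freeness then makes the corresponding generator vanish.\<close>

lemma (in module) drop_generator:
  assumes pid: "principal_domain R"
    and tf: "\<And>r x. r \<in> carrier R \<Longrightarrow> x \<in> carrier M \<Longrightarrow> r \<odot>\<^bsub>M\<^esub> x = \<zero>\<^bsub>M\<^esub> \<Longrightarrow> r = \<zero>\<^bsub>R\<^esub> \<or> x = \<zero>\<^bsub>M\<^esub>"
    and I: "finite I" and b: "b \<in> I \<rightarrow> carrier M" and c: "c \<in> I \<rightarrow> carrier R"
    and rel: "(\<Oplus>\<^bsub>M\<^esub>i\<in>I. c i \<odot>\<^bsub>M\<^esub> b i) = \<zero>\<^bsub>M\<^esub>" and nz: "\<exists>i\<in>I. c i \<noteq> \<zero>\<^bsub>R\<^esub>"
  shows "\<exists>J b'. J \<subset> I \<and> b' \<in> J \<rightarrow> carrier M \<and> span (b ` I) \<subseteq> span (b' ` J)"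
  using b c rel nz
\<comment> \<open>The number of nonzero coefficients decreases, while the family \<open>b\<close>
  changes along with the relation.\<close>
proof (induction "card {i\<in>I. c i \<noteq> \<zero>\<^bsub>R\<^esub>}" arbitrary: b c rule: less_induct)
  case less
  interpret R: principal_domain R by fact
  obtain i where i: "i \<in> I" "c i \<noteq> \<zero>\<^bsub>R\<^esub>" using less.prems by blast
  have bc: "b k \<in> carrier M" and cc: "c k \<in> carrier R" if "k \<in> I" for k
    using less.prems that by auto
  show ?case
  proof (cases "\<exists>j\<in>I. j \<noteq> i \<and> c j \<noteq> \<zero>\<^bsub>R\<^esub>")
    case False
    have "(\<Oplus>\<^bsub>M\<^esub>k\<in>I. c k \<odot>\<^bsub>M\<^esub> b k) = (\<Oplus>\<^bsub>M\<^esub>k\<in>I. if i = k then c k \<odot>\<^bsub>M\<^esub> b k else \<zero>\<^bsub>M\<^esub>)"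
      by (rule M.finsum_cong') (use False bc cc in auto)
    also have "\<dots> = c i \<odot>\<^bsub>M\<^esub> b i"
      by (rule M.finsum_singleton) (use i I bc cc in auto)
    finally have "b i = \<zero>\<^bsub>M\<^esub>" using tf[OF cc bc, of i i] i less.prems by auto
    moreover have sm: "submodule (span (b ` (I - {i}))) R M"
      by (rule span_submodule) (use bc in auto)
    ultimately have "b ` I \<subseteq> span (b ` (I - {i}))"
      using submodule_zero[OF sm] span_base[of _ "b ` (I - {i})"] by fastforce
    then have "span (b ` I) \<subseteq> span (b ` (I - {i}))" by (rule span_minimal[OF sm])
    then show ?thesis using i bc by (intro exI[of _ "I - {i}"] exI[of _ b]) auto
  next
    case True
    then obtain j where j: "j \<in> I" "j \<noteq> i" "c j \<noteq> \<zero>\<^bsub>R\<^esub>" by blast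
    obtain g s t u v where R: "g \<in> carrier R" "s \<in> carrier R" "t \<in> carrier R" "u \<in> carrier R" "v \<in> carrier R"
      and e: "g \<noteq> \<zero>\<^bsub>R\<^esub>" "c i = g \<otimes>\<^bsub>R\<^esub> s" "c j = g \<otimes>\<^bsub>R\<^esub> t" "u \<otimes>\<^bsub>R\<^esub> s \<oplus>\<^bsub>R\<^esub> v \<otimes>\<^bsub>R\<^esub> t = \<one>\<^bsub>R\<^esub>"
      using R.bezout_coefficients[OF cc[OF i(1)] i(2) cc[OF j(1)]] .
    define x y where "x = b i" and "y = b j"
    have xy: "x \<in> carrier M" "y \<in> carrier M" using bc i j by (auto simp: x_def y_def)
    \<comment> \<open>The pair \<open>x\<close>, \<open>y\<close> is transformed by the matrix with
      rows \<open>(s, t)\<close> and \<open>(-v, u)\<close>, of determinant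
      \<open>u s + v t = 1\<close>. Since \<open>c i x + c j y = g x'\<close>, the new coefficients
      are \<open>g\<close> and zero.\<close>
    define x' y' where "x' = s \<odot>\<^bsub>M\<^esub> x \<oplus>\<^bsub>M\<^esub> t \<odot>\<^bsub>M\<^esub> y" and "y' = u \<odot>\<^bsub>M\<^esub> y \<ominus>\<^bsub>M\<^esub> v \<odot>\<^bsub>M\<^esub> x"
    have xy': "x' \<in> carrier M" "y' \<in> carrier M" using xy R by (auto simp: x'_def y'_def)
    define b' c' where "b' = b(i := x', j := y')" and "c' = c(i := g, j := \<zero>\<^bsub>R\<^esub>)"
    have b': "b' \<in> I \<rightarrow> carrier M" and c': "c' \<in> I \<rightarrow> carrier R"
      using less.prems xy' R by (auto simp: b'_def c'_def)
    define K where "K = I - {i, j}"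
    have IK: "I = insert i (insert j K)" and K: "i \<notin> insert j K" "j \<notin> K" "finite K"
      using i j I by (auto simp: K_def)
    define S where "S = (\<Oplus>\<^bsub>M\<^esub>k\<in>K. c k \<odot>\<^bsub>M\<^esub> b k)"
    have S: "S \<in> carrier M" unfolding S_def
      by (rule M.finsum_closed) (use bc cc in \<open>auto simp: K_def\<close>)
    have S': "(\<Oplus>\<^bsub>M\<^esub>k\<in>K. c' k \<odot>\<^bsub>M\<^esub> b' k) = S" unfolding S_def
      by (rule M.finsum_cong') (use bc cc in \<open>auto simp: K_def c'_def b'_def\<close>)
    have "\<zero>\<^bsub>M\<^esub> = (\<Oplus>\<^bsub>M\<^esub>k\<in>insert i (insert j K). c k \<odot>\<^bsub>M\<^esub> b k)" using less.prems IK by simp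
    also have "\<dots> = c i \<odot>\<^bsub>M\<^esub> x \<oplus>\<^bsub>M\<^esub> (c j \<odot>\<^bsub>M\<^esub> y \<oplus>\<^bsub>M\<^esub> S)"
      using K bc cc i j by (simp add: S_def x_def y_def Pi_iff K_def)
    also have "\<dots> = g \<odot>\<^bsub>M\<^esub> x' \<oplus>\<^bsub>M\<^esub> (\<zero>\<^bsub>R\<^esub> \<odot>\<^bsub>M\<^esub> y' \<oplus>\<^bsub>M\<^esub> S)"
      using R xy S xy' by (simp add: x'_def e smult_r_distr smult_assoc1 M.a_assoc)
    also have "\<dots> = (\<Oplus>\<^bsub>M\<^esub>k\<in>insert i (insert j K). c' k \<odot>\<^bsub>M\<^esub> b' k)"
      using K i j bc cc R xy' S S' by (simp add: Pi_iff K_def b'_def c'_def)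
    finally have rel': "(\<Oplus>\<^bsub>M\<^esub>k\<in>I. c' k \<odot>\<^bsub>M\<^esub> b' k) = \<zero>\<^bsub>M\<^esub>" using IK by simp
    have "{k\<in>I. c' k \<noteq> \<zero>\<^bsub>R\<^esub>} \<subset> {k\<in>I. c k \<noteq> \<zero>\<^bsub>R\<^esub>}" using i j by (auto simp: c'_def)
    then have "card {k\<in>I. c' k \<noteq> \<zero>\<^bsub>R\<^esub>} < card {k\<in>I. c k \<noteq> \<zero>\<^bsub>R\<^esub>}" using I by (intro psubset_card_mono) auto
    moreover have "\<exists>k\<in>I. c' k \<noteq> \<zero>\<^bsub>R\<^esub>" using i j e by (auto simp: c'_def intro!: bexI[of _ i])
    ultimately obtain J b'' where J: "J \<subset> I" "b'' \<in> J \<rightarrow> carrier M" "span (b' ` I) \<subseteq> span (b'' ` J)"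
      using less.hyps[OF _ b' c' rel'] by blast
    have sm: "submodule (span (b' ` I)) R M" by (rule span_submodule) (use b' in auto)
    have x'y': "x' \<in> span (b' ` I)" "y' \<in> span (b' ` I)"
      using i j by (auto intro!: span_base simp: b'_def intro: image_eqI[of _ _ i] image_eqI[of _ _ j])
    \<comment> \<open>The inverse matrix gives \<open>x = u x' - t y'\<close> here and
      \<open>y = v x' + s y'\<close> in \<open>Y\<close>, so the old generators lie in the new
      span.\<close>
    have X: "u \<odot>\<^bsub>M\<^esub> x' \<oplus>\<^bsub>M\<^esub> (\<ominus>\<^bsub>R\<^esub> t) \<odot>\<^bsub>M\<^esub> y' = (u \<otimes>\<^bsub>R\<^esub> s \<oplus>\<^bsub>R\<^esub> v \<otimes>\<^bsub>R\<^esub> t) \<odot>\<^bsub>M\<^esub> x"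
      using R xy by (simp add: x'_def y'_def M.minus_eq smult_r_distr smult_r_minus smult_l_minus
          smult_assoc1[symmetric] smult_l_distr R.m_comm M.minus_add M.a_assoc M.r_neg1 M.r_neg2 M.minus_minus R.r_minus)
    have cancel: "p \<oplus>\<^bsub>M\<^esub> (q \<oplus>\<^bsub>M\<^esub> \<ominus>\<^bsub>M\<^esub> p) = q" if "p \<in> carrier M" "q \<in> carrier M" for p q
      using that M.a_comm[of q "\<ominus>\<^bsub>M\<^esub> p"] by (simp add: M.r_neg2)
    have Y: "v \<odot>\<^bsub>M\<^esub> x' \<oplus>\<^bsub>M\<^esub> s \<odot>\<^bsub>M\<^esub> y' = (u \<otimes>\<^bsub>R\<^esub> s \<oplus>\<^bsub>R\<^esub> v \<otimes>\<^bsub>R\<^esub> t) \<odot>\<^bsub>M\<^esub> y"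
      using R xy by (simp add: x'_def y'_def M.minus_eq smult_r_distr smult_r_minus smult_l_minus
          smult_assoc1[symmetric] smult_l_distr R.m_comm M.minus_add M.a_ac M.r_neg1 M.r_neg2 M.minus_minus R.r_minus cancel)
    have "u \<odot>\<^bsub>M\<^esub> x' \<oplus>\<^bsub>M\<^esub> (\<ominus>\<^bsub>R\<^esub> t) \<odot>\<^bsub>M\<^esub> y' \<in> span (b' ` I)" "v \<odot>\<^bsub>M\<^esub> x' \<oplus>\<^bsub>M\<^esub> s \<odot>\<^bsub>M\<^esub> y' \<in> span (b' ` I)"
      using submoduleE(4,5)[OF sm] x'y' R by auto
    then have "x \<in> span (b' ` I)" "y \<in> span (b' ` I)" using X Y e xy by auto
    moreover have "b k \<in> span (b' ` I)" if "k \<in> I" "k \<noteq> i" "k \<noteq> j" for k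
      using that by (auto intro!: span_base simp: b'_def image_iff intro: bexI[of _ k])
    ultimately have "b ` I \<subseteq> span (b' ` I)" by (auto simp: x_def y_def)
    then have "span (b ` I) \<subseteq> span (b' ` I)" by (rule span_minimal[OF sm])
    then show ?thesis using J by blast
  qed
qed

text \<open>The domain \<open>D\<close> is explicit because the coordinates used later exist on the
  span of a finite family and need not extend to all of \<open>M\<close>.\<close>

definition linear_form_on ::
    "('r, 'x) ring_scheme \<Rightarrow> ('r, 'm, 'y) module_scheme \<Rightarrow> 'm set \<Rightarrow> ('m \<Rightarrow> 'r) \<Rightarrow> bool" where
  "linear_form_on R M D c \<longleftrightarrow> submodule D R M \<and> (\<forall>x\<in>D. c x \<in> carrier R) \<and>
     (\<forall>x\<in>D. \<forall>x'\<in>D. c (x \<oplus>\<^bsub>M\<^esub> x') = c x \<oplus>\<^bsub>R\<^esub> c x') \<and>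
     (\<forall>r\<in>carrier R. \<forall>x\<in>D. c (r \<odot>\<^bsub>M\<^esub> x) = r \<otimes>\<^bsub>R\<^esub> c x)"

lemma (in module) torsion_free_coordinates:
  assumes pid: "principal_domain R"
    and tf: "\<And>r x. r \<in> carrier R \<Longrightarrow> x \<in> carrier M \<Longrightarrow> r \<odot>\<^bsub>M\<^esub> x = \<zero>\<^bsub>M\<^esub> \<Longrightarrow> r = \<zero>\<^bsub>R\<^esub> \<or> x = \<zero>\<^bsub>M\<^esub>"
    and X: "finite X" "X \<subseteq> carrier M"
  shows "\<exists>(I :: 'c set) b D co. finite I \<and> b \<in> I \<rightarrow> carrier M \<and> submodule D R M \<and> X \<subseteq> D \<and>
    (\<forall>i\<in>I. linear_form_on R M D (co i)) \<and> (\<forall>x\<in>D. x = (\<Oplus>\<^bsub>M\<^esub>i\<in>I. co i x \<odot>\<^bsub>M\<^esub> b i))"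
proof -
  \<comment> \<open>The size is minimised over families whose span contains \<open>X\<close>,
    possibly properly; this inclusion is what \<open>drop_generator\<close> preserves. The search
    starts with \<open>X\<close> as a family indexed by itself.\<close>
  let ?P = "\<lambda>I. \<exists>b. finite (I::'c set) \<and> b \<in> I \<rightarrow> carrier M \<and> X \<subseteq> span (b ` I)"
  have "?P X" using X span_base by (auto intro!: exI[of _ "\<lambda>x. x"])
  then obtain I where PI: "?P I" and min: "\<And>J. ?P J \<Longrightarrow> card I \<le> card J"
    using ex_has_least_nat[of ?P X card] by blast
  then obtain b where I: "finite I" and b: "b \<in> I \<rightarrow> carrier M" and XI: "X \<subseteq> span (b ` I)" by blast
  have bc: "b i \<in> carrier M" if "i \<in> I" for i using b that by auto
  \<comment> \<open>A nontrivial relation would let \<open>drop_generator\<close> produce a smaller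
    index set.\<close>
  have ind: "c i = \<zero>\<^bsub>R\<^esub>" if c: "c \<in> I \<rightarrow> carrier R" and rel: "(\<Oplus>\<^bsub>M\<^esub>i\<in>I. c i \<odot>\<^bsub>M\<^esub> b i) = \<zero>\<^bsub>M\<^esub>" and i: "i \<in> I" for c i
  proof (rule ccontr)
    assume "c i \<noteq> \<zero>\<^bsub>R\<^esub>"
    then obtain J b' where J: "J \<subset> I" "b' \<in> J \<rightarrow> carrier M" "span (b ` I) \<subseteq> span (b' ` J)"
      using drop_generator[OF pid tf I b c rel] i by blast
    then have "?P J" using XI I finite_subset[of J I] by blast
    then show False using min[of J] psubset_card_mono[OF I J(1)] by simp
  qed
  have uniq: "c i = d i" if c: "c \<in> I \<rightarrow> carrier R" and d: "d \<in> I \<rightarrow> carrier R"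
    and eq: "(\<Oplus>\<^bsub>M\<^esub>i\<in>I. c i \<odot>\<^bsub>M\<^esub> b i) = (\<Oplus>\<^bsub>M\<^esub>i\<in>I. d i \<odot>\<^bsub>M\<^esub> b i)" and i: "i \<in> I" for c d i
  proof -
    have cd: "c i \<in> carrier R" "d i \<in> carrier R" if "i \<in> I" for i using c d that by auto
    have clos: "(\<Oplus>\<^bsub>M\<^esub>i\<in>I. e i \<odot>\<^bsub>M\<^esub> b i) \<in> carrier M" if "e \<in> I \<rightarrow> carrier R" for e
      by (rule M.finsum_closed) (use bc that in auto)
    have "(\<Oplus>\<^bsub>M\<^esub>i\<in>I. (c i \<ominus>\<^bsub>R\<^esub> d i) \<odot>\<^bsub>M\<^esub> b i) \<oplus>\<^bsub>M\<^esub> (\<Oplus>\<^bsub>M\<^esub>i\<in>I. d i \<odot>\<^bsub>M\<^esub> b i)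
      = (\<Oplus>\<^bsub>M\<^esub>i\<in>I. (c i \<ominus>\<^bsub>R\<^esub> d i) \<odot>\<^bsub>M\<^esub> b i \<oplus>\<^bsub>M\<^esub> d i \<odot>\<^bsub>M\<^esub> b i)"
      by (rule M.finsum_addf[symmetric]) (use cd bc in auto)
    also have "\<dots> = (\<Oplus>\<^bsub>M\<^esub>i\<in>I. c i \<odot>\<^bsub>M\<^esub> b i)"
    proof (rule M.finsum_cong')
      fix i assume i: "i \<in> I"
      have "(c i \<ominus>\<^bsub>R\<^esub> d i) \<odot>\<^bsub>M\<^esub> b i \<oplus>\<^bsub>M\<^esub> d i \<odot>\<^bsub>M\<^esub> b i = (c i \<ominus>\<^bsub>R\<^esub> d i \<oplus>\<^bsub>R\<^esub> d i) \<odot>\<^bsub>M\<^esub> b i"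
        using cd[OF i] bc[OF i] by (simp add: smult_l_distr)
      also have "c i \<ominus>\<^bsub>R\<^esub> d i \<oplus>\<^bsub>R\<^esub> d i = c i" using cd[OF i] by (simp add: R.minus_eq R.a_assoc R.l_neg)
      finally show "(c i \<ominus>\<^bsub>R\<^esub> d i) \<odot>\<^bsub>M\<^esub> b i \<oplus>\<^bsub>M\<^esub> d i \<odot>\<^bsub>M\<^esub> b i = c i \<odot>\<^bsub>M\<^esub> b i" .
    qed (use cd bc in auto)
    finally have "(\<Oplus>\<^bsub>M\<^esub>i\<in>I. (c i \<ominus>\<^bsub>R\<^esub> d i) \<odot>\<^bsub>M\<^esub> b i) = \<zero>\<^bsub>M\<^esub>"
      using eq clos[OF d] clos[of "\<lambda>i. c i \<ominus>\<^bsub>R\<^esub> d i"] cd by (simp add: M.add.r_cancel_one Pi_iff)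
    moreover have "(\<lambda>i. c i \<ominus>\<^bsub>R\<^esub> d i) \<in> I \<rightarrow> carrier R" using cd by simp
    ultimately have "c i \<ominus>\<^bsub>R\<^esub> d i = \<zero>\<^bsub>R\<^esub>" using ind i by blast
    then show ?thesis using cd[OF i] R.r_right_minus_eq by simp
  qed
  define D where "D = span (b ` I)"
  have sm: "submodule D R M" unfolding D_def by (rule span_submodule) (use bc in auto)
  define co where "co = (\<lambda>i x. (SOME c. c \<in> I \<rightarrow> carrier R \<and> x = (\<Oplus>\<^bsub>M\<^esub>i\<in>I. c i \<odot>\<^bsub>M\<^esub> b i)) i)"
  have co: "(\<lambda>i. co i x) \<in> I \<rightarrow> carrier R \<and> x = (\<Oplus>\<^bsub>M\<^esub>i\<in>I. co i x \<odot>\<^bsub>M\<^esub> b i)" if "x \<in> D" for x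
    unfolding co_def using span_combination[OF I b, of x] that
    by (intro someI_ex[of "\<lambda>c. c \<in> I \<rightarrow> carrier R \<and> x = (\<Oplus>\<^bsub>M\<^esub>i\<in>I. c i \<odot>\<^bsub>M\<^esub> b i)"]) (auto simp: D_def)
  have coc: "co i x \<in> carrier R" if "x \<in> D" "i \<in> I" for i x using co[OF that(1)] that by auto
  \<comment> \<open>\<open>co\<close> is picked by choice for each element separately; it is linear
    because by \<open>uniq\<close> two coefficient families of the same element agree.\<close>
  have "linear_form_on R M D (co i)" if i: "i \<in> I" for i
    unfolding linear_form_on_def
  proof (intro conjI ballI sm)
    fix x assume x: "x \<in> D"
    show "co i x \<in> carrier R" using coc x i by simp
    show "co i (x \<oplus>\<^bsub>M\<^esub> y) = co i x \<oplus>\<^bsub>R\<^esub> co i y" if y: "y \<in> D" for y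
    proof (rule uniq[OF _ _ _ i])
      have xy: "x \<oplus>\<^bsub>M\<^esub> y \<in> D" using submoduleE(5)[OF sm x y] .
      show "(\<lambda>i. co i (x \<oplus>\<^bsub>M\<^esub> y)) \<in> I \<rightarrow> carrier R" using co[OF xy] by simp
      show "(\<lambda>i. co i x \<oplus>\<^bsub>R\<^esub> co i y) \<in> I \<rightarrow> carrier R" using coc x y by auto
      have "(\<Oplus>\<^bsub>M\<^esub>i\<in>I. (co i x \<oplus>\<^bsub>R\<^esub> co i y) \<odot>\<^bsub>M\<^esub> b i) = (\<Oplus>\<^bsub>M\<^esub>i\<in>I. co i x \<odot>\<^bsub>M\<^esub> b i \<oplus>\<^bsub>M\<^esub> co i y \<odot>\<^bsub>M\<^esub> b i)"
        by (rule M.finsum_cong') (use coc x y bc in \<open>auto simp: smult_l_distr\<close>)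
      also have "\<dots> = (\<Oplus>\<^bsub>M\<^esub>i\<in>I. co i x \<odot>\<^bsub>M\<^esub> b i) \<oplus>\<^bsub>M\<^esub> (\<Oplus>\<^bsub>M\<^esub>i\<in>I. co i y \<odot>\<^bsub>M\<^esub> b i)"
        by (rule M.finsum_addf) (use coc x y bc in auto)
      finally show "(\<Oplus>\<^bsub>M\<^esub>i\<in>I. co i (x \<oplus>\<^bsub>M\<^esub> y) \<odot>\<^bsub>M\<^esub> b i) = (\<Oplus>\<^bsub>M\<^esub>i\<in>I. (co i x \<oplus>\<^bsub>R\<^esub> co i y) \<odot>\<^bsub>M\<^esub> b i)"
        using co[OF x] co[OF y] co[OF xy] by simp
    qed
    show "co i (r \<odot>\<^bsub>M\<^esub> x) = r \<otimes>\<^bsub>R\<^esub> co i x" if r: "r \<in> carrier R" for r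
    proof (rule uniq[OF _ _ _ i])
      have rx: "r \<odot>\<^bsub>M\<^esub> x \<in> D" using submoduleE(4)[OF sm r x] .
      show "(\<lambda>i. co i (r \<odot>\<^bsub>M\<^esub> x)) \<in> I \<rightarrow> carrier R" using co[OF rx] by simp
      show "(\<lambda>i. r \<otimes>\<^bsub>R\<^esub> co i x) \<in> I \<rightarrow> carrier R" using coc x r by auto
      have "(\<Oplus>\<^bsub>M\<^esub>i\<in>I. (r \<otimes>\<^bsub>R\<^esub> co i x) \<odot>\<^bsub>M\<^esub> b i) = (\<Oplus>\<^bsub>M\<^esub>i\<in>I. r \<odot>\<^bsub>M\<^esub> (co i x \<odot>\<^bsub>M\<^esub> b i))"
        by (rule M.finsum_cong') (use coc x r bc in \<open>auto simp: smult_assoc1\<close>)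
      also have "\<dots> = r \<odot>\<^bsub>M\<^esub> (\<Oplus>\<^bsub>M\<^esub>i\<in>I. co i x \<odot>\<^bsub>M\<^esub> b i)"
        by (rule finsum_smult_ldistr[symmetric]) (use I coc x r bc in auto)
      finally show "(\<Oplus>\<^bsub>M\<^esub>i\<in>I. co i (r \<odot>\<^bsub>M\<^esub> x) \<odot>\<^bsub>M\<^esub> b i) = (\<Oplus>\<^bsub>M\<^esub>i\<in>I. (r \<otimes>\<^bsub>R\<^esub> co i x) \<odot>\<^bsub>M\<^esub> b i)"
        using co[OF x] co[OF rx] by simp
    qed
  qed
  then show ?thesis using I b sm XI co
    by (intro exI[of _ I] exI[of _ b] exI[of _ D] exI[of _ co]) (auto simp: D_def)
qed

section \<open>Tensor products as quotients of free abelian groups, and their detection by linear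
  forms\<close>

lemma tensor_relations_closed:
  assumes "module R M" "module R N"
  shows "tensor_relations R M N \<subseteq> carrier (free_Abelian_group (carrier M \<times> carrier N))"
proof -
  interpret M: module R M by fact
  interpret N: module R N by fact
  have fr: "Poly_Mapping.keys (frag_of p) \<subseteq> carrier M \<times> carrier N" if "p \<in> carrier M \<times> carrier N" for p
    using that by simp
  have df: "Poly_Mapping.keys (p - q) \<subseteq> carrier M \<times> carrier N"
    if "Poly_Mapping.keys p \<subseteq> carrier M \<times> carrier N" "Poly_Mapping.keys q \<subseteq> carrier M \<times> carrier N"
    for p q :: "'c \<times> 'd \<Rightarrow>\<^sub>0 int"
    using that keys_diff[of p q] by blast
  show ?thesis
    unfolding tensor_relations_def
    by (intro subsetI) (elim UnE CollectE exE conjE; simp add: df)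
qed

context
  fixes R :: "('r, 'x) ring_scheme" and M :: "('r, 'm) module" and N :: "('r, 'n) module"
  assumes M: "module R M" and N: "module R N"
begin

interpretation M: module R M by (fact M)
interpretation N: module R N by (fact N)

lemma tensor_kernel_subgroup:
  "subgroup (tensor_kernel R M N) (free_Abelian_group (carrier M \<times> carrier N))"
  unfolding tensor_kernel_def
  by (rule group.generate_is_subgroup[OF group_free_Abelian_group tensor_relations_closed[OF M N]])

lemma tensor_kernel_keys: "w \<in> tensor_kernel R M N \<Longrightarrow> Poly_Mapping.keys w \<subseteq> carrier M \<times> carrier N"
  using subgroup.mem_carrier[OF tensor_kernel_subgroup] by simp

lemma tensor_kernel_zero: "0 \<in> tensor_kernel R M N"
  using subgroup.one_closed[OF tensor_kernel_subgroup] by simp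

lemma tensor_kernel_add:
  "v \<in> tensor_kernel R M N \<Longrightarrow> w \<in> tensor_kernel R M N \<Longrightarrow> v + w \<in> tensor_kernel R M N"
  using subgroup.m_closed[OF tensor_kernel_subgroup] by simp

lemma tensor_kernel_uminus: "w \<in> tensor_kernel R M N \<Longrightarrow> - w \<in> tensor_kernel R M N"
  using subgroup.m_inv_closed[OF tensor_kernel_subgroup] tensor_kernel_keys by fastforce

lemma tensor_kernel_diff:
  "v \<in> tensor_kernel R M N \<Longrightarrow> w \<in> tensor_kernel R M N \<Longrightarrow> v - w \<in> tensor_kernel R M N"
  using tensor_kernel_add[of v "- w"] tensor_kernel_uminus[of w] by simp

lemma tensor_kernel_sum:
  "(\<And>i. i \<in> I \<Longrightarrow> w i \<in> tensor_kernel R M N) \<Longrightarrow> sum w I \<in> tensor_kernel R M N"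
  by (induction I rule: infinite_finite_induct) (auto intro: tensor_kernel_zero tensor_kernel_add)

lemma tensor_kernel_base: "w \<in> tensor_relations R M N \<Longrightarrow> w \<in> tensor_kernel R M N"
  unfolding tensor_kernel_def by (rule generate.incl)

lemma tensor_add_left:
  assumes "x \<in> carrier M" "x' \<in> carrier M" "y \<in> carrier N"
  shows "frag_of (x \<oplus>\<^bsub>M\<^esub> x', y) - frag_of (x, y) - frag_of (x', y) \<in> tensor_kernel R M N"
  by (rule tensor_kernel_base) (use assms in \<open>force simp: tensor_relations_def\<close>)

lemma tensor_add_right:
  assumes "x \<in> carrier M" "y \<in> carrier N" "y' \<in> carrier N"
  shows "frag_of (x, y \<oplus>\<^bsub>N\<^esub> y') - frag_of (x, y) - frag_of (x, y') \<in> tensor_kernel R M N"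
  by (rule tensor_kernel_base) (use assms in \<open>force simp: tensor_relations_def\<close>)

lemma tensor_smult:
  assumes "r \<in> carrier R" "x \<in> carrier M" "y \<in> carrier N"
  shows "frag_of (r \<odot>\<^bsub>M\<^esub> x, y) - frag_of (x, r \<odot>\<^bsub>N\<^esub> y) \<in> tensor_kernel R M N"
  by (rule tensor_kernel_base) (use assms in \<open>force simp: tensor_relations_def\<close>)

text \<open>The additivity relation for zero plus zero is the negative of this generator. The same
  holds on the right.\<close>

lemma tensor_zero_left:
  assumes "y \<in> carrier N" shows "frag_of (\<zero>\<^bsub>M\<^esub>, y) \<in> tensor_kernel R M N"
  using tensor_kernel_uminus[OF tensor_add_left[of "\<zero>\<^bsub>M\<^esub>" "\<zero>\<^bsub>M\<^esub>" y]] assms by simp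

lemma tensor_zero_right:
  assumes "x \<in> carrier M" shows "frag_of (x, \<zero>\<^bsub>N\<^esub>) \<in> tensor_kernel R M N"
  using tensor_kernel_uminus[OF tensor_add_right[of x "\<zero>\<^bsub>N\<^esub>" "\<zero>\<^bsub>N\<^esub>"]] assms by simp

lemma tensor_finsum_left:
  assumes "finite I" "v \<in> I \<rightarrow> carrier M" "y \<in> carrier N"
  shows "frag_of (\<Oplus>\<^bsub>M\<^esub>i\<in>I. v i, y) - (\<Sum>i\<in>I. frag_of (v i, y)) \<in> tensor_kernel R M N"
  using assms
proof (induction I rule: finite_induct)
  case empty
  then show ?case by (simp add: tensor_zero_left)
next
  case (insert i I)
  then have c: "v i \<in> carrier M" "v \<in> I \<rightarrow> carrier M" by auto
  then have "frag_of (v i \<oplus>\<^bsub>M\<^esub> (\<Oplus>\<^bsub>M\<^esub>i\<in>I. v i), y) - frag_of (v i, y) - frag_of (\<Oplus>\<^bsub>M\<^esub>i\<in>I. v i, y)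
      + (frag_of (\<Oplus>\<^bsub>M\<^esub>i\<in>I. v i, y) - (\<Sum>i\<in>I. frag_of (v i, y))) \<in> tensor_kernel R M N"
    using insert by (intro tensor_kernel_add tensor_add_left) auto
  then show ?case using insert c by (simp add: algebra_simps)
qed

end

text \<open>The map sending x tensor y to \<open>c x\<close> times y, lifted to formal sums. As
  \<open>c\<close> is known on \<open>D\<close> only, the values at pairs whose left entry lies
  outside \<open>D\<close> are left to the choice operator.\<close>

definition contraction ::
    "('r, 'm) module \<Rightarrow> ('r, 'n) module \<Rightarrow> 'm set \<Rightarrow> ('m \<Rightarrow> 'r) \<Rightarrow> ('m \<times> 'n \<Rightarrow>\<^sub>0 int) \<Rightarrow> 'n" where
  "contraction M N D c = (SOME h. h \<in> hom (free_Abelian_group (carrier M \<times> carrier N)) (add_monoid N) \<and>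
     (\<forall>x\<in>D. \<forall>y\<in>carrier N. h (frag_of (x, y)) = c x \<odot>\<^bsub>N\<^esub> y))"

context
  fixes R :: "('r, 'x) ring_scheme" and M :: "('r, 'm) module" and N :: "('r, 'n) module"
  assumes M: "module R M" and N: "module R N"
begin

interpretation M: module R M by (fact M)
interpretation N: module R N by (fact N)

lemma contraction:
  assumes "linear_form_on R M D c"
  shows "contraction M N D c \<in> hom (free_Abelian_group (carrier M \<times> carrier N)) (add_monoid N)"
    and "\<And>x y. x \<in> D \<Longrightarrow> y \<in> carrier N \<Longrightarrow> contraction M N D c (frag_of (x, y)) = c x \<odot>\<^bsub>N\<^esub> y"
proof -
  have D: "D \<subseteq> carrier M" using assms M.submoduleE(1) by (auto simp: linear_form_on_def)
  \<comment> \<open>Extension by zero outside \<open>D\<close> defines a map on all generators, and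
    freeness turns it into a homomorphism.\<close>
  obtain h where "h \<in> hom (free_Abelian_group (carrier M \<times> carrier N)) (add_monoid N)"
    "\<And>p. p \<in> carrier M \<times> carrier N \<Longrightarrow> h (frag_of p) = (if fst p \<in> D then c (fst p) \<odot>\<^bsub>N\<^esub> snd p else \<zero>\<^bsub>N\<^esub>)"
  proof (rule comm_group.free_Abelian_group_universal[OF N.a_comm_group,
        of "\<lambda>p. if fst p \<in> D then c (fst p) \<odot>\<^bsub>N\<^esub> snd p else \<zero>\<^bsub>N\<^esub>" "carrier M \<times> carrier N"])
    show "(\<lambda>p. if fst p \<in> D then c (fst p) \<odot>\<^bsub>N\<^esub> snd p else \<zero>\<^bsub>N\<^esub>) ` (carrier M \<times> carrier N) \<subseteq> carrier (add_monoid N)"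
      using assms by (auto simp: linear_form_on_def)
  qed blast
  then have "\<exists>h. h \<in> hom (free_Abelian_group (carrier M \<times> carrier N)) (add_monoid N) \<and>
     (\<forall>x\<in>D. \<forall>y\<in>carrier N. h (frag_of (x, y)) = c x \<odot>\<^bsub>N\<^esub> y)" using D by (intro exI[of _ h]) auto
  from someI_ex[OF this] show "contraction M N D c \<in> hom (free_Abelian_group (carrier M \<times> carrier N)) (add_monoid N)"
    and "\<And>x y. x \<in> D \<Longrightarrow> y \<in> carrier N \<Longrightarrow> contraction M N D c (frag_of (x, y)) = c x \<odot>\<^bsub>N\<^esub> y"
    unfolding contraction_def by blast+
qed

context
  fixes D c assumes lf: "linear_form_on R M D c"
begin

interpretation h: group_hom "free_Abelian_group (carrier M \<times> carrier N)" "add_monoid N" "contraction M N D c"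
  using contraction(1)[OF lf] N.a_group by (simp add: group_hom_def group_hom_axioms_def)

lemma contraction_closed:
  "Poly_Mapping.keys w \<subseteq> carrier M \<times> carrier N \<Longrightarrow> contraction M N D c w \<in> carrier N"
  using h.hom_closed by simp

lemma contraction_zero: "contraction M N D c 0 = \<zero>\<^bsub>N\<^esub>"
  using h.hom_one by simp

lemma contraction_add:
  assumes "Poly_Mapping.keys v \<subseteq> carrier M \<times> carrier N" "Poly_Mapping.keys w \<subseteq> carrier M \<times> carrier N"
  shows "contraction M N D c (v + w) = contraction M N D c v \<oplus>\<^bsub>N\<^esub> contraction M N D c w"
  using h.hom_mult[of v w] assms by simp

lemma contraction_uminus:
  assumes "Poly_Mapping.keys w \<subseteq> carrier M \<times> carrier N"
  shows "contraction M N D c (- w) = \<ominus>\<^bsub>N\<^esub> contraction M N D c w"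
  using h.hom_inv[of w] assms by (simp add: a_inv_def)

lemma contraction_diff:
  assumes "Poly_Mapping.keys v \<subseteq> carrier M \<times> carrier N" "Poly_Mapping.keys w \<subseteq> carrier M \<times> carrier N"
  shows "contraction M N D c (v - w) = contraction M N D c v \<ominus>\<^bsub>N\<^esub> contraction M N D c w"
  using contraction_add[of v "- w"] contraction_uminus[of w] assms by (simp add: N.minus_eq keys_minus)

end

text \<open>Only finitely many elements of the left factor occur in a certificate that a formal sum
  vanishes in the tensor product, so linear forms on a finitely generated submodule detect it.\<close>

lemma tensor_relations_finite_support:
  assumes "w \<in> tensor_relations R M N"
  shows "\<exists>X. finite X \<and> X \<subseteq> carrier M \<and>
    (\<forall>D c. linear_form_on R M D c \<longrightarrow> X \<subseteq> D \<longrightarrow> contraction M N D c w = \<zero>\<^bsub>N\<^esub>)"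
proof -
  have D: "D \<subseteq> carrier M" if "linear_form_on R M D c" for D c
    using that M.submoduleE(1) by (auto simp: linear_form_on_def)
  have cc: "c x \<in> carrier R" if "linear_form_on R M D c" "x \<in> D" for D c x
    using that by (auto simp: linear_form_on_def)
  have ca: "x \<oplus>\<^bsub>M\<^esub> y \<in> D \<and> c (x \<oplus>\<^bsub>M\<^esub> y) = c x \<oplus>\<^bsub>R\<^esub> c y" if "linear_form_on R M D c" "x \<in> D" "y \<in> D" for D c x y
    using that by (auto simp: linear_form_on_def intro: M.submoduleE(5))
  have cs: "r \<odot>\<^bsub>M\<^esub> x \<in> D \<and> c (r \<odot>\<^bsub>M\<^esub> x) = r \<otimes>\<^bsub>R\<^esub> c x" if "linear_form_on R M D c" "r \<in> carrier R" "x \<in> D" for D c r x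
    using that by (auto simp: linear_form_on_def intro: M.submoduleE(4))
  have k: "Poly_Mapping.keys (v - w) \<subseteq> carrier M \<times> carrier N"
    if "Poly_Mapping.keys v \<subseteq> carrier M \<times> carrier N" "Poly_Mapping.keys w \<subseteq> carrier M \<times> carrier N"
    for v w :: "'m \<times> 'n \<Rightarrow>\<^sub>0 int"
    using that keys_diff[of v w] by blast
  from assms consider
    (l) x x' y where "w = frag_of (x \<oplus>\<^bsub>M\<^esub> x', y) - frag_of (x, y) - frag_of (x', y)"
      "x \<in> carrier M" "x' \<in> carrier M" "y \<in> carrier N"
  | (r) x y y' where "w = frag_of (x, y \<oplus>\<^bsub>N\<^esub> y') - frag_of (x, y) - frag_of (x, y')"
      "x \<in> carrier M" "y \<in> carrier N" "y' \<in> carrier N"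
  | (s) r x y where "w = frag_of (r \<odot>\<^bsub>M\<^esub> x, y) - frag_of (x, r \<odot>\<^bsub>N\<^esub> y)"
      "r \<in> carrier R" "x \<in> carrier M" "y \<in> carrier N"
    unfolding tensor_relations_def by blast
  then show ?thesis
  proof cases
    case l
    have "contraction M N D c w = \<zero>\<^bsub>N\<^esub>" if lf: "linear_form_on R M D c" and x: "x \<in> D" "x' \<in> D" for D c
      using l lf x cc[OF lf] ca[OF lf] D[OF lf]
      by (simp add: contraction(2)[OF lf] contraction_diff[OF lf] k N.smult_l_distr N.minus_eq
          N.M.a_ac N.M.r_neg1 N.M.r_neg2 N.M.r_neg)
    \<comment> \<open>The sum of \<open>x\<close> and \<open>x'\<close> lies in \<open>D\<close> as
      well, since \<open>D\<close> is a submodule.\<close>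
    then show ?thesis using l by (intro exI[of _ "{x, x'}"]) auto
  next
    case r
    have "contraction M N D c w = \<zero>\<^bsub>N\<^esub>" if lf: "linear_form_on R M D c" and x: "x \<in> D" for D c
      using r lf x cc[OF lf] ca[OF lf] D[OF lf]
      by (simp add: contraction(2)[OF lf] contraction_diff[OF lf] k N.smult_r_distr N.minus_eq
          N.M.a_ac N.M.r_neg1 N.M.r_neg2 N.M.r_neg)
    then show ?thesis using r by (intro exI[of _ "{x}"]) auto
  next
    case s
    have "contraction M N D c w = \<zero>\<^bsub>N\<^esub>" if lf: "linear_form_on R M D c" and x: "x \<in> D" for D c
      using s lf x cc[OF lf] cs[OF lf] D[OF lf]
      by (simp add: contraction(2)[OF lf] contraction_diff[OF lf] k N.smult_assoc1[symmetric] M.R.m_comm N.minus_eq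
          N.M.r_neg)
    then show ?thesis using s by (intro exI[of _ "{x}"]) auto
  qed
qed

text \<open>An element of the kernel is built from finitely many relations, whose finite sets are
  united. One \<open>X\<close> serves all submodules \<open>D\<close> and all forms at once, so
  \<open>D\<close> may be chosen afterwards.\<close>

lemma tensor_kernel_finite_support:
  assumes "w \<in> tensor_kernel R M N"
  shows "\<exists>X. finite X \<and> X \<subseteq> carrier M \<and>
    (\<forall>D c. linear_form_on R M D c \<longrightarrow> X \<subseteq> D \<longrightarrow> contraction M N D c w = \<zero>\<^bsub>N\<^esub>)"
  using assms unfolding tensor_kernel_def
proof (induction rule: generate.induct)
  case one
  then show ?case by (auto simp: contraction_zero intro: exI[of _ "{}"])
next
  case (incl w)
  then show ?case by (rule tensor_relations_finite_support)
next
  case (inv w)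
  have w: "Poly_Mapping.keys w \<subseteq> carrier M \<times> carrier N"
    using tensor_kernel_keys[OF M N tensor_kernel_base[OF M N inv.hyps]] .
  obtain X where "finite X" "X \<subseteq> carrier M"
    "\<And>D c. linear_form_on R M D c \<Longrightarrow> X \<subseteq> D \<Longrightarrow> contraction M N D c w = \<zero>\<^bsub>N\<^esub>"
    using tensor_relations_finite_support[OF inv.hyps] by blast
  then show ?case using w by (intro exI[of _ X]) (auto simp: contraction_uminus)
next
  case (eng v w)
  then obtain X Y where "finite X" "X \<subseteq> carrier M" "finite Y" "Y \<subseteq> carrier M"
    "\<And>D c. linear_form_on R M D c \<Longrightarrow> X \<subseteq> D \<Longrightarrow> contraction M N D c v = \<zero>\<^bsub>N\<^esub>"
    "\<And>D c. linear_form_on R M D c \<Longrightarrow> Y \<subseteq> D \<Longrightarrow> contraction M N D c w = \<zero>\<^bsub>N\<^esub>" by blast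
  moreover have "Poly_Mapping.keys v \<subseteq> carrier M \<times> carrier N" "Poly_Mapping.keys w \<subseteq> carrier M \<times> carrier N"
    using eng.hyps tensor_kernel_keys[OF M N] unfolding tensor_kernel_def by blast+
  ultimately show ?case by (intro exI[of _ "X \<union> Y"]) (auto simp: contraction_add)
qed

text \<open>Expanding the left entry as the sum of the \<open>co i x\<close> times
  \<open>b i\<close> and moving the scalars to the right factor gives the claim for one generator.
  Consequently \<open>z\<close> vanishes in the tensor product as soon as all its contractions
  vanish.\<close>

lemma tensor_decomposition:
  assumes I: "finite I" and b: "b \<in> I \<rightarrow> carrier M" and lf: "\<And>i. i \<in> I \<Longrightarrow> linear_form_on R M D (co i)"
    and D: "submodule D R M" and ex: "\<And>x. x \<in> D \<Longrightarrow> x = (\<Oplus>\<^bsub>M\<^esub>i\<in>I. co i x \<odot>\<^bsub>M\<^esub> b i)"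
    and z: "Poly_Mapping.keys z \<subseteq> D \<times> carrier N"
  shows "z - (\<Sum>i\<in>I. frag_of (b i, contraction M N D (co i) z)) \<in> tensor_kernel R M N"
proof -
  have DM: "D \<subseteq> carrier M" using M.submoduleE(1)[OF D] .
  have bc: "b i \<in> carrier M" if "i \<in> I" for i using b that by auto
  have kc: "Poly_Mapping.keys z \<subseteq> carrier M \<times> carrier N" if "Poly_Mapping.keys z \<subseteq> D \<times> carrier N"
    for z :: "'m \<times> 'n \<Rightarrow>\<^sub>0 int" using that DM by auto
  show ?thesis using z
  proof (induction rule: free_Abelian_group_induct[consumes 1])
    case 1
    then show ?case using I bc lf
      by (auto simp: contraction_zero intro!: tensor_kernel_sum[OF M N] tensor_zero_right[OF M N]
          intro: tensor_kernel_uminus[OF M N, of "sum f A" for f A, simplified])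
  next
    case (2 z w)
    define Z where "Z = (\<lambda>i. contraction M N D (co i) z)"
    define W where "W = (\<lambda>i. contraction M N D (co i) w)"
    have ZW: "Z i \<in> carrier N" "W i \<in> carrier N" if "i \<in> I" for i
      using contraction_closed[OF lf[OF that]] kc 2 by (auto simp: Z_def W_def)
    have e: "contraction M N D (co i) (z - w) = Z i \<ominus>\<^bsub>N\<^esub> W i" if "i \<in> I" for i
      using contraction_diff[OF lf[OF that]] kc 2 by (simp add: Z_def W_def)
    \<comment> \<open>Additivity on the right for \<open>(Z i - W i) + W i = Z i\<close>: this
      corrects for replacing a difference of symbols by the symbol of the difference.\<close>
    have "(\<Sum>i\<in>I. frag_of (b i, Z i \<ominus>\<^bsub>N\<^esub> W i \<oplus>\<^bsub>N\<^esub> W i) - frag_of (b i, Z i \<ominus>\<^bsub>N\<^esub> W i) - frag_of (b i, W i)) \<in> tensor_kernel R M N"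
      using ZW bc by (intro tensor_kernel_sum[OF M N] tensor_add_right[OF M N]) auto
    also have "(\<Sum>i\<in>I. frag_of (b i, Z i \<ominus>\<^bsub>N\<^esub> W i \<oplus>\<^bsub>N\<^esub> W i) - frag_of (b i, Z i \<ominus>\<^bsub>N\<^esub> W i) - frag_of (b i, W i))
      = (\<Sum>i\<in>I. frag_of (b i, Z i) - frag_of (b i, Z i \<ominus>\<^bsub>N\<^esub> W i) - frag_of (b i, W i))"
      using ZW by (intro sum.cong) (simp_all add: N.minus_eq N.M.a_assoc N.M.l_neg)
    also have "\<dots> = (\<Sum>i\<in>I. frag_of (b i, Z i)) - (\<Sum>i\<in>I. frag_of (b i, Z i \<ominus>\<^bsub>N\<^esub> W i)) - (\<Sum>i\<in>I. frag_of (b i, W i))"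
      by (simp add: sum_subtractf)
    finally have "(z - (\<Sum>i\<in>I. frag_of (b i, Z i))) - (w - (\<Sum>i\<in>I. frag_of (b i, W i)))
        + ((\<Sum>i\<in>I. frag_of (b i, Z i)) - (\<Sum>i\<in>I. frag_of (b i, Z i \<ominus>\<^bsub>N\<^esub> W i)) - (\<Sum>i\<in>I. frag_of (b i, W i)))
        \<in> tensor_kernel R M N"
      using 2(3,4) by (intro tensor_kernel_add[OF M N tensor_kernel_diff[OF M N]]) (simp_all add: Z_def W_def)
    then show ?case by (simp add: e algebra_simps)
  next
    case (3 a)
    then obtain x y where a: "a = (x, y)" "x \<in> D" "y \<in> carrier N" by auto
    have c: "co i x \<in> carrier R" if "i \<in> I" for i using lf[OF that] a by (simp add: linear_form_on_def)
    have "frag_of (\<Oplus>\<^bsub>M\<^esub>i\<in>I. co i x \<odot>\<^bsub>M\<^esub> b i, y) - (\<Sum>i\<in>I. frag_of (co i x \<odot>\<^bsub>M\<^esub> b i, y))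
      + (\<Sum>i\<in>I. frag_of (co i x \<odot>\<^bsub>M\<^esub> b i, y) - frag_of (b i, co i x \<odot>\<^bsub>N\<^esub> y)) \<in> tensor_kernel R M N"
      using I a bc c
      by (intro tensor_kernel_add[OF M N] tensor_finsum_left[OF M N] tensor_kernel_sum[OF M N] tensor_smult[OF M N]) auto
    also have "(\<Sum>i\<in>I. frag_of (co i x \<odot>\<^bsub>M\<^esub> b i, y) - frag_of (b i, co i x \<odot>\<^bsub>N\<^esub> y))
      = (\<Sum>i\<in>I. frag_of (co i x \<odot>\<^bsub>M\<^esub> b i, y)) - (\<Sum>i\<in>I. frag_of (b i, contraction M N D (co i) (frag_of (x, y))))"
      using a lf by (simp add: contraction(2) sum_subtractf)
    finally show ?case using ex[OF a(2)] by (simp add: a(1))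
  qed
qed

end

text \<open>Contraction acts through the left entry and \<open>f\<close> through the right one, so
  they commute. The claim on the support is carried through the induction because additivity of
  contraction requires it.\<close>

lemma contraction_natural:
  assumes M: "module R M" and N: "module R N" and N': "module R N'"
    and f: "f \<in> linear_maps R N N'" and lf: "linear_form_on R M D c"
    and z: "Poly_Mapping.keys z \<subseteq> D \<times> carrier N"
  shows "Poly_Mapping.keys (frag_extend (\<lambda>(x, y). frag_of (x, f y)) z) \<subseteq> D \<times> carrier N' \<and>
    contraction M N' D c (frag_extend (\<lambda>(x, y). frag_of (x, f y)) z) = f (contraction M N D c z)"
proof -
  interpret M: module R M by fact
  interpret N: module R N by fact
  interpret N': module R N' by fact
  have D: "D \<subseteq> carrier M" using lf M.submoduleE(1) by (auto simp: linear_form_on_def)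
  interpret f: abelian_group_hom N N' f
    by (rule abelian_group_homI) (use f in \<open>auto simp: linear_maps_def N.abelian_group_axioms N'.abelian_group_axioms hom_def
      group_hom_def group_hom_axioms_def N.a_group N'.a_group\<close>)
  show ?thesis using z
  proof (induction rule: free_Abelian_group_induct[consumes 1])
    case 1
    then show ?case by (simp add: contraction_zero[OF M N' lf] contraction_zero[OF M N lf])
  next
    case (2 z w)
    let ?f = "frag_extend (\<lambda>(x, y). frag_of (x, f y))"
    have "Poly_Mapping.keys z \<subseteq> carrier M \<times> carrier N" "Poly_Mapping.keys w \<subseteq> carrier M \<times> carrier N"
      "Poly_Mapping.keys (?f z) \<subseteq> carrier M \<times> carrier N'" "Poly_Mapping.keys (?f w) \<subseteq> carrier M \<times> carrier N'"
      using 2 D by auto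
    moreover have "Poly_Mapping.keys (?f z - ?f w) \<subseteq> D \<times> carrier N'"
      using 2 keys_diff[of "?f z" "?f w"] by blast
    ultimately show ?case using 2 contraction_closed[OF M N lf]
      by (simp add: frag_extend_diff contraction_diff[OF M N' lf] contraction_diff[OF M N lf] a_minus_def)
  next
    case (3 a)
    then obtain x y where a: "a = (x, y)" "x \<in> D" "y \<in> carrier N" by auto
    have "c x \<in> carrier R" using lf a by (simp add: linear_form_on_def)
    then show ?case using a f
      by (auto simp: contraction(2)[OF M N' lf] contraction(2)[OF M N lf] linear_maps_def)
  qed
qed

text \<open>If the image of \<open>z\<close> vanishes, so do its contractions by all coordinate
  forms on a large enough \<open>D\<close>. These are the images under \<open>f\<close> of the
  contractions of \<open>z\<close>, which vanish by injectivity, and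
  \<open>tensor_decomposition\<close> then makes \<open>z\<close> vanish.\<close>

theorem torsion_free_imp_flat:
  fixes M :: "('r, 'm) module"
  assumes pid: "principal_domain R" and M: "module R M"
    and tf: "\<And>r x. r \<in> carrier R \<Longrightarrow> x \<in> carrier M \<Longrightarrow> r \<odot>\<^bsub>M\<^esub> x = \<zero>\<^bsub>M\<^esub> \<Longrightarrow> r = \<zero>\<^bsub>R\<^esub> \<or> x = \<zero>\<^bsub>M\<^esub>"
  shows "flat_module TYPE('n) R M"
  unfolding flat_module_def
proof (intro conjI allI impI M, elim conjE)
  fix N N' :: "('r, 'n) module" and f
  assume N: "module R N" and N': "module R N'" and f: "f \<in> linear_maps R N N'" and inj: "inj_on f (carrier N)"
  interpret M: module R M by fact
  interpret N: module R N by fact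
  interpret N': module R N' by fact
  interpret f: abelian_group_hom N N' f
    by (rule abelian_group_homI) (use f in \<open>auto simp: linear_maps_def N.abelian_group_axioms N'.abelian_group_axioms hom_def
      group_hom_def group_hom_axioms_def N.a_group N'.a_group\<close>)
  let ?f = "frag_extend (\<lambda>(x, y). frag_of (x, f y))"
  let ?F = "free_Abelian_group (carrier M \<times> carrier N)" and ?F' = "free_Abelian_group (carrier M \<times> carrier N')"
  interpret K: subgroup "tensor_kernel R M N" ?F by (rule tensor_kernel_subgroup[OF M N])
  interpret K': subgroup "tensor_kernel R M N'" ?F' by (rule tensor_kernel_subgroup[OF M N'])
  have key: "z \<in> tensor_kernel R M N"
    if z: "Poly_Mapping.keys z \<subseteq> carrier M \<times> carrier N" and fz: "?f z \<in> tensor_kernel R M N'" for z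
  proof -
    obtain X where X: "finite X" "X \<subseteq> carrier M"
      "\<And>D c. linear_form_on R M D c \<Longrightarrow> X \<subseteq> D \<Longrightarrow> contraction M N' D c (?f z) = \<zero>\<^bsub>N'\<^esub>"
      using tensor_kernel_finite_support[OF M N' fz] by blast
    \<comment> \<open>\<open>D\<close> must contain the left entries of the certificate for the
      image and also those of \<open>z\<close> itself.\<close>
    have Y: "finite (X \<union> fst ` Poly_Mapping.keys z)" "X \<union> fst ` Poly_Mapping.keys z \<subseteq> carrier M"
      using X z by auto
    obtain I :: "'m set" and b D co where I: "finite I" "b \<in> I \<rightarrow> carrier M" "submodule D R M" "X \<union> fst ` Poly_Mapping.keys z \<subseteq> D"
      and co: "\<forall>i\<in>I. linear_form_on R M D (co i)" "\<forall>x\<in>D. x = (\<Oplus>\<^bsub>M\<^esub>i\<in>I. co i x \<odot>\<^bsub>M\<^esub> b i)"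
      using M.torsion_free_coordinates[OF pid _ Y] tf by blast
    have lf: "linear_form_on R M D (co i)" if "i \<in> I" for i using that co by blast
    have zD: "Poly_Mapping.keys z \<subseteq> D \<times> carrier N" using z I by force
    have "contraction M N D (co i) z = \<zero>\<^bsub>N\<^esub>" if i: "i \<in> I" for i
    proof -
      have "f (contraction M N D (co i) z) = \<zero>\<^bsub>N'\<^esub>"
        using contraction_natural[OF M N N' f lf[OF i] zD] X(3)[OF lf[OF i]] I by simp
      then have "f (contraction M N D (co i) z) = f \<zero>\<^bsub>N\<^esub>" by simp
      then show ?thesis
        by (rule inj_onD[OF inj _ contraction_closed[OF M N lf[OF i] z]]) simp
    qed
    then have "z - (\<Sum>i\<in>I. frag_of (b i, \<zero>\<^bsub>N\<^esub>)) \<in> tensor_kernel R M N"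
      using tensor_decomposition[OF M N I(1,2) lf I(3) _ zD] co(2) by simp
    moreover have "(\<Sum>i\<in>I. frag_of (b i, \<zero>\<^bsub>N\<^esub>)) \<in> tensor_kernel R M N"
      using I(2) by (intro tensor_kernel_sum[OF M N] tensor_zero_right[OF M N]) auto
    ultimately show ?thesis using tensor_kernel_add[OF M N] by fastforce
  qed
  have ff: "Poly_Mapping.keys (?f z) \<subseteq> carrier M \<times> carrier N'" if "Poly_Mapping.keys z \<subseteq> carrier M \<times> carrier N" for z
    using that keys_frag_extend[of "\<lambda>(x, y). frag_of (x, f y)" z] by (force split: prod.splits)
  show "inj_on (tensor_map R M N' f) (carrier (tensor_product R M N))"
  proof (rule inj_onI)
    fix X Y assume XY: "X \<in> carrier (tensor_product R M N)" "Y \<in> carrier (tensor_product R M N)"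
      and eq: "tensor_map R M N' f X = tensor_map R M N' f Y"
    obtain a b where a: "a \<in> carrier ?F" "X = tensor_kernel R M N #>\<^bsub>?F\<^esub> a"
      and b: "b \<in> carrier ?F" "Y = tensor_kernel R M N #>\<^bsub>?F\<^esub> b"
      using XY by (auto simp: tensor_product_def FactGroup_def RCOSETS_def)
    have aX: "a \<in> X" using a group.rcos_self[OF group_free_Abelian_group _ K.subgroup_axioms] by simp
    have "?f a \<in> tensor_kernel R M N' #>\<^bsub>?F'\<^esub> ?f a"
      using group.rcos_self[OF group_free_Abelian_group _ K'.subgroup_axioms, of "?f a"] ff[of a] a by simp
    \<comment> \<open>\<open>tensor_map\<close> is a union over representatives, so equality of
      images yields some \<open>t\<close> in \<open>Y\<close>, equal to \<open>b\<close> modulo the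
      kernel, whose image agrees with that of \<open>a\<close>. Then \<open>key\<close> applies to
      \<open>a - t\<close>.\<close>
    then have "?f a \<in> tensor_map R M N' f Y" unfolding eq[symmetric] unfolding tensor_map_def by (rule UN_I[OF aX])
    then obtain t where t: "t \<in> Y" "?f a \<in> tensor_kernel R M N' #>\<^bsub>?F'\<^esub> ?f t" by (auto simp: tensor_map_def)
    then obtain k where k: "k \<in> tensor_kernel R M N'" "?f a = k + ?f t" by (auto simp: r_coset_def)
    obtain l where l: "l \<in> tensor_kernel R M N" "t = l + b" using t b by (auto simp: r_coset_def)
    have tk: "Poly_Mapping.keys t \<subseteq> carrier M \<times> carrier N"
      using l b keys_add[of l b] tensor_kernel_keys[OF M N l(1)] by auto
    have "?f (a - t) = k" using k by (simp add: frag_extend_diff)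
    then have "a - t \<in> tensor_kernel R M N" using key[of "a - t"] k a tk keys_diff[of a t] by auto
    then have "a - t + l \<in> tensor_kernel R M N" using l tensor_kernel_add[OF M N] by blast
    then have "a \<in> tensor_kernel R M N #>\<^bsub>?F\<^esub> b" unfolding r_coset_def using l by (auto intro!: bexI[of _ "a - t + l"])
    then show "X = Y" unfolding a(2) b(2)
      by (rule group.repr_independence[OF group_free_Abelian_group _ b(1) K.subgroup_axioms, symmetric])
  qed
qed

section \<open>Group rings\<close>

lemma (in abelian_monoid) finsum_swap:
  assumes A: "finite A" and B: "finite B" and f: "\<And>a b. a \<in> A \<Longrightarrow> b \<in> B \<Longrightarrow> f a b \<in> carrier G"
  shows "(\<Oplus>a\<in>A. \<Oplus>b\<in>B. f a b) = (\<Oplus>b\<in>B. \<Oplus>a\<in>A. f a b)"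
  using A f
proof (induction A rule: finite_induct)
  case empty
  then show ?case by simp
next
  case (insert a A)
  then have "(\<Oplus>a\<in>insert a A. \<Oplus>b\<in>B. f a b) = (\<Oplus>b\<in>B. f a b) \<oplus> (\<Oplus>b\<in>B. \<Oplus>a\<in>A. f a b)"
    by (subst finsum_insert) (auto intro!: finsum_closed)
  also have "\<dots> = (\<Oplus>b\<in>B. f a b \<oplus> (\<Oplus>a\<in>A. f a b))"
    using insert by (intro finsum_addf[symmetric]) (auto intro!: finsum_closed)
  also have "\<dots> = (\<Oplus>b\<in>B. \<Oplus>a\<in>insert a A. f a b)"
    using insert by (intro finsum_cong') (auto intro!: finsum_closed)
  finally show ?case .
qed

locale group_algebra = R: cring R + G: group G
  for R :: "('r, 'x) ring_scheme" (structure) and G :: "('g, 'y) monoid_scheme"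
begin

abbreviation RG where "RG \<equiv> group_ring R G"

abbreviation supp where "supp a \<equiv> {g. a g \<noteq> \<zero>}"

lemma carrier_group_ring_iff:
  "a \<in> carrier RG \<longleftrightarrow> (\<forall>g. a g \<in> carrier R) \<and> (\<forall>g. g \<notin> carrier G \<longrightarrow> a g = \<zero>) \<and> finite (supp a)"
  by (simp add: group_ring_def)

lemma group_ring_add: "a \<oplus>\<^bsub>RG\<^esub> b = (\<lambda>g. a g \<oplus> b g)"
  and group_ring_zero: "\<zero>\<^bsub>RG\<^esub> = (\<lambda>g. \<zero>)"
  and group_ring_one: "\<one>\<^bsub>RG\<^esub> = ring_single R \<one>\<^bsub>G\<^esub> \<one>"
  by (simp_all add: group_ring_def)

lemma carrier_group_ringI:
  "(\<And>g. a g \<in> carrier R) \<Longrightarrow> (\<And>g. g \<notin> carrier G \<Longrightarrow> a g = \<zero>) \<Longrightarrow> finite (supp a) \<Longrightarrow> a \<in> carrier RG"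
  by (simp add: carrier_group_ring_iff)

lemma group_ring_mult_supp:
  "g \<in> carrier G \<Longrightarrow> (a \<otimes>\<^bsub>RG\<^esub> b) g = (\<Oplus>h\<in>supp a. a h \<otimes> b (inv\<^bsub>G\<^esub> h \<otimes>\<^bsub>G\<^esub> g))"
  by (simp add: group_ring_def)

lemma group_ring_mult_outside: "g \<notin> carrier G \<Longrightarrow> (a \<otimes>\<^bsub>RG\<^esub> b) g = \<zero>"
  by (simp add: group_ring_def)

lemma coeff_closed: "a \<in> carrier RG \<Longrightarrow> a g \<in> carrier R"
  and coeff_outside: "a \<in> carrier RG \<Longrightarrow> g \<notin> carrier G \<Longrightarrow> a g = \<zero>"
  and supp_finite: "a \<in> carrier RG \<Longrightarrow> finite (supp a)"
  and supp_subset: "a \<in> carrier RG \<Longrightarrow> supp a \<subseteq> carrier G"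
proof -
  show "a g \<in> carrier R" if "a \<in> carrier RG" using that by (simp add: carrier_group_ring_iff)
  show z: "a g = \<zero>" if "a \<in> carrier RG" "g \<notin> carrier G" for g using that unfolding carrier_group_ring_iff by blast
  show "finite (supp a)" if "a \<in> carrier RG" using that unfolding carrier_group_ring_iff by blast
  show "supp a \<subseteq> carrier G" if "a \<in> carrier RG" using z[OF that] by blast
qed

declare coeff_closed [simp] supp_finite [simp]

text \<open>The product is defined by a sum over the support of \<open>a\<close>; any larger finite
  \<open>H\<close> will do, so sums for different elements can be taken over one index set.\<close>

lemma group_ring_mult:
  assumes "a \<in> carrier RG" "b \<in> carrier RG" "g \<in> carrier G" "finite H" "supp a \<subseteq> H"
  shows "(a \<otimes>\<^bsub>RG\<^esub> b) g = (\<Oplus>h\<in>H. a h \<otimes> b (inv\<^bsub>G\<^esub> h \<otimes>\<^bsub>G\<^esub> g))"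
proof -
  have "(a \<otimes>\<^bsub>RG\<^esub> b) g = (\<Oplus>h\<in>supp a. a h \<otimes> b (inv\<^bsub>G\<^esub> h \<otimes>\<^bsub>G\<^esub> g))"
    using assms by (rule_tac group_ring_mult_supp)
  also have "\<dots> = (\<Oplus>h\<in>H. a h \<otimes> b (inv\<^bsub>G\<^esub> h \<otimes>\<^bsub>G\<^esub> g))"
    by (rule R.add.finprod_mono_neutral_cong_left) (use assms in auto)
  finally show ?thesis .
qed

lemma finite_supp_product:
  assumes "a \<in> carrier RG" "b \<in> carrier RG"
  shows "finite ((\<lambda>(h, k). h \<otimes>\<^bsub>G\<^esub> k) ` (supp a \<times> supp b))"
    and "(\<lambda>(h, k). h \<otimes>\<^bsub>G\<^esub> k) ` (supp a \<times> supp b) \<subseteq> carrier G"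
  using assms supp_subset[of a] supp_subset[of b] by auto

text \<open>A nonzero coefficient at \<open>g\<close> forces a nonzero summand, hence a
  factorisation of \<open>g\<close> as \<open>h\<close> times \<open>inv h g\<close> through both
  supports. This bounds the support of a product by a finite set.\<close>

lemma supp_mult:
  assumes "a \<in> carrier RG" "b \<in> carrier RG"
  shows "supp (a \<otimes>\<^bsub>RG\<^esub> b) \<subseteq> (\<lambda>(h, k). h \<otimes>\<^bsub>G\<^esub> k) ` (supp a \<times> supp b)"
proof
  fix g assume "g \<in> supp (a \<otimes>\<^bsub>RG\<^esub> b)"
  then have nz: "(a \<otimes>\<^bsub>RG\<^esub> b) g \<noteq> \<zero>" by simp
  then have g: "g \<in> carrier G" using group_ring_mult_outside by blast
  have "(\<Oplus>h\<in>supp a. a h \<otimes> b (inv\<^bsub>G\<^esub> h \<otimes>\<^bsub>G\<^esub> g)) \<noteq> \<zero>"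
    using nz unfolding group_ring_mult_supp[OF g] .
  then have "\<not> (\<forall>h\<in>supp a. a h \<otimes> b (inv\<^bsub>G\<^esub> h \<otimes>\<^bsub>G\<^esub> g) = \<zero>)"
    by (metis (lifting) R.add.finprod_one_eqI)
  then obtain h where h: "h \<in> supp a" "a h \<otimes> b (inv\<^bsub>G\<^esub> h \<otimes>\<^bsub>G\<^esub> g) \<noteq> \<zero>"
    by blast
  have "b (inv\<^bsub>G\<^esub> h \<otimes>\<^bsub>G\<^esub> g) \<noteq> \<zero>" using h assms by auto
  moreover have "g = h \<otimes>\<^bsub>G\<^esub> (inv\<^bsub>G\<^esub> h \<otimes>\<^bsub>G\<^esub> g)"
    using h g supp_subset[OF assms(1)] by (auto simp: G.m_assoc[symmetric])
  ultimately show "g \<in> (\<lambda>(h, k). h \<otimes>\<^bsub>G\<^esub> k) ` (supp a \<times> supp b)" using h by force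
qed

lemma group_ring_closed:
  shows "\<zero>\<^bsub>RG\<^esub> \<in> carrier RG"
    and "a \<in> carrier RG \<Longrightarrow> b \<in> carrier RG \<Longrightarrow> a \<oplus>\<^bsub>RG\<^esub> b \<in> carrier RG"
    and "a \<in> carrier RG \<Longrightarrow> b \<in> carrier RG \<Longrightarrow> a \<otimes>\<^bsub>RG\<^esub> b \<in> carrier RG"
proof -
  show "\<zero>\<^bsub>RG\<^esub> \<in> carrier RG" by (rule carrier_group_ringI) (auto simp: group_ring_zero)
  show "a \<oplus>\<^bsub>RG\<^esub> b \<in> carrier RG" if "a \<in> carrier RG" "b \<in> carrier RG"
  proof -
    have "supp (\<lambda>g. a g \<oplus> b g) \<subseteq> supp a \<union> supp b" by auto
    then have "finite (supp (\<lambda>g. a g \<oplus> b g))" using that finite_subset by fastforce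
    then show ?thesis unfolding group_ring_add
      using that by (intro carrier_group_ringI) (auto simp: coeff_outside)
  qed
  show "a \<otimes>\<^bsub>RG\<^esub> b \<in> carrier RG" if ab: "a \<in> carrier RG" "b \<in> carrier RG"
  proof -
    have "(a \<otimes>\<^bsub>RG\<^esub> b) g \<in> carrier R" for g
      using ab by (cases "g \<in> carrier G")
        (auto simp: group_ring_mult_supp group_ring_mult_outside intro!: R.finsum_closed)
    then show ?thesis
      using finite_subset[OF supp_mult[OF ab] finite_supp_product(1)[OF ab]]
      by (intro carrier_group_ringI) (auto simp: group_ring_mult_outside)
  qed
qed

lemma ring_single_closed:
  "g \<in> carrier G \<Longrightarrow> r \<in> carrier R \<Longrightarrow> ring_single R g r \<in> carrier RG"
  by (rule carrier_group_ringI) (auto simp: ring_single_def)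

lemma ring_single_mult:
  assumes g: "g \<in> carrier G" and r: "r \<in> carrier R" and a: "a \<in> carrier RG" and x: "x \<in> carrier G"
  shows "(ring_single R g r \<otimes>\<^bsub>RG\<^esub> a) x = r \<otimes> a (inv\<^bsub>G\<^esub> g \<otimes>\<^bsub>G\<^esub> x)"
proof -
  have "supp (ring_single R g r) \<subseteq> {g}" by (auto simp: ring_single_def)
  from group_ring_mult[OF ring_single_closed[OF g r] a x _ this] show ?thesis
    using assms by (simp add: ring_single_def)
qed

lemma mult_ring_single:
  assumes g: "g \<in> carrier G" and r: "r \<in> carrier R" and a: "a \<in> carrier RG" and x: "x \<in> carrier G"
  shows "(a \<otimes>\<^bsub>RG\<^esub> ring_single R g r) x = a (x \<otimes>\<^bsub>G\<^esub> inv\<^bsub>G\<^esub> g) \<otimes> r"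
proof -
  let ?y = "x \<otimes>\<^bsub>G\<^esub> inv\<^bsub>G\<^esub> g"
  have e: "inv\<^bsub>G\<^esub> h \<otimes>\<^bsub>G\<^esub> x = g \<longleftrightarrow> h = ?y" if "h \<in> carrier G" for h
    using that g x by (metis G.inv_closed G.inv_solve_left G.inv_solve_right)
  \<comment> \<open>The index \<open>?y\<close> is adjoined to the support, because \<open>a\<close>
    may vanish there.\<close>
  have "(a \<otimes>\<^bsub>RG\<^esub> ring_single R g r) x
      = (\<Oplus>h\<in>insert ?y (supp a). a h \<otimes> ring_single R g r (inv\<^bsub>G\<^esub> h \<otimes>\<^bsub>G\<^esub> x))"
    by (rule group_ring_mult) (use a x ring_single_closed[OF g r] in auto)
  also have "\<dots> = (\<Oplus>h\<in>insert ?y (supp a). if ?y = h then a h \<otimes> r else \<zero>)"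
  proof (rule R.finsum_cong')
    fix h assume "h \<in> insert ?y (supp a)"
    then have "h \<in> carrier G" using supp_subset[OF a] g x by auto
    then show "a h \<otimes> ring_single R g r (inv\<^bsub>G\<^esub> h \<otimes>\<^bsub>G\<^esub> x) = (if ?y = h then a h \<otimes> r else \<zero>)"
      using e[of h] a by (auto simp: ring_single_def)
  qed (use a r in auto)
  also have "\<dots> = a ?y \<otimes> r"
    by (rule R.finsum_singleton) (use a r in auto)
  finally show ?thesis .
qed

text \<open>Both sides are the same double sum over \<open>h\<close> in the support of
  \<open>a\<close> and \<open>x\<close> in \<open>P\<close>, which contains the support of the
  product of \<open>a\<close> and \<open>b\<close>. For the right side the inner product is
  reindexed by \<open>y = inv h x\<close>; the translates of \<open>P\<close> cover the support of
  \<open>b\<close>.\<close>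

lemma group_ring_assoc:
  assumes a: "a \<in> carrier RG" and b: "b \<in> carrier RG" and c: "c \<in> carrier RG"
  shows "a \<otimes>\<^bsub>RG\<^esub> b \<otimes>\<^bsub>RG\<^esub> c = a \<otimes>\<^bsub>RG\<^esub> (b \<otimes>\<^bsub>RG\<^esub> c)"
proof
  fix g
  define P where "P = (\<lambda>(h, k). h \<otimes>\<^bsub>G\<^esub> k) ` (supp a \<times> supp b)"
  have P: "finite P" "P \<subseteq> carrier G" using finite_supp_product[OF a b] by (auto simp: P_def)
  have A: "h \<in> carrier G" if "h \<in> supp a" for h using supp_subset[OF a] that by auto
  note cl = group_ring_closed(3)
  show "(a \<otimes>\<^bsub>RG\<^esub> b \<otimes>\<^bsub>RG\<^esub> c) g = (a \<otimes>\<^bsub>RG\<^esub> (b \<otimes>\<^bsub>RG\<^esub> c)) g"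
  proof (cases "g \<in> carrier G")
    case g: True
    have inner: "(b \<otimes>\<^bsub>RG\<^esub> c) (inv\<^bsub>G\<^esub> h \<otimes>\<^bsub>G\<^esub> g) = (\<Oplus>x\<in>P. b (inv\<^bsub>G\<^esub> h \<otimes>\<^bsub>G\<^esub> x) \<otimes> c (inv\<^bsub>G\<^esub> x \<otimes>\<^bsub>G\<^esub> g))"
      if h: "h \<in> supp a" for h
    proof -
      have hG: "h \<in> carrier G" using A h .
      have "supp b \<subseteq> (\<lambda>x. inv\<^bsub>G\<^esub> h \<otimes>\<^bsub>G\<^esub> x) ` P"
      proof
        fix k assume k: "k \<in> supp b"
        then have "k = inv\<^bsub>G\<^esub> h \<otimes>\<^bsub>G\<^esub> (h \<otimes>\<^bsub>G\<^esub> k)" "h \<otimes>\<^bsub>G\<^esub> k \<in> P"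
          using hG h supp_subset[OF b] by (auto simp: P_def G.m_assoc[symmetric])
        then show "k \<in> (\<lambda>x. inv\<^bsub>G\<^esub> h \<otimes>\<^bsub>G\<^esub> x) ` P" by blast
      qed
      then have "(b \<otimes>\<^bsub>RG\<^esub> c) (inv\<^bsub>G\<^esub> h \<otimes>\<^bsub>G\<^esub> g)
        = (\<Oplus>y\<in>(\<lambda>x. inv\<^bsub>G\<^esub> h \<otimes>\<^bsub>G\<^esub> x) ` P. b y \<otimes> c (inv\<^bsub>G\<^esub> y \<otimes>\<^bsub>G\<^esub> (inv\<^bsub>G\<^esub> h \<otimes>\<^bsub>G\<^esub> g)))"
        by (intro group_ring_mult) (use b c P hG g in auto)
      also have "\<dots> = (\<Oplus>x\<in>P. b (inv\<^bsub>G\<^esub> h \<otimes>\<^bsub>G\<^esub> x) \<otimes> c (inv\<^bsub>G\<^esub> (inv\<^bsub>G\<^esub> h \<otimes>\<^bsub>G\<^esub> x) \<otimes>\<^bsub>G\<^esub> (inv\<^bsub>G\<^esub> h \<otimes>\<^bsub>G\<^esub> g)))"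
        by (rule R.finsum_reindex) (use b c P hG in \<open>auto simp: inj_on_def subset_iff\<close>)
      also have "\<dots> = (\<Oplus>x\<in>P. b (inv\<^bsub>G\<^esub> h \<otimes>\<^bsub>G\<^esub> x) \<otimes> c (inv\<^bsub>G\<^esub> x \<otimes>\<^bsub>G\<^esub> g))"
      proof (rule R.finsum_cong')
        fix x assume "x \<in> P"
        then have x: "x \<in> carrier G" using P by auto
        have "inv\<^bsub>G\<^esub> (inv\<^bsub>G\<^esub> h \<otimes>\<^bsub>G\<^esub> x) \<otimes>\<^bsub>G\<^esub> (inv\<^bsub>G\<^esub> h \<otimes>\<^bsub>G\<^esub> g) = inv\<^bsub>G\<^esub> x \<otimes>\<^bsub>G\<^esub> (h \<otimes>\<^bsub>G\<^esub> (inv\<^bsub>G\<^esub> h \<otimes>\<^bsub>G\<^esub> g))"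
          using x hG g by (simp add: G.inv_mult_group G.m_assoc)
        also have "h \<otimes>\<^bsub>G\<^esub> (inv\<^bsub>G\<^esub> h \<otimes>\<^bsub>G\<^esub> g) = g" using hG g by (simp add: G.m_assoc[symmetric])
        finally show "b (inv\<^bsub>G\<^esub> h \<otimes>\<^bsub>G\<^esub> x) \<otimes> c (inv\<^bsub>G\<^esub> (inv\<^bsub>G\<^esub> h \<otimes>\<^bsub>G\<^esub> x) \<otimes>\<^bsub>G\<^esub> (inv\<^bsub>G\<^esub> h \<otimes>\<^bsub>G\<^esub> g))
          = b (inv\<^bsub>G\<^esub> h \<otimes>\<^bsub>G\<^esub> x) \<otimes> c (inv\<^bsub>G\<^esub> x \<otimes>\<^bsub>G\<^esub> g)" by simp
      qed (use b c in auto)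
      finally show ?thesis .
    qed
    have "(a \<otimes>\<^bsub>RG\<^esub> b \<otimes>\<^bsub>RG\<^esub> c) g = (\<Oplus>x\<in>P. (a \<otimes>\<^bsub>RG\<^esub> b) x \<otimes> c (inv\<^bsub>G\<^esub> x \<otimes>\<^bsub>G\<^esub> g))"
      by (rule group_ring_mult) (use cl[OF a b] c g P supp_mult[OF a b] in \<open>auto simp: P_def\<close>)
    also have "\<dots> = (\<Oplus>x\<in>P. \<Oplus>h\<in>supp a. a h \<otimes> (b (inv\<^bsub>G\<^esub> h \<otimes>\<^bsub>G\<^esub> x) \<otimes> c (inv\<^bsub>G\<^esub> x \<otimes>\<^bsub>G\<^esub> g)))"
    proof (rule R.finsum_cong')
      fix x assume "x \<in> P"
      then have x: "x \<in> carrier G" using P by auto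
      have "(a \<otimes>\<^bsub>RG\<^esub> b) x \<otimes> c (inv\<^bsub>G\<^esub> x \<otimes>\<^bsub>G\<^esub> g)
        = (\<Oplus>h\<in>supp a. a h \<otimes> b (inv\<^bsub>G\<^esub> h \<otimes>\<^bsub>G\<^esub> x)) \<otimes> c (inv\<^bsub>G\<^esub> x \<otimes>\<^bsub>G\<^esub> g)"
        using group_ring_mult[OF a b x supp_finite[OF a]] by simp
      also have "\<dots> = (\<Oplus>h\<in>supp a. a h \<otimes> b (inv\<^bsub>G\<^esub> h \<otimes>\<^bsub>G\<^esub> x) \<otimes> c (inv\<^bsub>G\<^esub> x \<otimes>\<^bsub>G\<^esub> g))"
        by (rule R.finsum_ldistr) (use a b c in auto)
      finally show "(a \<otimes>\<^bsub>RG\<^esub> b) x \<otimes> c (inv\<^bsub>G\<^esub> x \<otimes>\<^bsub>G\<^esub> g)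
        = (\<Oplus>h\<in>supp a. a h \<otimes> (b (inv\<^bsub>G\<^esub> h \<otimes>\<^bsub>G\<^esub> x) \<otimes> c (inv\<^bsub>G\<^esub> x \<otimes>\<^bsub>G\<^esub> g)))"
        using a b c by (simp add: R.m_assoc)
    qed (use a b c in \<open>auto intro!: R.finsum_closed\<close>)
    also have "\<dots> = (\<Oplus>h\<in>supp a. \<Oplus>x\<in>P. a h \<otimes> (b (inv\<^bsub>G\<^esub> h \<otimes>\<^bsub>G\<^esub> x) \<otimes> c (inv\<^bsub>G\<^esub> x \<otimes>\<^bsub>G\<^esub> g)))"
      by (rule R.finsum_swap) (use a b c P in auto)
    also have "\<dots> = (\<Oplus>h\<in>supp a. a h \<otimes> (b \<otimes>\<^bsub>RG\<^esub> c) (inv\<^bsub>G\<^esub> h \<otimes>\<^bsub>G\<^esub> g))"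
      by (rule R.finsum_cong') (use a b c P cl[OF b c] in \<open>auto simp: inner intro!: R.finsum_rdistr[symmetric]\<close>)
    also have "\<dots> = (a \<otimes>\<^bsub>RG\<^esub> (b \<otimes>\<^bsub>RG\<^esub> c)) g"
      by (rule group_ring_mult[symmetric]) (use a cl[OF b c] g in auto)
    finally show ?thesis .
  qed (simp add: group_ring_mult_outside)
qed

lemma group_ring_ring: "ring RG"
proof (rule ringI)
  show "abelian_group RG"
  proof (rule abelian_groupI)
    fix a assume a: "a \<in> carrier RG"
    have "supp (\<lambda>g. \<ominus> a g) \<subseteq> supp a" by auto
    then have "(\<lambda>g. \<ominus> a g) \<in> carrier RG"
      using a finite_subset[OF _ supp_finite[OF a]] by (intro carrier_group_ringI) (auto simp: coeff_outside)
    then show "\<exists>b\<in>carrier RG. b \<oplus>\<^bsub>RG\<^esub> a = \<zero>\<^bsub>RG\<^esub>"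
      using a by (intro bexI[of _ "\<lambda>g. \<ominus> a g"]) (auto simp: group_ring_add group_ring_zero R.l_neg)
    show "\<zero>\<^bsub>RG\<^esub> \<oplus>\<^bsub>RG\<^esub> a = a" using a by (simp add: group_ring_add group_ring_zero)
    fix b assume b: "b \<in> carrier RG"
    show "a \<oplus>\<^bsub>RG\<^esub> b = b \<oplus>\<^bsub>RG\<^esub> a" using a b by (simp add: group_ring_add R.a_comm)
    show "a \<oplus>\<^bsub>RG\<^esub> b \<oplus>\<^bsub>RG\<^esub> c = a \<oplus>\<^bsub>RG\<^esub> (b \<oplus>\<^bsub>RG\<^esub> c)" if "c \<in> carrier RG" for c
      using a b that by (simp add: group_ring_add R.a_assoc)
  qed (simp_all add: group_ring_closed)
  show "monoid RG"
  proof (rule monoidI)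
    fix a assume a: "a \<in> carrier RG"
    show "\<one>\<^bsub>RG\<^esub> \<otimes>\<^bsub>RG\<^esub> a = a"
    proof
      fix g show "(\<one>\<^bsub>RG\<^esub> \<otimes>\<^bsub>RG\<^esub> a) g = a g"
        by (cases "g \<in> carrier G") (simp_all add: a group_ring_one ring_single_mult group_ring_mult_outside coeff_outside)
    qed
    show "a \<otimes>\<^bsub>RG\<^esub> \<one>\<^bsub>RG\<^esub> = a"
    proof
      fix g show "(a \<otimes>\<^bsub>RG\<^esub> \<one>\<^bsub>RG\<^esub>) g = a g"
        by (cases "g \<in> carrier G") (simp_all add: a group_ring_one mult_ring_single group_ring_mult_outside coeff_outside)
    qed
  qed (auto simp: group_ring_closed group_ring_one ring_single_closed group_ring_assoc)
  fix a b c assume abc: "a \<in> carrier RG" "b \<in> carrier RG" "c \<in> carrier RG"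
  show "(a \<oplus>\<^bsub>RG\<^esub> b) \<otimes>\<^bsub>RG\<^esub> c = a \<otimes>\<^bsub>RG\<^esub> c \<oplus>\<^bsub>RG\<^esub> b \<otimes>\<^bsub>RG\<^esub> c"
  proof
    fix g show "((a \<oplus>\<^bsub>RG\<^esub> b) \<otimes>\<^bsub>RG\<^esub> c) g = (a \<otimes>\<^bsub>RG\<^esub> c \<oplus>\<^bsub>RG\<^esub> b \<otimes>\<^bsub>RG\<^esub> c) g"
    proof (cases "g \<in> carrier G")
      case g: True
      let ?H = "supp a \<union> supp b"
      have "((a \<oplus>\<^bsub>RG\<^esub> b) \<otimes>\<^bsub>RG\<^esub> c) g = (\<Oplus>h\<in>?H. (a \<oplus>\<^bsub>RG\<^esub> b) h \<otimes> c (inv\<^bsub>G\<^esub> h \<otimes>\<^bsub>G\<^esub> g))"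
        by (rule group_ring_mult) (use abc g group_ring_closed(2)[of a b] in \<open>auto simp: group_ring_add\<close>)
      also have "\<dots> = (\<Oplus>h\<in>?H. a h \<otimes> c (inv\<^bsub>G\<^esub> h \<otimes>\<^bsub>G\<^esub> g) \<oplus> b h \<otimes> c (inv\<^bsub>G\<^esub> h \<otimes>\<^bsub>G\<^esub> g))"
        using abc by (intro R.finsum_cong') (auto simp: group_ring_add R.l_distr)
      also have "\<dots> = (\<Oplus>h\<in>?H. a h \<otimes> c (inv\<^bsub>G\<^esub> h \<otimes>\<^bsub>G\<^esub> g)) \<oplus> (\<Oplus>h\<in>?H. b h \<otimes> c (inv\<^bsub>G\<^esub> h \<otimes>\<^bsub>G\<^esub> g))"
        using abc by (intro R.finsum_addf) auto
      also have "\<dots> = (a \<otimes>\<^bsub>RG\<^esub> c) g \<oplus> (b \<otimes>\<^bsub>RG\<^esub> c) g"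
        using abc g group_ring_mult[of a c g ?H] group_ring_mult[of b c g ?H] by auto
      finally show ?thesis by (simp add: group_ring_add)
    qed (simp add: group_ring_add group_ring_mult_outside)
  qed
  show "c \<otimes>\<^bsub>RG\<^esub> (a \<oplus>\<^bsub>RG\<^esub> b) = c \<otimes>\<^bsub>RG\<^esub> a \<oplus>\<^bsub>RG\<^esub> c \<otimes>\<^bsub>RG\<^esub> b"
  proof
    fix g show "(c \<otimes>\<^bsub>RG\<^esub> (a \<oplus>\<^bsub>RG\<^esub> b)) g = (c \<otimes>\<^bsub>RG\<^esub> a \<oplus>\<^bsub>RG\<^esub> c \<otimes>\<^bsub>RG\<^esub> b) g"
    proof (cases "g \<in> carrier G")
      case g: True
      let ?H = "supp c"
      have "(c \<otimes>\<^bsub>RG\<^esub> (a \<oplus>\<^bsub>RG\<^esub> b)) g = (\<Oplus>h\<in>?H. c h \<otimes> (a \<oplus>\<^bsub>RG\<^esub> b) (inv\<^bsub>G\<^esub> h \<otimes>\<^bsub>G\<^esub> g))"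
        by (rule group_ring_mult) (use abc g in \<open>auto simp: group_ring_closed\<close>)
      also have "\<dots> = (\<Oplus>h\<in>?H. c h \<otimes> a (inv\<^bsub>G\<^esub> h \<otimes>\<^bsub>G\<^esub> g) \<oplus> c h \<otimes> b (inv\<^bsub>G\<^esub> h \<otimes>\<^bsub>G\<^esub> g))"
        using abc by (intro R.finsum_cong') (auto simp: group_ring_add R.r_distr)
      also have "\<dots> = (\<Oplus>h\<in>?H. c h \<otimes> a (inv\<^bsub>G\<^esub> h \<otimes>\<^bsub>G\<^esub> g)) \<oplus> (\<Oplus>h\<in>?H. c h \<otimes> b (inv\<^bsub>G\<^esub> h \<otimes>\<^bsub>G\<^esub> g))"
        using abc by (intro R.finsum_addf) auto
      also have "\<dots> = (c \<otimes>\<^bsub>RG\<^esub> a) g \<oplus> (c \<otimes>\<^bsub>RG\<^esub> b) g"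
        using abc g group_ring_mult[of c a g ?H] group_ring_mult[of c b g ?H] by auto
      finally show ?thesis by (simp add: group_ring_add)
    qed (simp add: group_ring_add group_ring_mult_outside)
  qed
qed

sublocale RG: ring RG by (rule group_ring_ring)

lemma group_ring_uminus:
  assumes "a \<in> carrier RG" shows "\<ominus>\<^bsub>RG\<^esub> a = (\<lambda>g. \<ominus> a g)"
proof -
  have "supp (\<lambda>g. \<ominus> a g) \<subseteq> supp a" by auto
  then have "(\<lambda>g. \<ominus> a g) \<in> carrier RG"
    using assms finite_subset[OF _ supp_finite[OF assms]] by (intro carrier_group_ringI) (auto simp: coeff_outside)
  then show ?thesis
    by (intro RG.minus_equality) (use assms in \<open>auto simp: group_ring_add group_ring_zero R.l_neg\<close>)
qed

lemma ring_single_add: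
  "r \<in> carrier R \<Longrightarrow> s \<in> carrier R \<Longrightarrow> ring_single R g (r \<oplus> s) = ring_single R g r \<oplus>\<^bsub>RG\<^esub> ring_single R g s"
  by (auto simp: ring_single_def group_ring_add)

lemma ring_single_times:
  assumes "g \<in> carrier G" "h \<in> carrier G" "r \<in> carrier R" "s \<in> carrier R"
  shows "ring_single R g r \<otimes>\<^bsub>RG\<^esub> ring_single R h s = ring_single R (g \<otimes>\<^bsub>G\<^esub> h) (r \<otimes> s)"
proof
  fix x
  have "inv\<^bsub>G\<^esub> g \<otimes>\<^bsub>G\<^esub> x = h \<longleftrightarrow> x = g \<otimes>\<^bsub>G\<^esub> h" if "x \<in> carrier G"
    using that assms by (metis G.inv_solve_left)
  then show "(ring_single R g r \<otimes>\<^bsub>RG\<^esub> ring_single R h s) x = ring_single R (g \<otimes>\<^bsub>G\<^esub> h) (r \<otimes> s) x"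
    using assms ring_single_mult[OF assms(1,3) ring_single_closed[OF assms(2,4)], of x]
    by (cases "x \<in> carrier G") (auto simp: group_ring_mult_outside ring_single_def)
qed

section \<open>The augmentation homomorphism and the trivial module\<close>

definition augmentation :: "('g \<Rightarrow> 'r) \<Rightarrow> 'r" where
  "augmentation a = (\<Oplus>g\<in>supp a. a g)"

lemma augmentation_eq:
  assumes "a \<in> carrier RG" "finite H" "supp a \<subseteq> H"
  shows "augmentation a = (\<Oplus>g\<in>H. a g)"
  unfolding augmentation_def by (rule R.add.finprod_mono_neutral_cong_left) (use assms in auto)

lemma augmentation_closed: "a \<in> carrier RG \<Longrightarrow> augmentation a \<in> carrier R"
  by (auto simp: augmentation_def intro!: R.finsum_closed)

lemma augmentation_add:
  assumes "a \<in> carrier RG" "b \<in> carrier RG"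
  shows "augmentation (a \<oplus>\<^bsub>RG\<^esub> b) = augmentation a \<oplus> augmentation b"
proof -
  let ?H = "supp a \<union> supp b"
  have "augmentation (a \<oplus>\<^bsub>RG\<^esub> b) = (\<Oplus>g\<in>?H. (a \<oplus>\<^bsub>RG\<^esub> b) g)"
    by (rule augmentation_eq) (use assms in \<open>auto simp: group_ring_add group_ring_closed(2)[unfolded group_ring_add]\<close>)
  also have "\<dots> = (\<Oplus>g\<in>?H. a g \<oplus> b g)" by (simp add: group_ring_add)
  also have "\<dots> = (\<Oplus>g\<in>?H. a g) \<oplus> (\<Oplus>g\<in>?H. b g)"
    by (rule R.finsum_addf) (use assms in auto)
  finally show ?thesis using assms augmentation_eq[of a ?H] augmentation_eq[of b ?H] by auto
qed

text \<open>For \<open>h\<close> in the support of \<open>a\<close>, the translate of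
  \<open>P\<close> by the inverse of \<open>h\<close> contains the support of \<open>b\<close>, so
  summing the translated coefficients over \<open>P\<close> gives the augmentation of
  \<open>b\<close> for every such \<open>h\<close>.\<close>

lemma augmentation_mult:
  assumes a: "a \<in> carrier RG" and b: "b \<in> carrier RG"
  shows "augmentation (a \<otimes>\<^bsub>RG\<^esub> b) = augmentation a \<otimes> augmentation b"
proof -
  define P where "P = (\<lambda>(h, k). h \<otimes>\<^bsub>G\<^esub> k) ` (supp a \<times> supp b)"
  have P: "finite P" "P \<subseteq> carrier G" using finite_supp_product[OF a b] by (auto simp: P_def)
  have inner: "augmentation b = (\<Oplus>x\<in>P. b (inv\<^bsub>G\<^esub> h \<otimes>\<^bsub>G\<^esub> x))" if h: "h \<in> supp a" for h
  proof -
    have hG: "h \<in> carrier G" using supp_subset[OF a] h by auto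
    have "supp b \<subseteq> (\<lambda>x. inv\<^bsub>G\<^esub> h \<otimes>\<^bsub>G\<^esub> x) ` P"
    proof
      fix k assume k: "k \<in> supp b"
      then have "k = inv\<^bsub>G\<^esub> h \<otimes>\<^bsub>G\<^esub> (h \<otimes>\<^bsub>G\<^esub> k)" "h \<otimes>\<^bsub>G\<^esub> k \<in> P"
        using hG h supp_subset[OF b] by (auto simp: P_def G.m_assoc[symmetric])
      then show "k \<in> (\<lambda>x. inv\<^bsub>G\<^esub> h \<otimes>\<^bsub>G\<^esub> x) ` P" by blast
    qed
    then have "augmentation b = (\<Oplus>y\<in>(\<lambda>x. inv\<^bsub>G\<^esub> h \<otimes>\<^bsub>G\<^esub> x) ` P. b y)"
      using augmentation_eq[OF b] P by simp
    also have "\<dots> = (\<Oplus>x\<in>P. b (inv\<^bsub>G\<^esub> h \<otimes>\<^bsub>G\<^esub> x))"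
      by (rule R.finsum_reindex) (use b P hG in \<open>auto simp: inj_on_def subset_iff\<close>)
    finally show ?thesis .
  qed
  have "augmentation (a \<otimes>\<^bsub>RG\<^esub> b) = (\<Oplus>x\<in>P. (a \<otimes>\<^bsub>RG\<^esub> b) x)"
    by (rule augmentation_eq) (use P supp_mult[OF a b] group_ring_closed(3)[OF a b] in \<open>auto simp: P_def\<close>)
  also have "\<dots> = (\<Oplus>x\<in>P. \<Oplus>h\<in>supp a. a h \<otimes> b (inv\<^bsub>G\<^esub> h \<otimes>\<^bsub>G\<^esub> x))"
    by (rule R.finsum_cong') (use a b P group_ring_mult[OF a b _ supp_finite[OF a]] in \<open>auto intro!: R.finsum_closed\<close>)
  also have "\<dots> = (\<Oplus>h\<in>supp a. \<Oplus>x\<in>P. a h \<otimes> b (inv\<^bsub>G\<^esub> h \<otimes>\<^bsub>G\<^esub> x))"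
    by (rule R.finsum_swap) (use a b P in auto)
  also have "\<dots> = (\<Oplus>h\<in>supp a. a h \<otimes> augmentation b)"
    by (rule R.finsum_cong') (use a b P augmentation_closed[OF b] in \<open>auto simp: inner R.finsum_rdistr intro!: R.finsum_closed\<close>)
  also have "\<dots> = augmentation a \<otimes> augmentation b"
    unfolding augmentation_def[of a] by (rule R.finsum_ldistr[symmetric]) (use a augmentation_closed[OF b] in auto)
  finally show ?thesis .
qed

lemma augmentation_one: "augmentation \<one>\<^bsub>RG\<^esub> = \<one>"
proof -
  have "augmentation \<one>\<^bsub>RG\<^esub> = (\<Oplus>g\<in>{\<one>\<^bsub>G\<^esub>}. \<one>\<^bsub>RG\<^esub> g)"
    by (rule augmentation_eq[OF RG.one_closed]) (auto simp: group_ring_one ring_single_def)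
  then show ?thesis by (simp add: group_ring_one ring_single_def)
qed

lemma trivial_module_left_module: "left_module RG (trivial_module R G)"
proof -
  have eq: "trivial_module R G = \<lparr>carrier = carrier R, monoid.mult = undefined, monoid.one = undefined,
      zero = \<zero>, add = (\<oplus>), smult = (\<lambda>a x. augmentation a \<otimes> x)\<rparr>"
    by (simp add: trivial_module_def augmentation_def)
  have "abelian_group (trivial_module R G)"
    unfolding eq by (rule abelian_groupI) (auto simp: R.a_ac intro: bexI[of _ "\<ominus> x" for x] R.l_neg)
  then show ?thesis
    unfolding left_module_def left_module_axioms_def
    by (auto simp: eq group_ring_ring augmentation_closed augmentation_add augmentation_mult augmentation_one
        R.l_distr R.r_distr R.m_assoc)
qed

end

lemma regular_module_left_module:
  assumes "ring A" shows "left_module A (regular_module A)"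
proof -
  interpret A: ring A by fact
  have "abelian_group (regular_module A)"
    unfolding regular_module_def by (rule abelian_groupI) (auto simp: A.a_ac intro: bexI[of _ "\<ominus>\<^bsub>A\<^esub> x" for x] A.l_neg)
  then show ?thesis
    unfolding left_module_def left_module_axioms_def
    by (auto simp: regular_module_def A.ring_axioms A.l_distr A.r_distr A.m_assoc)
qed

section \<open>The cochain complex\<close>

context left_module
begin

lemma smult_r_null: "a \<in> carrier A \<Longrightarrow> a \<odot> \<zero> = \<zero>"
  using smult_r_distr[of a "\<zero>" "\<zero>"] smult_closed[of a "\<zero>"] by (simp add: M.add.l_cancel_one)

lemma smult_l_null: "x \<in> carrier M \<Longrightarrow> \<zero>\<^bsub>A\<^esub> \<odot> x = \<zero>"
  using smult_l_distr[of "\<zero>\<^bsub>A\<^esub>" "\<zero>\<^bsub>A\<^esub>" x] smult_closed[of "\<zero>\<^bsub>A\<^esub>" x] by (simp add: M.add.l_cancel_one)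

lemma smult_l_minus:
  assumes "a \<in> carrier A" "x \<in> carrier M" shows "(\<ominus>\<^bsub>A\<^esub> a) \<odot> x = \<ominus> (a \<odot> x)"
proof -
  have "(\<ominus>\<^bsub>A\<^esub> a) \<odot> x \<oplus> a \<odot> x = \<zero>"
    using assms smult_l_distr[of "\<ominus>\<^bsub>A\<^esub> a" a x] by (simp add: A.l_neg smult_l_null)
  then show ?thesis using assms by (simp add: M.minus_equality smult_closed)
qed

lemma smult_r_minus:
  assumes "a \<in> carrier A" "x \<in> carrier M" shows "a \<odot> (\<ominus> x) = \<ominus> (a \<odot> x)"
proof -
  have "a \<odot> (\<ominus> x) \<oplus> a \<odot> x = \<zero>"
    using assms smult_r_distr[of a "\<ominus> x" x] by (simp add: M.l_neg smult_r_null)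
  then show ?thesis using assms by (simp add: M.minus_equality smult_closed)
qed

lemma smult_finsum:
  assumes "a \<in> carrier A" "f \<in> I \<rightarrow> carrier M"
  shows "a \<odot> (\<Oplus>i\<in>I. f i) = (\<Oplus>i\<in>I. a \<odot> f i)"
  using assms(2)
proof (induction I rule: infinite_finite_induct)
  case (insert i I)
  then have "f i \<in> carrier M" "f \<in> I \<rightarrow> carrier M" by auto
  with insert assms(1) show ?case
    by (simp add: smult_r_distr M.finsum_closed smult_closed Pi_iff)
qed (simp_all add: smult_r_null assms)

abbreviation sign where "sign i x \<equiv> alternating_sign M i x"

lemma sign_closed [simp]: "x \<in> carrier M \<Longrightarrow> sign i x \<in> carrier M"
  by (simp add: alternating_sign_def)

text \<open>Reading signs as scalars of the ring lets them pass through sums by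
  \<open>smult_finsum\<close>.\<close>

lemma sign_eq_smult: "x \<in> carrier M \<Longrightarrow> sign i x = (if even i then \<one>\<^bsub>A\<^esub> else \<ominus>\<^bsub>A\<^esub> \<one>\<^bsub>A\<^esub>) \<odot> x"
  by (simp add: alternating_sign_def smult_one smult_l_minus)

lemma sign_Suc: "x \<in> carrier M \<Longrightarrow> sign (Suc i) x = \<ominus> sign i x"
  by (simp add: alternating_sign_def)

lemma sign_sign: "x \<in> carrier M \<Longrightarrow> sign i (sign j x) = sign (i + j) x"
  by (simp add: alternating_sign_def)

lemma sign_add: "x \<in> carrier M \<Longrightarrow> y \<in> carrier M \<Longrightarrow> sign i (x \<oplus> y) = sign i x \<oplus> sign i y"
  by (simp add: alternating_sign_def M.minus_add M.a_comm)

lemma sign_smult: "a \<in> carrier A \<Longrightarrow> x \<in> carrier M \<Longrightarrow> a \<odot> sign i x = sign i (a \<odot> x)"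
  by (simp add: alternating_sign_def smult_r_minus)

lemma sign_finsum: "f \<in> I \<rightarrow> carrier M \<Longrightarrow> sign i (\<Oplus>k\<in>I. f k) = (\<Oplus>k\<in>I. sign i (f k))"
proof -
  assume f: "f \<in> I \<rightarrow> carrier M"
  then have fc: "f k \<in> carrier M" if "k \<in> I" for k using that by auto
  let ?a = "if even i then \<one>\<^bsub>A\<^esub> else \<ominus>\<^bsub>A\<^esub> \<one>\<^bsub>A\<^esub>"
  have "sign i (\<Oplus>k\<in>I. f k) = ?a \<odot> (\<Oplus>k\<in>I. f k)"
    by (rule sign_eq_smult) (rule M.finsum_closed[OF f])
  also have "\<dots> = (\<Oplus>k\<in>I. ?a \<odot> f k)" by (rule smult_finsum) (use f in auto)
  also have "\<dots> = (\<Oplus>k\<in>I. sign i (f k))"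
  proof (rule M.finsum_cong')
    show "(\<lambda>k. sign i (f k)) \<in> I \<rightarrow> carrier M" using fc by simp
    show "?a \<odot> f k = sign i (f k)" if "k \<in> I" for k by (rule sign_eq_smult[symmetric]) (rule fc[OF that])
  qed simp
  finally show ?thesis .
qed

lemma finsum_shift:
  assumes "\<And>i. i \<le> n \<Longrightarrow> f i \<in> carrier M"
  shows "(\<Oplus>i\<in>{..n}. f i) = f 0 \<oplus> (\<Oplus>i\<in>{..<n}. f (Suc i))"
  using assms
proof (induction n)
  case (Suc n)
  have "(\<Oplus>i\<in>{..Suc n}. f i) = f (Suc n) \<oplus> (f 0 \<oplus> (\<Oplus>i\<in>{..<n}. f (Suc i)))"
    using Suc by (subst M.finsum_Suc) auto
  also have "\<dots> = f 0 \<oplus> (f (Suc n) \<oplus> (\<Oplus>i\<in>{..<n}. f (Suc i)))"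
    using Suc.prems by (intro M.a_lcomm M.finsum_closed) auto
  also have "f (Suc n) \<oplus> (\<Oplus>i\<in>{..<n}. f (Suc i)) = (\<Oplus>i\<in>{..<Suc n}. f (Suc i))"
    using Suc.prems by (simp add: lessThan_Suc Pi_iff)
  finally show ?case .
qed simp

text \<open>\<open>F j i\<close> stands for the j-th face of the i-th face. The terms at
  \<open>(j, i)\<close> and \<open>(i, j - 1)\<close> for \<open>i < j\<close> are equal with
  opposite signs. The induction on \<open>N\<close> makes the new row cancel the new column, so no
  explicit pairing of the index square is required.\<close>

lemma cosimplicial_cancellation:
  assumes "\<And>i j. i \<le> N \<Longrightarrow> j \<le> Suc N \<Longrightarrow> F j i \<in> carrier M"
    and "\<And>i j. i < j \<Longrightarrow> j \<le> Suc N \<Longrightarrow> F j i = F i (j - 1)"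
  shows "(\<Oplus>j\<in>{..Suc N}. \<Oplus>i\<in>{..N}. sign (i + j) (F j i)) = \<zero>"
  using assms
proof (induction N)
  case 0
  then have "F 1 0 = F 0 0" "F 0 0 \<in> carrier M" "F 1 0 \<in> carrier M" by auto
  then show ?case by (simp add: alternating_sign_def M.l_neg atMost_Suc)
next
  case (Suc N)
  have cl: "F j i \<in> carrier M" if "i \<le> Suc N" "j \<le> Suc (Suc N)" for i j using Suc.prems that by auto
  \<comment> \<open>\<open>?P\<close> is the old square, \<open>?Y\<close> the new column
    \<open>i = N + 1\<close> and \<open>?Z\<close> together with the corner \<open>?t\<close> the
    new row \<open>j = N + 2\<close>. \<open>?X\<close> is that row rewritten by the face identity,
    with signs opposite to \<open>?Y\<close>.\<close>
  let ?P = "\<Oplus>j\<in>{..Suc N}. \<Oplus>i\<in>{..N}. sign (i + j) (F j i)"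
  let ?Y = "\<Oplus>j\<in>{..Suc N}. sign (Suc N + j) (F j (Suc N))"
  let ?Z = "\<Oplus>i\<in>{..N}. sign (i + Suc (Suc N)) (F (Suc (Suc N)) i)"
  let ?t = "sign (Suc N + Suc (Suc N)) (F (Suc (Suc N)) (Suc N))"
  let ?X = "\<Oplus>i\<in>{..Suc N}. sign (i + Suc (Suc N)) (F i (Suc N))"
  have P: "?P = \<zero>" using Suc by auto
  have c: "?Y \<in> carrier M" "?Z \<in> carrier M" "?t \<in> carrier M" "?X \<in> carrier M"
    using cl by (auto intro!: M.finsum_closed)
  have "(\<Oplus>j\<in>{..Suc (Suc N)}. \<Oplus>i\<in>{..Suc N}. sign (i + j) (F j i))
      = (\<Oplus>j\<in>{..Suc (Suc N)}. sign (Suc N + j) (F j (Suc N)) \<oplus> (\<Oplus>i\<in>{..N}. sign (i + j) (F j i)))"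
    by (rule M.finsum_cong') (use cl in \<open>auto intro!: M.finsum_closed M.a_closed M.finsum_Suc\<close>)
  also have "\<dots> = (\<Oplus>j\<in>{..Suc (Suc N)}. sign (Suc N + j) (F j (Suc N)))
      \<oplus> (\<Oplus>j\<in>{..Suc (Suc N)}. \<Oplus>i\<in>{..N}. sign (i + j) (F j i))"
    by (rule M.finsum_addf) (use cl in \<open>auto intro!: M.finsum_closed\<close>)
  also have "(\<Oplus>j\<in>{..Suc (Suc N)}. sign (Suc N + j) (F j (Suc N))) = ?t \<oplus> ?Y"
    by (rule M.finsum_Suc) (use cl in auto)
  also have "(\<Oplus>j\<in>{..Suc (Suc N)}. \<Oplus>i\<in>{..N}. sign (i + j) (F j i)) = ?Z \<oplus> ?P"
    by (rule M.finsum_Suc) (use cl in \<open>auto intro!: M.finsum_closed\<close>)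
  also have "?t \<oplus> ?Y \<oplus> (?Z \<oplus> ?P) = (?t \<oplus> ?Z) \<oplus> ?Y"
    unfolding P using c by (simp add: M.a_ac)
  also have "?t \<oplus> ?Z = ?X"
  proof -
    have "?X = sign (Suc N + Suc (Suc N)) (F (Suc N) (Suc N)) \<oplus> (\<Oplus>i\<in>{..N}. sign (i + Suc (Suc N)) (F i (Suc N)))"
      by (rule M.finsum_Suc) (use cl in auto)
    also have "F (Suc N) (Suc N) = F (Suc (Suc N)) (Suc N)"
      using Suc.prems(2)[of "Suc N" "Suc (Suc N)"] by simp
    also have "(\<Oplus>i\<in>{..N}. sign (i + Suc (Suc N)) (F i (Suc N))) = ?Z"
    proof (rule M.finsum_cong')
      fix i assume "i \<in> {..N}"
      then show "sign (i + Suc (Suc N)) (F i (Suc N)) = sign (i + Suc (Suc N)) (F (Suc (Suc N)) i)"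
        using Suc.prems(2)[of i "Suc (Suc N)"] by simp
    qed (use cl in auto)
    finally show ?thesis by simp
  qed
  also have "?X \<oplus> ?Y = (\<Oplus>i\<in>{..Suc N}. sign (i + Suc (Suc N)) (F i (Suc N)) \<oplus> sign (Suc N + i) (F i (Suc N)))"
    by (rule M.finsum_addf[symmetric]) (use cl in auto)
  also have "\<dots> = \<zero>"
  proof (rule M.add.finprod_one_eqI)
    fix i assume "i \<in> {..Suc N}"
    then have x: "F i (Suc N) \<in> carrier M" using cl by auto
    have "i + Suc (Suc N) = Suc (Suc N + i)" by simp
    then show "sign (i + Suc (Suc N)) (F i (Suc N)) \<oplus> sign (Suc N + i) (F i (Suc N)) = \<zero>"
      using x by (simp only: sign_Suc) (simp add: M.l_neg)
  qed
  finally show ?case .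
qed

end

section \<open>Merging adjacent entries of a tuple\<close>

definition merge :: "('g, 'y) monoid_scheme \<Rightarrow> nat \<Rightarrow> 'g list \<Rightarrow> 'g list" where
  "merge G j gs = take j gs @ [gs ! j \<otimes>\<^bsub>G\<^esub> gs ! Suc j] @ drop (j + 2) gs"

lemma merge_0: "merge G 0 (x # y # gs) = (x \<otimes>\<^bsub>G\<^esub> y) # gs"
  and merge_Suc: "merge G (Suc j) (x # gs) = x # merge G j gs"
  by (simp_all add: merge_def)

lemma length_merge: "Suc j < length gs \<Longrightarrow> length (merge G j gs) = length gs - 1"
  by (simp add: merge_def)

lemma set_merge:
  "Suc j < length gs \<Longrightarrow> set gs \<subseteq> H \<Longrightarrow> (\<And>x y. x \<in> H \<Longrightarrow> y \<in> H \<Longrightarrow> x \<otimes>\<^bsub>G\<^esub> y \<in> H) \<Longrightarrow> set (merge G j gs) \<subseteq> H"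
proof -
  assume j: "Suc j < length gs" and gs: "set gs \<subseteq> H" and m: "\<And>x y. x \<in> H \<Longrightarrow> y \<in> H \<Longrightarrow> x \<otimes>\<^bsub>G\<^esub> y \<in> H"
  have "gs ! j \<otimes>\<^bsub>G\<^esub> gs ! Suc j \<in> H" using j gs by (intro m subsetD[OF gs] nth_mem) auto
  then show ?thesis
    using gs set_take_subset[of j gs] set_drop_subset[of "j + 2" gs] by (auto simp: merge_def)
qed

text \<open>Removing common heads reduces to \<open>a = 0\<close>. Associativity enters only if
  \<open>b = 1\<close>, when both merges involve the same entry; otherwise they act on disjoint
  positions.\<close>

lemma (in group) merge_merge:
  "a < b \<Longrightarrow> Suc b < length gs \<Longrightarrow> set gs \<subseteq> carrier G \<Longrightarrow>
    merge G a (merge G b gs) = merge G (b - 1) (merge G a gs)"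
proof (induction a arbitrary: b gs)
  case 0
  then obtain b' where b: "b = Suc b'" by (cases b) auto
  with 0 obtain x y z gs' where gs: "gs = x # y # z # gs'"
    by (cases gs; cases "tl gs"; cases "tl (tl gs)") auto
  show ?case
  proof (cases b')
    case 0
    then show ?thesis using \<open>set gs \<subseteq> carrier G\<close> by (simp add: gs b merge_0 merge_Suc m_assoc)
  next
    case (Suc c)
    then show ?thesis by (simp add: gs b merge_0 merge_Suc)
  qed
next
  case (Suc a)
  then obtain b' where b: "b = Suc b'" by (cases b) auto
  with Suc.prems obtain x gs' where gs: "gs = x # gs'" by (cases gs) auto
  obtain c where c: "b' = Suc c" using Suc.prems b by (cases b') auto
  have "merge G a (merge G b' gs') = merge G (b' - 1) (merge G a gs')"
    using Suc b gs by (intro Suc.IH) auto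
  then show ?case by (simp add: b gs c merge_Suc)
qed

lemma butlast_merge: "Suc (Suc j) < length gs \<Longrightarrow> butlast (merge G j gs) = merge G j (butlast gs)"
proof (induction j arbitrary: gs)
  case 0
  then obtain x y z gs' where gs: "gs = x # y # z # gs'"
    by (cases gs; cases "tl gs"; cases "tl (tl gs)") auto
  show ?case by (simp add: gs merge_0)
next
  case (Suc j)
  then obtain x gs' where gs: "gs = x # gs'" by (cases gs) auto
  have "merge G j gs' \<noteq> []" by (simp add: merge_def)
  moreover have "gs' \<noteq> []" using Suc.prems gs by auto
  ultimately show ?case using Suc.IH[of gs'] Suc.prems by (simp add: gs merge_Suc)
qed

text \<open>The last entry after this merge is the product of the last two, so dropping it drops
  both factors.\<close>

lemma butlast_merge_last: "length gs = Suc (Suc n) \<Longrightarrow> butlast (merge G n gs) = butlast (butlast gs)"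
proof (induction n arbitrary: gs)
  case 0
  then show ?case by (cases gs; cases "tl gs") (auto simp: merge_0)
next
  case (Suc n)
  then obtain x gs' where gs: "gs = x # gs'" by (cases gs) auto
  have "merge G n gs' \<noteq> []" by (simp add: merge_def)
  moreover have "gs' \<noteq> []" "butlast gs' \<noteq> []" using Suc.prems gs by (auto simp: length_Suc_conv)
  ultimately show ?case using Suc.IH[of gs'] Suc.prems by (simp add: gs merge_Suc)
qed

text \<open>This and \<open>merge_append_last\<close> serve the averaging argument, in which a
  variable \<open>t\<close> is appended to a tuple.\<close>

lemma merge_append: "Suc j < length gs \<Longrightarrow> merge G j (gs @ [t]) = merge G j gs @ [t]"
  by (simp add: merge_def nth_append)

lemma merge_append_last: "length gs = Suc n \<Longrightarrow> merge G n (gs @ [t]) = butlast gs @ [last gs \<otimes>\<^bsub>G\<^esub> t]"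
  by (simp add: merge_def nth_append last_conv_nth butlast_conv_take) (metis diff_Suc_1 last_conv_nth length_0_conv nat.distinct(1))

section \<open>Faces of cochains, and the square of the coboundary\<close>

locale group_algebra_module = group_algebra R G + left_module "group_ring R G" M
  for R :: "('r, 'x) ring_scheme" and G :: "('g, 'y) monoid_scheme" and M :: "('g \<Rightarrow> 'r, 'm) module" (structure)
begin

definition act :: "'g \<Rightarrow> 'm \<Rightarrow> 'm" where
  "act g x = ring_single R g \<one>\<^bsub>R\<^esub> \<odot> x"

definition scal :: "'r \<Rightarrow> 'm \<Rightarrow> 'm" where
  "scal r x = ring_single R \<one>\<^bsub>G\<^esub> r \<odot> x"

lemma act_closed [simp]: "g \<in> carrier G \<Longrightarrow> x \<in> carrier M \<Longrightarrow> act g x \<in> carrier M"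
  by (simp add: act_def smult_closed ring_single_closed)

lemma scal_closed [simp]: "r \<in> carrier R \<Longrightarrow> x \<in> carrier M \<Longrightarrow> scal r x \<in> carrier M"
  by (simp add: scal_def smult_closed ring_single_closed)

lemma act_mult:
  "g \<in> carrier G \<Longrightarrow> h \<in> carrier G \<Longrightarrow> x \<in> carrier M \<Longrightarrow> act (g \<otimes>\<^bsub>G\<^esub> h) x = act g (act h x)"
  using ring_single_times[of g h "\<one>\<^bsub>R\<^esub>" "\<one>\<^bsub>R\<^esub>"] smult_assoc[of "ring_single R g \<one>\<^bsub>R\<^esub>" "ring_single R h \<one>\<^bsub>R\<^esub>" x]
  by (simp add: act_def ring_single_closed)

lemma scal_mult:
  "r \<in> carrier R \<Longrightarrow> s \<in> carrier R \<Longrightarrow> x \<in> carrier M \<Longrightarrow> scal (r \<otimes>\<^bsub>R\<^esub> s) x = scal r (scal s x)"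
  using ring_single_times[of "\<one>\<^bsub>G\<^esub>" "\<one>\<^bsub>G\<^esub>" r s] smult_assoc[of "ring_single R \<one>\<^bsub>G\<^esub> r" "ring_single R \<one>\<^bsub>G\<^esub> s" x]
  by (simp add: scal_def ring_single_closed)

lemma scal_one: "x \<in> carrier M \<Longrightarrow> scal \<one>\<^bsub>R\<^esub> x = x"
  using smult_one[of x] by (simp add: scal_def group_ring_one)

text \<open>Scalars are central in the group ring: both composites are the action of the single
  element with value \<open>r\<close> at \<open>g\<close>.\<close>

lemma act_scal: "g \<in> carrier G \<Longrightarrow> r \<in> carrier R \<Longrightarrow> x \<in> carrier M \<Longrightarrow> act g (scal r x) = scal r (act g x)"
  using ring_single_times[of g "\<one>\<^bsub>G\<^esub>" "\<one>\<^bsub>R\<^esub>" r] ring_single_times[of "\<one>\<^bsub>G\<^esub>" g r "\<one>\<^bsub>R\<^esub>"]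
    smult_assoc[of "ring_single R g \<one>\<^bsub>R\<^esub>" "ring_single R \<one>\<^bsub>G\<^esub> r" x]
    smult_assoc[of "ring_single R \<one>\<^bsub>G\<^esub> r" "ring_single R g \<one>\<^bsub>R\<^esub>" x]
  by (simp add: scal_def act_def ring_single_closed)

lemma act_add: "g \<in> carrier G \<Longrightarrow> x \<in> carrier M \<Longrightarrow> y \<in> carrier M \<Longrightarrow> act g (x \<oplus> y) = act g x \<oplus> act g y"
  by (simp add: act_def smult_r_distr ring_single_closed)

lemma act_sign: "g \<in> carrier G \<Longrightarrow> x \<in> carrier M \<Longrightarrow> act g (sign i x) = sign i (act g x)"
  by (simp add: act_def sign_smult ring_single_closed)

lemma act_finsum:
  "g \<in> carrier G \<Longrightarrow> f \<in> I \<rightarrow> carrier M \<Longrightarrow> act g (\<Oplus>i\<in>I. f i) = (\<Oplus>i\<in>I. act g (f i))"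
  by (simp add: act_def smult_finsum ring_single_closed)

lemma scal_add: "r \<in> carrier R \<Longrightarrow> x \<in> carrier M \<Longrightarrow> y \<in> carrier M \<Longrightarrow> scal r (x \<oplus> y) = scal r x \<oplus> scal r y"
  by (simp add: scal_def smult_r_distr ring_single_closed)

lemma scal_add_left:
  "r \<in> carrier R \<Longrightarrow> s \<in> carrier R \<Longrightarrow> x \<in> carrier M \<Longrightarrow> scal (r \<oplus>\<^bsub>R\<^esub> s) x = scal r x \<oplus> scal s x"
  by (simp add: scal_def ring_single_add smult_l_distr ring_single_closed)

lemma scal_sign: "r \<in> carrier R \<Longrightarrow> x \<in> carrier M \<Longrightarrow> scal r (sign i x) = sign i (scal r x)"
  by (simp add: scal_def sign_smult ring_single_closed)

lemma scal_finsum: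
  "r \<in> carrier R \<Longrightarrow> f \<in> I \<rightarrow> carrier M \<Longrightarrow> scal r (\<Oplus>i\<in>I. f i) = (\<Oplus>i\<in>I. scal r (f i))"
  by (simp add: scal_def smult_finsum ring_single_closed)

lemma scal_zero_right: "r \<in> carrier R \<Longrightarrow> scal r \<zero> = \<zero>"
  by (simp add: scal_def smult_r_null ring_single_closed)

lemma scal_zero_left: "x \<in> carrier M \<Longrightarrow> scal \<zero>\<^bsub>R\<^esub> x = \<zero>"
  using smult_l_null[of x] by (simp add: scal_def ring_single_def group_ring_zero if_cancel)

text \<open>Turns a sum of equal terms over a finite subgroup into a scalar, which can be inverted
  in \<open>R\<close>.\<close>

lemma scal_add_pow: "x \<in> carrier M \<Longrightarrow> scal (add_pow R (n :: nat) \<one>\<^bsub>R\<^esub>) x = add_pow M n x"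
  by (induction n) (simp_all add: scal_zero_left scal_add_left scal_one R.add.nat_pow_closed)

abbreviation tuples :: "'g set \<Rightarrow> nat \<Rightarrow> 'g list set" where
  "tuples H n \<equiv> {gs. length gs = n \<and> set gs \<subseteq> H}"

lemma cochains_closed': "f \<in> cochains G M n \<Longrightarrow> f gs \<in> carrier M"
  by (cases "gs \<in> group_tuples G n") (simp_all add: cochains_def)

text \<open>The summands of the coboundary without signs, numbered from 0 to \<open>n + 1\<close>.
  List positions start at zero, so the face numbered \<open>i\<close> merges at position
  \<open>i - 1\<close>.\<close>

definition face :: "nat \<Rightarrow> nat \<Rightarrow> ('g list \<Rightarrow> 'm) \<Rightarrow> 'g list \<Rightarrow> 'm" where
  "face n i f gs = (if i = 0 then act (hd gs) (f (tl gs))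
     else if i \<le> n then f (merge G (i - 1) gs) else f (butlast gs))"

lemma coboundary_outside: "gs \<notin> tuples (carrier G) (Suc n) \<Longrightarrow> coboundary R G M n f gs = \<zero>"
  unfolding coboundary_def group_tuples_def by (rule if_not_P)

lemma hd_closed: "gs \<in> tuples H (Suc n) \<Longrightarrow> hd gs \<in> H"
  by (cases gs) auto

lemma tl_tuple: "gs \<in> tuples H (Suc n) \<Longrightarrow> tl gs \<in> tuples H n"
  by (cases gs) auto

lemma butlast_tuple: "gs \<in> tuples H (Suc n) \<Longrightarrow> butlast gs \<in> tuples H n"
  using in_set_butlastD[of _ gs] by auto

lemma face_closed:
  assumes "f \<in> cochains G M n" "gs \<in> tuples (carrier G) (Suc n)"
  shows "face n i f gs \<in> carrier M"
  using hd_closed[OF assms(2)] cochains_closed'[OF assms(1)] by (simp add: face_def)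

text \<open>The definition keeps the first and last summands apart; one alternating sum over all
  faces is what \<open>cosimplicial_cancellation\<close> handles.\<close>

lemma coboundary_eq:
  assumes f: "f \<in> cochains G M n" and gs: "gs \<in> tuples (carrier G) (Suc n)"
  shows "coboundary R G M n f gs = (\<Oplus>i\<in>{..Suc n}. sign i (face n i f gs))"
proof -
  note cl = face_closed[OF f gs]
  have "(\<Oplus>i\<in>{..Suc n}. sign i (face n i f gs))
      = sign (Suc n) (face n (Suc n) f gs) \<oplus> (\<Oplus>i\<in>{..n}. sign i (face n i f gs))"
    by (rule M.finsum_Suc) (use cl in auto)
  also have "(\<Oplus>i\<in>{..n}. sign i (face n i f gs))
      = sign 0 (face n 0 f gs) \<oplus> (\<Oplus>i\<in>{..<n}. sign (Suc i) (face n (Suc i) f gs))"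
    by (rule finsum_shift) (use cl in auto)
  also have "sign (Suc n) (face n (Suc n) f gs) \<oplus> \<dots> = \<dots> \<oplus> sign (Suc n) (face n (Suc n) f gs)"
    by (rule M.a_comm) (use cl in \<open>auto intro!: M.finsum_closed M.a_closed\<close>)
  also have "sign (Suc n) (face n (Suc n) f gs) = sign (Suc n) (f (butlast gs))" by (simp add: face_def)
  also have "sign 0 (face n 0 f gs) = ring_single R (hd gs) \<one>\<^bsub>R\<^esub> \<odot> f (tl gs)"
    by (simp add: face_def act_def alternating_sign_def)
  also have "(\<Oplus>i\<in>{..<n}. sign (Suc i) (face n (Suc i) f gs))
    = (\<Oplus>i\<in>{..<n}. sign (Suc i) (f (take i gs @ [gs ! i \<otimes>\<^bsub>G\<^esub> gs ! Suc i] @ drop (i + 2) gs)))"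
    using cochains_closed'[OF f] by (intro M.finsum_cong') (auto simp: face_def merge_def)
  finally show ?thesis using gs by (simp add: coboundary_def group_tuples_def)
qed

lemma coboundary_closed:
  assumes f: "f \<in> cochains G M n"
  shows "coboundary R G M n f \<in> cochains G M (Suc n)"
proof -
  have "coboundary R G M n f gs \<in> carrier M" if "gs \<in> tuples (carrier G) (Suc n)" for gs
    unfolding coboundary_eq[OF f that] by (rule M.finsum_closed) (use face_closed[OF f that] in auto)
  then show ?thesis
    using coboundary_outside[of _ n f] by (auto simp: cochains_def group_tuples_def)
qed

lemma face_tuple:
  assumes "\<And>x y. x \<in> H \<Longrightarrow> y \<in> H \<Longrightarrow> x \<otimes>\<^bsub>G\<^esub> y \<in> H" "gs \<in> tuples H (Suc n)" "i \<le> n" "i \<noteq> 0"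
  shows "merge G (i - 1) gs \<in> tuples H n"
  using assms length_merge[of "i - 1" gs G] set_merge[of "i - 1" gs H G] by auto

text \<open>The cosimplicial identity. Case \<open>a\<close> is multiplicativity of the action, case
  \<open>d\<close> is \<open>merge_merge\<close>, and \<open>e\<close> and \<open>h\<close> commute
  a merge with dropping the last entry. In the other cases the head acts while the second face
  changes only the tail.\<close>

lemma face_face:
  assumes f: "f \<in> cochains G M n" and gs: "gs \<in> tuples (carrier G) (Suc (Suc n))" and ij: "i < j" "j \<le> Suc (Suc n)"
  shows "face (Suc n) j (face n i f) gs = face (Suc n) i (face n (j - 1) f) gs"
proof -
  obtain x y gs' where g: "gs = x # y # gs'" using gs by (auto simp: length_Suc_conv)
  have xy: "x \<in> carrier G" "y \<in> carrier G" "set gs' \<subseteq> carrier G" "length gs' = n" using gs g by auto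
  note fc = cochains_closed'[OF f]
  consider (a) "i = 0" "j = 1" | (b) k where "i = 0" "j = Suc (Suc k)" "k < n" | (c) "i = 0" "j = Suc (Suc n)" "n \<noteq> 0"
    | (c') "i = 0" "j = Suc (Suc n)" "n = 0"
    | (d) a b where "i = Suc a" "j = Suc b" "a < b" "b \<le> n"
    | (e) a where "i = Suc a" "j = Suc (Suc n)" "a < n" | (h) "i = Suc n" "j = Suc (Suc n)"
  proof (cases i)
    case 0
    show thesis
    proof (cases "j = 1 \<or> j = Suc (Suc n)")
      case False
      then obtain k where "j = Suc (Suc k)" using ij 0 by (cases j; cases "j - 1") auto
      then show thesis using that 0 False ij by auto
    qed (use that 0 in blast)
  next
    case (Suc a)
    show thesis
    proof (cases "j = Suc (Suc n)")
      case True
      then show thesis using that Suc ij by (cases "a < n") auto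
    next
      case False
      then obtain b where "j = Suc b" using ij by (cases j) auto
      then show thesis using that Suc ij False by auto
    qed
  qed
  then show ?thesis
  proof cases
    case a
    then show ?thesis using xy fc by (simp add: face_def g merge_0 act_mult)
  next
    case b
    then show ?thesis using xy by (simp add: face_def g merge_Suc)
  next
    case c
    then show ?thesis using xy by (auto simp: face_def g)
  next
    case c'
    then show ?thesis using xy by (auto simp: face_def g)
  next
    case d
    then show ?thesis using G.merge_merge[of a b gs] gs by (cases b) (auto simp: face_def)
  next
    case e
    then show ?thesis using butlast_merge[of a gs G] gs by (auto simp: face_def)
  next
    case h
    then show ?thesis using butlast_merge_last[of gs n G] gs by (auto simp: face_def)
  qed
qed

lemma face_finsum_sign:
  assumes F: "\<And>i gs. i \<in> I \<Longrightarrow> F i gs \<in> carrier M" and gs: "gs \<in> tuples (carrier G) (Suc n)"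
  shows "face n j (\<lambda>gs. \<Oplus>i\<in>I. sign i (F i gs)) gs = (\<Oplus>i\<in>I. sign i (face n j (F i) gs))"
proof (cases "j = 0")
  case True
  have "act (hd gs) (\<Oplus>i\<in>I. sign i (F i (tl gs))) = (\<Oplus>i\<in>I. act (hd gs) (sign i (F i (tl gs))))"
    by (rule act_finsum) (use F hd_closed[OF gs] in auto)
  also have "\<dots> = (\<Oplus>i\<in>I. sign i (act (hd gs) (F i (tl gs))))"
    by (rule M.finsum_cong') (use F hd_closed[OF gs] in \<open>auto simp: act_sign\<close>)
  finally show ?thesis using True by (simp add: face_def)
qed (simp add: face_def)

text \<open>Stated for any \<open>H\<close> closed under multiplication, so that it serves the whole
  group and also restrictions to subgroups.\<close>

lemma face_cong:
  assumes "\<And>x y. x \<in> H \<Longrightarrow> y \<in> H \<Longrightarrow> x \<otimes>\<^bsub>G\<^esub> y \<in> H" "gs \<in> tuples H (Suc n)"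
    and "\<And>gs. gs \<in> tuples H n \<Longrightarrow> f gs = f' gs"
  shows "face n i f gs = face n i f' gs"
  using assms(3)[OF tl_tuple[OF assms(2)]] assms(3)[OF butlast_tuple[OF assms(2)]]
    assms(3)[OF face_tuple[OF assms(1,2)], of i] by (auto simp: face_def)

text \<open>Since faces are additive, the double coboundary is an alternating sum over pairs of
  faces, and \<open>face_face\<close> is the hypothesis of the cancellation lemma.\<close>

lemma coboundary_coboundary:
  assumes f: "f \<in> cochains G M n"
  shows "coboundary R G M (Suc n) (coboundary R G M n f) = (\<lambda>gs. \<zero>)"
proof
  fix gs
  show "coboundary R G M (Suc n) (coboundary R G M n f) gs = \<zero>"
  proof (cases "gs \<in> tuples (carrier G) (Suc (Suc n))")
    case gs: True
    have ff: "face (Suc n) j (face n i f) gs \<in> carrier M" for i j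
    proof (cases "j = 0")
      case True
      then show ?thesis using hd_closed[OF gs] face_closed[OF f tl_tuple[OF gs]] by (simp add: face_def[of "Suc n"])
    next
      case False
      then show ?thesis
        using face_closed[OF f butlast_tuple[OF gs]] face_closed[OF f face_tuple[OF G.m_closed gs]]
        by (auto simp: face_def[of "Suc n"])
    qed
    \<comment> \<open>The faces are cut off outside the tuples of \<open>G\<close>:
      \<open>face_finsum_sign\<close> requires values in \<open>M\<close> at every list, and a head
      outside the group need not act on \<open>M\<close>.\<close>
    let ?F = "\<lambda>i gs. if gs \<in> tuples (carrier G) (Suc n) then face n i f gs else \<zero>"
    have F: "?F i gs \<in> carrier M" for i gs using face_closed[OF f, of gs i] by auto
    have "coboundary R G M (Suc n) (coboundary R G M n f) gs
        = (\<Oplus>j\<in>{..Suc (Suc n)}. sign j (face (Suc n) j (coboundary R G M n f) gs))"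
      by (rule coboundary_eq[OF coboundary_closed[OF f] gs])
    also have "\<dots> = (\<Oplus>j\<in>{..Suc (Suc n)}. \<Oplus>i\<in>{..Suc n}. sign (i + j) (face (Suc n) j (face n i f) gs))"
    proof (rule M.finsum_cong')
      fix j
      have "face (Suc n) j (coboundary R G M n f) gs = face (Suc n) j (\<lambda>gs. \<Oplus>i\<in>{..Suc n}. sign i (?F i gs)) gs"
        by (rule face_cong[OF G.m_closed gs]) (simp_all add: coboundary_eq[OF f])
      also have "\<dots> = (\<Oplus>i\<in>{..Suc n}. sign i (face (Suc n) j (?F i) gs))"
        by (rule face_finsum_sign[OF F gs])
      also have "\<dots> = (\<Oplus>i\<in>{..Suc n}. sign i (face (Suc n) j (face n i f) gs))"
      proof (rule M.finsum_cong')
        fix i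
        have "face (Suc n) j (?F i) gs = face (Suc n) j (face n i f) gs"
          by (rule face_cong[OF G.m_closed gs]) simp_all
        then show "sign i (face (Suc n) j (?F i) gs) = sign i (face (Suc n) j (face n i f) gs)" by simp
      qed (use ff in auto)
      also have "sign j \<dots> = (\<Oplus>i\<in>{..Suc n}. sign j (sign i (face (Suc n) j (face n i f) gs)))"
        by (rule sign_finsum) (use ff in auto)
      also have "\<dots> = (\<Oplus>i\<in>{..Suc n}. sign (i + j) (face (Suc n) j (face n i f) gs))"
        by (rule M.finsum_cong') (use ff in \<open>auto simp: sign_sign add.commute\<close>)
      finally show "sign j (face (Suc n) j (coboundary R G M n f) gs)
          = (\<Oplus>i\<in>{..Suc n}. sign (i + j) (face (Suc n) j (face n i f) gs))" by simp
    qed (use ff in \<open>auto intro!: M.finsum_closed\<close>)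
    also have "\<dots> = \<zero>"
      by (rule cosimplicial_cancellation) (use ff face_face[OF f gs] in auto)
    finally show ?thesis .
  qed (rule coboundary_outside)
qed

end

section \<open>Cohomology modules\<close>

lemma zero_module_quotientI:
  assumes "abelian_group Z" "carrier Z = B"
  shows "zero_module (quotient_module Z B)"
proof -
  interpret Z: abelian_group Z by fact
  have "B +>\<^bsub>Z\<^esub> x = B" if "x \<in> B" for x
    using Z.a_coset_join2[of x B] that assms(2) Z.add.subgroup_self by simp
  moreover have "B \<noteq> {}" using assms(2) Z.zero_closed by auto
  ultimately show ?thesis
    using assms(2) by (auto simp: zero_module_def quotient_module_def A_RCOSETS_def')
qed

lemma quotient_module_module:
  assumes Z: "module R Z" and B: "submodule B R Z"
  shows "module R (quotient_module Z B)"
    and "x \<in> carrier Z \<Longrightarrow> r \<in> carrier R \<Longrightarrow> r \<odot>\<^bsub>quotient_module Z B\<^esub> (B +>\<^bsub>Z\<^esub> x) = B +>\<^bsub>Z\<^esub> (r \<odot>\<^bsub>Z\<^esub> x)"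
proof -
  interpret Z: module R Z by fact
  interpret B: submodule B R Z by fact
  interpret B: abelian_subgroup B Z
    by (rule abelian_subgroupI3[OF additive_subgroup.intro[OF B.subgroup_axioms] Z.abelian_group_axioms])
  let ?Q = "quotient_module Z B"
  have sm: "r \<odot>\<^bsub>?Q\<^esub> (B +>\<^bsub>Z\<^esub> x) = B +>\<^bsub>Z\<^esub> (r \<odot>\<^bsub>Z\<^esub> x)" if x: "x \<in> carrier Z" and r: "r \<in> carrier R" for r x
  proof -
    \<comment> \<open>Scalar multiplication on the quotient is a union over representatives; here
      all members of that union are seen to coincide.\<close>
    have "B +>\<^bsub>Z\<^esub> (r \<odot>\<^bsub>Z\<^esub> y) = B +>\<^bsub>Z\<^esub> (r \<odot>\<^bsub>Z\<^esub> x)" if y: "y \<in> B +>\<^bsub>Z\<^esub> x" for y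
    proof -
      obtain b where b: "b \<in> B" "y = b \<oplus>\<^bsub>Z\<^esub> x" using y by (auto simp: a_r_coset_def')
      have "r \<odot>\<^bsub>Z\<^esub> y = r \<odot>\<^bsub>Z\<^esub> b \<oplus>\<^bsub>Z\<^esub> r \<odot>\<^bsub>Z\<^esub> x" using b x r by (simp add: Z.smult_r_distr)
      then have "r \<odot>\<^bsub>Z\<^esub> y \<in> B +>\<^bsub>Z\<^esub> (r \<odot>\<^bsub>Z\<^esub> x)" using b r by (auto simp: a_r_coset_def')
      then show ?thesis using x r Z.smult_closed B.a_repr_independence' by metis
    qed
    then have "(\<Union>y\<in>B +>\<^bsub>Z\<^esub> x. B +>\<^bsub>Z\<^esub> (r \<odot>\<^bsub>Z\<^esub> y)) = B +>\<^bsub>Z\<^esub> (r \<odot>\<^bsub>Z\<^esub> x)"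
      by (intro UN_constant_eq[OF B.a_rcos_self[OF x]] ballI)
    then show ?thesis by (simp add: quotient_module_def)
  qed
  show "x \<in> carrier Z \<Longrightarrow> r \<in> carrier R \<Longrightarrow> r \<odot>\<^bsub>quotient_module Z B\<^esub> (B +>\<^bsub>Z\<^esub> x) = B +>\<^bsub>Z\<^esub> (r \<odot>\<^bsub>Z\<^esub> x)"
    by (rule sm)
  have ad: "(B +>\<^bsub>Z\<^esub> x) \<oplus>\<^bsub>?Q\<^esub> (B +>\<^bsub>Z\<^esub> y) = B +>\<^bsub>Z\<^esub> (x \<oplus>\<^bsub>Z\<^esub> y)" if "x \<in> carrier Z" "y \<in> carrier Z" for x y
    using B.a_rcos_sum[OF that] by (simp add: quotient_module_def)
  have zr: "\<zero>\<^bsub>?Q\<^esub> = B +>\<^bsub>Z\<^esub> \<zero>\<^bsub>Z\<^esub>"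
    using Z.a_coset_add_zero[OF B.a_subset] by (simp add: quotient_module_def)
  have ca: "X \<in> carrier ?Q \<longleftrightarrow> (\<exists>x\<in>carrier Z. X = B +>\<^bsub>Z\<^esub> x)" for X
    by (auto simp: quotient_module_def A_RCOSETS_def')
  show "module R ?Q"
  proof (rule moduleI)
    show "cring R" by (rule Z.R.is_cring)
    show "abelian_group ?Q"
    proof (rule abelian_groupI)
      fix X assume "X \<in> carrier ?Q"
      then obtain x where x: "x \<in> carrier Z" "X = B +>\<^bsub>Z\<^esub> x" using ca by blast
      show "\<zero>\<^bsub>?Q\<^esub> \<oplus>\<^bsub>?Q\<^esub> X = X" using x by (simp add: zr ad del: Z.M.a_coset_add_zero)
      have "(B +>\<^bsub>Z\<^esub> (\<ominus>\<^bsub>Z\<^esub> x)) \<oplus>\<^bsub>?Q\<^esub> X = \<zero>\<^bsub>?Q\<^esub>" using x by (simp add: ad Z.M.l_neg zr)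
      then show "\<exists>Y\<in>carrier ?Q. Y \<oplus>\<^bsub>?Q\<^esub> X = \<zero>\<^bsub>?Q\<^esub>" using x ca by blast
      fix Y assume "Y \<in> carrier ?Q"
      then obtain y where y: "y \<in> carrier Z" "Y = B +>\<^bsub>Z\<^esub> y" using ca by blast
      show "X \<oplus>\<^bsub>?Q\<^esub> Y \<in> carrier ?Q" unfolding ca using x y by (auto simp: ad)
      show "X \<oplus>\<^bsub>?Q\<^esub> Y = Y \<oplus>\<^bsub>?Q\<^esub> X" using x y by (simp add: ad Z.M.a_comm)
      fix W assume "W \<in> carrier ?Q"
      then obtain w where w: "w \<in> carrier Z" "W = B +>\<^bsub>Z\<^esub> w" using ca by blast
      show "X \<oplus>\<^bsub>?Q\<^esub> Y \<oplus>\<^bsub>?Q\<^esub> W = X \<oplus>\<^bsub>?Q\<^esub> (Y \<oplus>\<^bsub>?Q\<^esub> W)" using x y w by (simp add: ad Z.M.a_assoc)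
    next
      show "\<zero>\<^bsub>?Q\<^esub> \<in> carrier ?Q" unfolding ca zr by blast
    qed
    fix r X assume r: "r \<in> carrier R" and "X \<in> carrier ?Q"
    then obtain x where x: "x \<in> carrier Z" "X = B +>\<^bsub>Z\<^esub> x" using ca by blast
    show "r \<odot>\<^bsub>?Q\<^esub> X \<in> carrier ?Q" unfolding ca using x r by (auto simp: sm)
    show "(r \<oplus>\<^bsub>R\<^esub> s) \<odot>\<^bsub>?Q\<^esub> X = r \<odot>\<^bsub>?Q\<^esub> X \<oplus>\<^bsub>?Q\<^esub> s \<odot>\<^bsub>?Q\<^esub> X" if "s \<in> carrier R" for s
      using x r that by (simp add: sm ad Z.smult_l_distr)
    show "(r \<otimes>\<^bsub>R\<^esub> s) \<odot>\<^bsub>?Q\<^esub> X = r \<odot>\<^bsub>?Q\<^esub> (s \<odot>\<^bsub>?Q\<^esub> X)" if "s \<in> carrier R" for s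
      using x r that by (simp add: sm Z.smult_assoc1)
    fix Y assume "Y \<in> carrier ?Q"
    then obtain y where y: "y \<in> carrier Z" "Y = B +>\<^bsub>Z\<^esub> y" using ca by blast
    show "r \<odot>\<^bsub>?Q\<^esub> (X \<oplus>\<^bsub>?Q\<^esub> Y) = r \<odot>\<^bsub>?Q\<^esub> X \<oplus>\<^bsub>?Q\<^esub> r \<odot>\<^bsub>?Q\<^esub> Y"
      using x y r by (simp add: sm ad Z.smult_r_distr)
  next
    fix X assume "X \<in> carrier ?Q"
    then obtain x where x: "x \<in> carrier Z" "X = B +>\<^bsub>Z\<^esub> x" using ca by blast
    then show "\<one>\<^bsub>R\<^esub> \<odot>\<^bsub>?Q\<^esub> X = X" by (simp add: sm)
  qed
qed

section \<open>The module of cocycles, and acyclicity over finite subgroups\<close>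

context group_algebra_module
begin

lemma face_add:
  assumes "f \<in> cochains G M n" "f' \<in> cochains G M n" "gs \<in> tuples (carrier G) (Suc n)"
  shows "face n i (\<lambda>gs. f gs \<oplus> f' gs) gs = face n i f gs \<oplus> face n i f' gs"
  using cochains_closed'[OF assms(1)] cochains_closed'[OF assms(2)] hd_closed[OF assms(3)]
  by (simp add: face_def act_add)

lemma face_scal:
  assumes "r \<in> carrier R" "f \<in> cochains G M n" "gs \<in> tuples (carrier G) (Suc n)"
  shows "face n i (\<lambda>gs. scal r (f gs)) gs = scal r (face n i f gs)"
  using cochains_closed'[OF assms(2)] hd_closed[OF assms(3)] assms(1)
  by (simp add: face_def act_scal)

lemma cochains_add: "f \<in> cochains G M n \<Longrightarrow> f' \<in> cochains G M n \<Longrightarrow> (\<lambda>gs. f gs \<oplus> f' gs) \<in> cochains G M n"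
  by (simp add: cochains_def)

lemma cochains_zero: "(\<lambda>gs. \<zero>) \<in> cochains G M n"
  by (simp add: cochains_def)

lemma cochains_scal: "r \<in> carrier R \<Longrightarrow> f \<in> cochains G M n \<Longrightarrow> (\<lambda>gs. scal r (f gs)) \<in> cochains G M n"
  by (simp add: cochains_def scal_zero_right)

lemma coboundary_add:
  assumes f: "f \<in> cochains G M n" and f': "f' \<in> cochains G M n"
  shows "coboundary R G M n (\<lambda>gs. f gs \<oplus> f' gs) = (\<lambda>gs. coboundary R G M n f gs \<oplus> coboundary R G M n f' gs)"
proof
  fix gs
  show "coboundary R G M n (\<lambda>gs. f gs \<oplus> f' gs) gs = coboundary R G M n f gs \<oplus> coboundary R G M n f' gs"
  proof (cases "gs \<in> tuples (carrier G) (Suc n)")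
    case gs: True
    note cl = face_closed[OF f gs] face_closed[OF f' gs]
    have "(\<Oplus>i\<in>{..Suc n}. sign i (face n i (\<lambda>gs. f gs \<oplus> f' gs) gs))
        = (\<Oplus>i\<in>{..Suc n}. sign i (face n i f gs) \<oplus> sign i (face n i f' gs))"
      by (rule M.finsum_cong') (use cl in \<open>auto simp: face_add[OF f f' gs] sign_add\<close>)
    also have "\<dots> = (\<Oplus>i\<in>{..Suc n}. sign i (face n i f gs)) \<oplus> (\<Oplus>i\<in>{..Suc n}. sign i (face n i f' gs))"
      by (rule M.finsum_addf) (use cl in auto)
    finally show ?thesis
      unfolding coboundary_eq[OF cochains_add[OF f f'] gs] coboundary_eq[OF f gs] coboundary_eq[OF f' gs] .
  next
    case False
    show ?thesis unfolding coboundary_outside[OF False] by simp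
  qed
qed

lemma coboundary_scal:
  assumes r: "r \<in> carrier R" and f: "f \<in> cochains G M n"
  shows "coboundary R G M n (\<lambda>gs. scal r (f gs)) = (\<lambda>gs. scal r (coboundary R G M n f gs))"
proof
  fix gs
  show "coboundary R G M n (\<lambda>gs. scal r (f gs)) gs = scal r (coboundary R G M n f gs)"
  proof (cases "gs \<in> tuples (carrier G) (Suc n)")
    case gs: True
    note cl = face_closed[OF f gs]
    have "(\<Oplus>i\<in>{..Suc n}. sign i (face n i (\<lambda>gs. scal r (f gs)) gs))
        = (\<Oplus>i\<in>{..Suc n}. scal r (sign i (face n i f gs)))"
      by (rule M.finsum_cong') (use cl r in \<open>auto simp: face_scal[OF r f gs] scal_sign\<close>)
    also have "\<dots> = scal r (\<Oplus>i\<in>{..Suc n}. sign i (face n i f gs))"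
      by (rule scal_finsum[symmetric]) (use cl r in auto)
    finally show ?thesis
      unfolding coboundary_eq[OF cochains_scal[OF r f] gs] coboundary_eq[OF f gs] .
  next
    case False
    show ?thesis unfolding coboundary_outside[OF False] scal_zero_right[OF r] ..
  qed
qed

lemma coboundary_zero: "coboundary R G M n (\<lambda>gs. \<zero>) = (\<lambda>gs. \<zero>)"
proof
  fix gs
  show "coboundary R G M n (\<lambda>gs. \<zero>) gs = \<zero>"
    using fun_cong[OF coboundary_scal[OF R.zero_closed cochains_zero, of n], of gs]
      cochains_closed'[OF coboundary_closed[OF cochains_zero, of n], of gs]
    by (simp add: scal_zero_left)
qed

text \<open>All faces of a tuple from \<open>H\<close> are again tuples from \<open>H\<close>, so
  the coboundary on \<open>H\<close> sees only the values there. The gluing argument relies on this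
  locality.\<close>

lemma coboundary_cong:
  assumes f: "f \<in> cochains G M n" and f': "f' \<in> cochains G M n"
    and H: "\<And>x y. x \<in> H \<Longrightarrow> y \<in> H \<Longrightarrow> x \<otimes>\<^bsub>G\<^esub> y \<in> H" "H \<subseteq> carrier G" and gs: "gs \<in> tuples H (Suc n)"
    and eq: "\<And>gs. gs \<in> tuples H n \<Longrightarrow> f gs = f' gs"
  shows "coboundary R G M n f gs = coboundary R G M n f' gs"
proof -
  have gs': "gs \<in> tuples (carrier G) (Suc n)" using gs H by auto
  show ?thesis
    unfolding coboundary_eq[OF f gs'] coboundary_eq[OF f' gs']
    by (rule M.finsum_cong') (use face_cong[OF H(1) gs eq] face_closed[OF f' gs'] in auto)
qed

lemma cocycles_iff: "f \<in> cocycles R G M n \<longleftrightarrow> f \<in> cochains G M n \<and> coboundary R G M n f = (\<lambda>gs. \<zero>)"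
  by (simp add: cocycles_def)

text \<open>The case distinction in the definition disappears because cochains vanish off the tuples
  and scalars fix zero.\<close>

lemma cocycle_module_smult: "f \<in> cochains G M n \<Longrightarrow> r \<in> carrier R \<Longrightarrow> r \<odot>\<^bsub>cocycle_module R G M n\<^esub> f = (\<lambda>gs. scal r (f gs))"
  by (auto simp: cocycle_module_def scal_def cochains_def scal_zero_right[unfolded scal_def])

lemma cocycle_module_module: "module R (cocycle_module R G M n)"
proof -
  let ?Z = "cocycle_module R G M n"
  have ca: "f \<in> carrier ?Z \<longleftrightarrow> f \<in> cocycles R G M n" for f by (simp add: cocycle_module_def)
  have ad: "f \<oplus>\<^bsub>?Z\<^esub> f' = (\<lambda>gs. f gs \<oplus> f' gs)" for f f' by (simp add: cocycle_module_def)
  have zr: "\<zero>\<^bsub>?Z\<^esub> = (\<lambda>gs. \<zero>)" by (simp add: cocycle_module_def)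
  note sm = cocycle_module_smult
  have cl: "f gs \<in> carrier M" if "f \<in> carrier ?Z" for f gs
    using that cochains_closed' unfolding ca cocycles_iff by blast
  have co: "f \<in> cochains G M n" if "f \<in> carrier ?Z" for f
    using that unfolding ca cocycles_iff by blast
  have smc: "(\<lambda>gs. scal r (f gs)) \<in> carrier ?Z" if "r \<in> carrier R" "f \<in> carrier ?Z" for r f
    using that co[OF that(2)] unfolding ca cocycles_iff
    by (simp add: cochains_scal coboundary_scal scal_zero_right)
  show ?thesis
  proof (rule moduleI)
    show "cring R" by (rule R.is_cring)
    show "abelian_group ?Z"
    proof (rule abelian_groupI)
      show "\<zero>\<^bsub>?Z\<^esub> \<in> carrier ?Z" unfolding ca zr cocycles_iff using cochains_zero coboundary_zero by simp
      fix f assume f: "f \<in> carrier ?Z"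
      show "\<zero>\<^bsub>?Z\<^esub> \<oplus>\<^bsub>?Z\<^esub> f = f" using cl[OF f] by (simp add: ad zr)
      have "(\<lambda>gs. scal (\<ominus>\<^bsub>R\<^esub> \<one>\<^bsub>R\<^esub>) (f gs)) \<oplus>\<^bsub>?Z\<^esub> f = \<zero>\<^bsub>?Z\<^esub>"
      proof -
        have "scal (\<ominus>\<^bsub>R\<^esub> \<one>\<^bsub>R\<^esub>) (f gs) \<oplus> f gs = \<zero>" for gs
          using scal_add_left[of "\<ominus>\<^bsub>R\<^esub> \<one>\<^bsub>R\<^esub>" "\<one>\<^bsub>R\<^esub>" "f gs"] cl[OF f] by (simp add: scal_one R.l_neg scal_zero_left)
        then show ?thesis by (simp add: ad zr)
      qed
      then show "\<exists>f'\<in>carrier ?Z. f' \<oplus>\<^bsub>?Z\<^esub> f = \<zero>\<^bsub>?Z\<^esub>" using smc[OF _ f] by blast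
      fix f' assume f': "f' \<in> carrier ?Z"
      show "f \<oplus>\<^bsub>?Z\<^esub> f' \<in> carrier ?Z"
        using f f' co[OF f] co[OF f'] unfolding ca ad cocycles_iff by (simp add: cochains_add coboundary_add)
      show "f \<oplus>\<^bsub>?Z\<^esub> f' = f' \<oplus>\<^bsub>?Z\<^esub> f" using cl f f' by (simp add: ad M.a_comm)
      show "f \<oplus>\<^bsub>?Z\<^esub> f' \<oplus>\<^bsub>?Z\<^esub> f'' = f \<oplus>\<^bsub>?Z\<^esub> (f' \<oplus>\<^bsub>?Z\<^esub> f'')" if "f'' \<in> carrier ?Z" for f''
        using cl f f' that by (simp add: ad M.a_assoc)
    qed
    fix r f assume r: "r \<in> carrier R" and f: "f \<in> carrier ?Z"
    show "r \<odot>\<^bsub>?Z\<^esub> f \<in> carrier ?Z" using smc r f by (simp add: sm[OF co[OF f]])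
    show "(r \<oplus>\<^bsub>R\<^esub> s) \<odot>\<^bsub>?Z\<^esub> f = r \<odot>\<^bsub>?Z\<^esub> f \<oplus>\<^bsub>?Z\<^esub> s \<odot>\<^bsub>?Z\<^esub> f" if "s \<in> carrier R" for s
      using r that cl[OF f] by (simp add: sm[OF co[OF f]] ad scal_add_left)
    show "(r \<otimes>\<^bsub>R\<^esub> s) \<odot>\<^bsub>?Z\<^esub> f = r \<odot>\<^bsub>?Z\<^esub> (s \<odot>\<^bsub>?Z\<^esub> f)" if "s \<in> carrier R" for s
      using r that cl[OF f] cochains_scal[OF that co[OF f]] by (simp add: sm co[OF f] scal_mult)
    fix f' assume f': "f' \<in> carrier ?Z"
    have "f \<oplus>\<^bsub>?Z\<^esub> f' \<in> cochains G M n" using cochains_add[OF co[OF f] co[OF f']] by (simp add: ad)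
    then show "r \<odot>\<^bsub>?Z\<^esub> (f \<oplus>\<^bsub>?Z\<^esub> f') = r \<odot>\<^bsub>?Z\<^esub> f \<oplus>\<^bsub>?Z\<^esub> r \<odot>\<^bsub>?Z\<^esub> f'"
      using r cl f f' by (simp add: sm co ad scal_add)
  next
    fix f assume f: "f \<in> carrier ?Z"
    show "\<one>\<^bsub>R\<^esub> \<odot>\<^bsub>?Z\<^esub> f = f" using cl[OF f] by (simp add: sm[OF co[OF f]] scal_one)
  qed
qed

text \<open>Averaging over the last argument contracts the restriction of the complex to a finite
  subgroup of invertible order.\<close>

lemma finite_subgroup_acyclic:
  assumes H: "subgroup H G" "finite H" and unit: "add_pow R (card H) \<one>\<^bsub>R\<^esub> \<in> Units R"
    and f: "f \<in> cochains G M (Suc n)"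
    and cyc: "\<And>gs. gs \<in> tuples H (Suc (Suc n)) \<Longrightarrow> coboundary R G M (Suc n) f gs = \<zero>"
  shows "\<exists>h\<in>cochains G M n. \<forall>gs\<in>tuples H (Suc n). coboundary R G M n h gs = f gs"
proof -
  interpret H: subgroup H G by fact
  define u where "u = inv\<^bsub>R\<^esub> (add_pow R (card H) \<one>\<^bsub>R\<^esub>)"
  have u: "u \<in> carrier R" "u \<otimes>\<^bsub>R\<^esub> add_pow R (card H) \<one>\<^bsub>R\<^esub> = \<one>\<^bsub>R\<^esub>"
    using unit by (auto simp: u_def R.Units_inv_closed R.Units_l_inv)
  note fc = cochains_closed'[OF f]
  define S where "S = (\<lambda>x. if x \<in> tuples (carrier G) n then \<Oplus>t\<in>H. f (x @ [t]) else \<zero>)"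
  have S: "S \<in> cochains G M n"
    using fc by (auto simp: S_def cochains_def group_tuples_def intro!: M.finsum_closed)
  \<comment> \<open>The cocycle identity at \<open>gs @ [t]\<close> is summed over \<open>t\<close>
    in \<open>H\<close>. The last face contributes \<open>card H\<close> times \<open>f gs\<close>,
    with sign \<open>(-1)^(n+2)\<close>, and the others form the coboundary of
    \<open>S\<close>.\<close>
  have key: "coboundary R G M n S gs = sign (Suc n) (scal (add_pow R (card H) \<one>\<^bsub>R\<^esub>) (f gs))"
    if gs: "gs \<in> tuples H (Suc n)" for gs
  proof -
    have gsG: "gs \<in> tuples (carrier G) (Suc n)" using gs H.subset by auto
    have app: "gs @ [t] \<in> tuples H (Suc (Suc n))" "gs @ [t] \<in> tuples (carrier G) (Suc (Suc n))"
      if "t \<in> H" for t using gs that H.subset by auto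
    have ne: "gs \<noteq> []" using gs by auto
    have last: "last gs \<in> H" using gs ne by auto
    have hd: "hd gs \<in> carrier G" using hd_closed[OF gsG] .
    have fcl: "face (Suc n) i f (gs @ [t]) \<in> carrier M" if "t \<in> H" for i t
      using face_closed[OF f app(2)[OF that]] .
    have sum_face: "(\<Oplus>t\<in>H. face (Suc n) i f (gs @ [t])) = face n i S gs" if i: "i \<le> Suc n" for i
    proof -
      consider "i = 0" | "i \<noteq> 0" "i \<le> n" | "i = Suc n" using i by linarith
      then show ?thesis
      proof cases
        case 1
        have "(\<Oplus>t\<in>H. face (Suc n) i f (gs @ [t])) = (\<Oplus>t\<in>H. act (hd gs) (f (tl gs @ [t])))"
          by (rule M.finsum_cong') (use 1 ne hd fc in \<open>auto simp: face_def\<close>)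
        also have "\<dots> = act (hd gs) (\<Oplus>t\<in>H. f (tl gs @ [t]))"
          by (rule act_finsum[symmetric]) (use hd fc in auto)
        also have "(\<Oplus>t\<in>H. f (tl gs @ [t])) = S (tl gs)"
          using tl_tuple[OF gsG] by (simp add: S_def)
        finally show ?thesis using 1 by (simp add: face_def)
      next
        case 2
        have "(\<Oplus>t\<in>H. face (Suc n) i f (gs @ [t])) = (\<Oplus>t\<in>H. f (merge G (i - 1) gs @ [t]))"
          by (rule M.finsum_cong') (use 2 fc gs merge_append[of "i - 1" gs G] in \<open>auto simp: face_def\<close>)
        also have "\<dots> = S (merge G (i - 1) gs)"
          using face_tuple[OF G.m_closed gsG 2(2,1)] by (simp add: S_def)
        finally show ?thesis using 2 by (simp add: face_def)
      next
        case 3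
        \<comment> \<open>This face multiplies \<open>t\<close> by the last entry of
          \<open>gs\<close>; left translation by an element of \<open>H\<close> permutes
          \<open>H\<close>, so the sum is unchanged.\<close>
        have "(\<Oplus>t\<in>H. face (Suc n) i f (gs @ [t])) = (\<Oplus>t\<in>H. f (butlast gs @ [last gs \<otimes>\<^bsub>G\<^esub> t]))"
          by (rule M.finsum_cong') (use 3 fc gs merge_append_last[of gs n G] in \<open>auto simp: face_def\<close>)
        also have "\<dots> = (\<Oplus>t\<in>(\<lambda>t. last gs \<otimes>\<^bsub>G\<^esub> t) ` H. f (butlast gs @ [t]))"
          by (rule M.finsum_reindex[symmetric]) (use fc last H.subset in \<open>auto simp: inj_on_def subset_iff\<close>)
        also have "(\<lambda>t. last gs \<otimes>\<^bsub>G\<^esub> t) ` H = H"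
        proof
          show "(\<lambda>t. last gs \<otimes>\<^bsub>G\<^esub> t) ` H \<subseteq> H" using last by auto
          show "H \<subseteq> (\<lambda>t. last gs \<otimes>\<^bsub>G\<^esub> t) ` H"
          proof
            fix t assume t: "t \<in> H"
            have "t = last gs \<otimes>\<^bsub>G\<^esub> (inv\<^bsub>G\<^esub> last gs \<otimes>\<^bsub>G\<^esub> t)"
              using last t H.subset by (simp add: G.m_assoc[symmetric] subset_iff)
            moreover have "inv\<^bsub>G\<^esub> last gs \<otimes>\<^bsub>G\<^esub> t \<in> H" using last t by auto
            ultimately show "t \<in> (\<lambda>t. last gs \<otimes>\<^bsub>G\<^esub> t) ` H" by blast
          qed
        qed
        also have "(\<Oplus>t\<in>H. f (butlast gs @ [t])) = S (butlast gs)"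
          using butlast_tuple[OF gsG] by (simp add: S_def)
        finally show ?thesis using 3 by (simp add: face_def)
      qed
    qed
    have "\<zero> = (\<Oplus>t\<in>H. coboundary R G M (Suc n) f (gs @ [t]))"
      by (rule M.add.finprod_one_eqI[symmetric]) (use cyc app in auto)
    also have "\<dots> = (\<Oplus>t\<in>H. \<Oplus>i\<in>{..Suc (Suc n)}. sign i (face (Suc n) i f (gs @ [t])))"
      by (rule M.finsum_cong') (use coboundary_eq[OF f app(2)] fcl in \<open>auto intro!: M.finsum_closed\<close>)
    also have "\<dots> = (\<Oplus>i\<in>{..Suc (Suc n)}. \<Oplus>t\<in>H. sign i (face (Suc n) i f (gs @ [t])))"
      by (rule M.finsum_swap) (use H fcl in auto)
    also have "\<dots> = (\<Oplus>i\<in>{..Suc (Suc n)}. sign i (\<Oplus>t\<in>H. face (Suc n) i f (gs @ [t])))"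
      by (rule M.finsum_cong') (use fcl in \<open>auto simp: sign_finsum intro!: M.finsum_closed sign_closed\<close>)
    also have "\<dots> = sign (Suc (Suc n)) (\<Oplus>t\<in>H. face (Suc n) (Suc (Suc n)) f (gs @ [t]))
        \<oplus> (\<Oplus>i\<in>{..Suc n}. sign i (\<Oplus>t\<in>H. face (Suc n) i f (gs @ [t])))"
      by (rule M.finsum_Suc) (use fcl in \<open>auto intro!: M.finsum_closed sign_closed\<close>)
    also have "(\<Oplus>i\<in>{..Suc n}. sign i (\<Oplus>t\<in>H. face (Suc n) i f (gs @ [t]))) = coboundary R G M n S gs"
      unfolding coboundary_eq[OF S gsG]
      by (rule M.finsum_cong') (use sum_face face_closed[OF S gsG] in auto)
    also have "(\<Oplus>t\<in>H. face (Suc n) (Suc (Suc n)) f (gs @ [t])) = (\<Oplus>t\<in>H. f gs)"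
      by (rule M.finsum_cong') (use fc in \<open>auto simp: face_def\<close>)
    also have "\<dots> = scal (add_pow R (card H) \<one>\<^bsub>R\<^esub>) (f gs)"
      using M.add.finprod_const[OF fc] scal_add_pow[OF fc] by simp
    finally have "sign (Suc (Suc n)) (scal (add_pow R (card H) \<one>\<^bsub>R\<^esub>) (f gs)) \<oplus> coboundary R G M n S gs = \<zero>" by simp
    moreover have c: "scal (add_pow R (card H) \<one>\<^bsub>R\<^esub>) (f gs) \<in> carrier M" using fc by (simp add: R.add.nat_pow_closed)
    ultimately have "\<ominus> sign (Suc n) (scal (add_pow R (card H) \<one>\<^bsub>R\<^esub>) (f gs)) \<oplus> coboundary R G M n S gs = \<zero>"
      by (simp only: sign_Suc[of _ "Suc n"])
    then show ?thesis
      using c cochains_closed'[OF coboundary_closed[OF S]]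
      by (metis M.add.inv_closed M.add.inv_solve_left M.r_zero M.zero_closed sign_closed)
  qed
  \<comment> \<open>The sign in \<open>key\<close> is absorbed: \<open>v\<close> is
    \<open>(-1)^(n+1)\<close> divided by the order of \<open>H\<close>.\<close>
  define v where "v = (if even (Suc n) then u else \<ominus>\<^bsub>R\<^esub> u)"
  have v: "v \<in> carrier R" using u by (simp add: v_def)
  have vs: "scal v (sign (Suc n) x) = scal u x" if x: "x \<in> carrier M" for x
  proof -
    have "scal (\<ominus>\<^bsub>R\<^esub> u) (\<ominus> x) \<oplus> scal u (\<ominus> x) = \<zero>"
      using scal_add_left[of "\<ominus>\<^bsub>R\<^esub> u" u "\<ominus> x"] u x by (simp add: R.l_neg scal_zero_left)
    moreover have "scal u x \<oplus> scal u (\<ominus> x) = \<zero>"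
      using scal_add[of u x "\<ominus> x"] u x by (simp add: M.r_neg scal_zero_right)
    ultimately have "scal (\<ominus>\<^bsub>R\<^esub> u) (\<ominus> x) = scal u x" using u x
      by (metis M.add.inv_closed M.add.r_cancel R.add.inv_closed scal_closed)
    then show ?thesis by (simp add: v_def alternating_sign_def)
  qed
  show ?thesis
  proof (intro bexI ballI)
    show "(\<lambda>gs. scal v (S gs)) \<in> cochains G M n" by (rule cochains_scal[OF v S])
    fix gs assume gs: "gs \<in> tuples H (Suc n)"
    have "coboundary R G M n (\<lambda>gs. scal v (S gs)) gs = scal v (coboundary R G M n S gs)"
      using coboundary_scal[OF v S] by simp
    also have "\<dots> = scal u (scal (add_pow R (card H) \<one>\<^bsub>R\<^esub>) (f gs))"
      unfolding key[OF gs] by (rule vs) (simp add: fc R.add.nat_pow_closed)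
    also have "\<dots> = f gs" using scal_mult[of u "add_pow R (card H) \<one>\<^bsub>R\<^esub>" "f gs"] u fc
      by (simp add: R.add.nat_pow_closed scal_one)
    finally show "coboundary R G M n (\<lambda>gs. scal v (S gs)) gs = f gs" .
  qed
qed

end

context group_algebra_module
begin

lemma scal_minus_one: "x \<in> carrier M \<Longrightarrow> scal (\<ominus>\<^bsub>R\<^esub> \<one>\<^bsub>R\<^esub>) x = \<ominus> x"
  using scal_add_left[of "\<ominus>\<^bsub>R\<^esub> \<one>\<^bsub>R\<^esub>" "\<one>\<^bsub>R\<^esub>" x]
  by (intro M.minus_equality[symmetric]) (simp_all add: scal_one R.l_neg scal_zero_left)

lemma cochains_diff:
  "f \<in> cochains G M n \<Longrightarrow> f' \<in> cochains G M n \<Longrightarrow> (\<lambda>gs. f gs \<ominus> f' gs) \<in> cochains G M n"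
  by (simp add: cochains_def M.minus_eq)

lemma coboundary_diff:
  assumes f: "f \<in> cochains G M n" and f': "f' \<in> cochains G M n"
  shows "coboundary R G M n (\<lambda>gs. f gs \<ominus> f' gs) = (\<lambda>gs. coboundary R G M n f gs \<ominus> coboundary R G M n f' gs)"
proof -
  have m: "\<ominus>\<^bsub>R\<^esub> \<one>\<^bsub>R\<^esub> \<in> carrier R" by simp
  have "(\<lambda>gs. f gs \<ominus> f' gs) = (\<lambda>gs. f gs \<oplus> scal (\<ominus>\<^bsub>R\<^esub> \<one>\<^bsub>R\<^esub>) (f' gs))"
    using cochains_closed'[OF f'] by (simp add: scal_minus_one M.minus_eq)
  then have "coboundary R G M n (\<lambda>gs. f gs \<ominus> f' gs)
      = (\<lambda>gs. coboundary R G M n f gs \<oplus> scal (\<ominus>\<^bsub>R\<^esub> \<one>\<^bsub>R\<^esub>) (coboundary R G M n f' gs))"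
    by (simp only: coboundary_add[OF f cochains_scal[OF m f']] coboundary_scal[OF m f'])
  then show ?thesis
    using cochains_closed'[OF coboundary_closed[OF f']] by (simp add: scal_minus_one M.minus_eq)
qed

lemma coboundary_0:
  assumes f: "f \<in> cochains G M 0" and g: "g \<in> carrier G"
  shows "coboundary R G M 0 f [g] = act g (f []) \<ominus> f []"
  using g cochains_closed'[OF f]
  by (simp add: coboundary_def group_tuples_def act_def alternating_sign_def M.minus_eq smult_closed ring_single_closed)

lemma coboundaries_submodule: "submodule (coboundaries R G M (Suc n)) R (cocycle_module R G M (Suc n))"
proof -
  let ?Z = "cocycle_module R G M (Suc n)"
  interpret Z: module R ?Z by (rule cocycle_module_module)
  have ad: "f \<oplus>\<^bsub>?Z\<^esub> f' = (\<lambda>gs. f gs \<oplus> f' gs)" for f f' by (simp add: cocycle_module_def)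
  have B: "f \<in> coboundaries R G M (Suc n) \<longleftrightarrow> (\<exists>h\<in>cochains G M n. f = coboundary R G M n h)" for f
    by (auto simp: coboundaries_def)
  have sub: "coboundaries R G M (Suc n) \<subseteq> carrier ?Z"
    using coboundary_closed coboundary_coboundary by (auto simp: B cocycle_module_def cocycles_iff)
  have sm: "r \<odot>\<^bsub>?Z\<^esub> f \<in> coboundaries R G M (Suc n)" if r: "r \<in> carrier R" and f: "f \<in> coboundaries R G M (Suc n)" for r f
  proof -
    obtain h where h: "h \<in> cochains G M n" "f = coboundary R G M n h" using f unfolding B by blast
    then have "r \<odot>\<^bsub>?Z\<^esub> f = coboundary R G M n (\<lambda>gs. scal r (h gs))"
      using r coboundary_closed[OF h(1)] by (simp add: cocycle_module_smult coboundary_scal)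
    then show ?thesis unfolding B using cochains_scal[OF r h(1)] by blast
  qed
  show ?thesis
  proof (rule Z.submoduleI[OF sub])
    have "\<zero>\<^bsub>?Z\<^esub> = coboundary R G M n (\<lambda>gs. \<zero>)" by (simp add: coboundary_zero cocycle_module_def)
    then show "\<zero>\<^bsub>?Z\<^esub> \<in> coboundaries R G M (Suc n)" unfolding B using cochains_zero by blast
    show "\<ominus>\<^bsub>?Z\<^esub> f \<in> coboundaries R G M (Suc n)" if f: "f \<in> coboundaries R G M (Suc n)" for f
    proof -
      have "f \<in> carrier ?Z" using f sub by blast
      then have "\<ominus>\<^bsub>?Z\<^esub> f = (\<ominus>\<^bsub>R\<^esub> \<one>\<^bsub>R\<^esub>) \<odot>\<^bsub>?Z\<^esub> f" by (simp add: Z.smult_l_minus)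
      then show ?thesis using sm[OF _ f] by simp
    qed
    show "f \<oplus>\<^bsub>?Z\<^esub> f' \<in> coboundaries R G M (Suc n)"
      if ff: "f \<in> coboundaries R G M (Suc n)" "f' \<in> coboundaries R G M (Suc n)" for f f'
    proof -
      obtain h where h: "h \<in> cochains G M n" "f = coboundary R G M n h" using ff(1) unfolding B by blast
      obtain h' where h': "h' \<in> cochains G M n" "f' = coboundary R G M n h'" using ff(2) unfolding B by blast
      have "f \<oplus>\<^bsub>?Z\<^esub> f' = coboundary R G M n (\<lambda>gs. h gs \<oplus> h' gs)"
        unfolding ad coboundary_add[OF h(1) h'(1)] h(2) h'(2) ..
      then show ?thesis unfolding B using cochains_add[OF h(1) h'(1)] by blast
    qed
  qed (rule sm)
qed

end

section \<open>Coefficients in the group ring: degrees zero and one\<close>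

context group_algebra
begin

lemma regular_module: "group_algebra_module R G (regular_module RG)"
  by (intro group_algebra_module.intro group_algebra_axioms regular_module_left_module group_ring_ring)

interpretation Reg: group_algebra_module R G "regular_module RG"
  by (rule regular_module)

lemma regular_simps:
  "carrier (regular_module RG) = carrier RG" "a \<odot>\<^bsub>regular_module RG\<^esub> b = a \<otimes>\<^bsub>RG\<^esub> b"
  "a \<oplus>\<^bsub>regular_module RG\<^esub> b = a \<oplus>\<^bsub>RG\<^esub> b" "\<zero>\<^bsub>regular_module RG\<^esub> = \<zero>\<^bsub>RG\<^esub>"
  by (simp_all add: regular_module_def)

lemma regular_minus:
  assumes "a \<in> carrier RG" "b \<in> carrier RG"
  shows "(a \<ominus>\<^bsub>regular_module RG\<^esub> b) x = a x \<ominus> b x"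
proof -
  have "\<ominus>\<^bsub>regular_module RG\<^esub> b = \<ominus>\<^bsub>RG\<^esub> b"
    by (rule Reg.M.minus_equality) (use assms in \<open>simp_all add: regular_simps RG.l_neg\<close>)
  then show ?thesis
    using assms by (simp add: a_minus_def regular_simps group_ring_add group_ring_uminus)
qed

lemma regular_act: "g \<in> carrier G \<Longrightarrow> a \<in> carrier RG \<Longrightarrow> x \<in> carrier G \<Longrightarrow> Reg.act g a x = a (inv\<^bsub>G\<^esub> g \<otimes>\<^bsub>G\<^esub> x)"
  by (simp add: Reg.act_def regular_simps ring_single_mult)

lemma regular_scal:
  assumes "r \<in> carrier R" "a \<in> carrier RG"
  shows "Reg.scal r a = (\<lambda>x. r \<otimes> a x)"
proof
  fix x show "Reg.scal r a x = r \<otimes> a x"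
    using assms by (cases "x \<in> carrier G")
      (simp_all add: Reg.scal_def regular_simps ring_single_mult group_ring_mult_outside coeff_outside)
qed

text \<open>This is the form in which infinitude of the group enters, both for degree zero and for
  torsion-freeness in degree one.\<close>

lemma infinite_supp_complement:
  assumes "infinite (carrier G)" "a \<in> carrier RG"
  obtains y where "y \<in> carrier G" "a y = \<zero>"
proof -
  have "\<not> carrier G \<subseteq> supp a" using assms finite_subset supp_finite by blast
  then show thesis using that by blast
qed

text \<open>A cocycle of degree zero is an element of the group ring fixed by left translations. Its
  coefficients are all equal, and one of them is zero.\<close>

lemma cocycles_0_trivial:
  assumes inf: "infinite (carrier G)"
  shows "cocycles R G (regular_module RG) 0 = {\<lambda>gs. \<zero>\<^bsub>regular_module RG\<^esub>}"
proof
  show "{\<lambda>gs. \<zero>\<^bsub>regular_module RG\<^esub>} \<subseteq> cocycles R G (regular_module RG) 0"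
    using Reg.cochains_zero Reg.coboundary_zero by (simp add: Reg.cocycles_iff)
  show "cocycles R G (regular_module RG) 0 \<subseteq> {\<lambda>gs. \<zero>\<^bsub>regular_module RG\<^esub>}"
  proof
    fix f assume "f \<in> cocycles R G (regular_module RG) 0"
    then have f: "f \<in> cochains G (regular_module RG) 0"
      and c: "coboundary R G (regular_module RG) 0 f = (\<lambda>gs. \<zero>\<^bsub>regular_module RG\<^esub>)" by (simp_all add: Reg.cocycles_iff)
    have a: "f [] \<in> carrier RG" using Reg.cochains_closed'[OF f, of "[]"] by (simp add: regular_simps)
    obtain y where y: "y \<in> carrier G" "f [] y = \<zero>" using infinite_supp_complement[OF inf a] .
    have "f [] x = \<zero>" for x
    proof (cases "x \<in> carrier G")
      case x: True
      \<comment> \<open>Translation by \<open>?g\<close> moves the vanishing coefficient from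
        \<open>y\<close> to \<open>x\<close>.\<close>
      let ?g = "x \<otimes>\<^bsub>G\<^esub> inv\<^bsub>G\<^esub> y"
      have g: "?g \<in> carrier G" "inv\<^bsub>G\<^esub> ?g \<otimes>\<^bsub>G\<^esub> x = y"
        using x y by (simp_all add: G.inv_mult_group G.m_assoc)
      have "Reg.act ?g (f []) \<in> carrier RG" using Reg.act_closed[OF g(1)] a by (simp add: regular_simps)
      moreover have "Reg.act ?g (f []) \<ominus>\<^bsub>regular_module RG\<^esub> f [] = \<zero>\<^bsub>regular_module RG\<^esub>"
        using Reg.coboundary_0[OF f g(1)] by (simp add: c)
      ultimately have "Reg.act ?g (f []) x \<ominus> f [] x = \<zero>"
        using regular_minus[OF _ a, of "Reg.act ?g (f [])" x] by (simp add: regular_simps group_ring_zero)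
      then show ?thesis using regular_act[OF g(1) a x] g(2) y a by (simp add: R.minus_eq R.add.inv_eq_1_iff)
    qed (rule coeff_outside[OF a])
    then have "f [] = \<zero>\<^bsub>regular_module RG\<^esub>" by (auto simp: regular_simps group_ring_zero)
    moreover have "f gs = \<zero>\<^bsub>regular_module RG\<^esub>" if "gs \<noteq> []" for gs
      using f that by (simp add: cochains_def group_tuples_def)
    ultimately have "f gs = \<zero>\<^bsub>regular_module RG\<^esub>" for gs by (cases "gs = []") simp_all
    then show "f \<in> {\<lambda>gs. \<zero>\<^bsub>regular_module RG\<^esub>}" by auto
  qed
qed

lemma cohomology_0_zero:
  assumes "infinite (carrier G)"
  shows "zero_module (group_cohomology R G (regular_module RG) 0)"
  unfolding group_cohomology_def
proof (rule zero_module_quotientI)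
  interpret Z: module R "cocycle_module R G (regular_module RG) 0" by (rule Reg.cocycle_module_module)
  show "abelian_group (cocycle_module R G (regular_module RG) 0)" by (rule Z.abelian_group_axioms)
  show "carrier (cocycle_module R G (regular_module RG) 0) = coboundaries R G (regular_module RG) 0"
    using cocycles_0_trivial[OF assms] by (simp add: cocycle_module_def coboundaries_def)
qed

text \<open>If \<open>r f = \<delta> a\<close>, then every coefficient of \<open>a\<close> is a multiple of \<open>r\<close>: for given \<open>x\<close> choose \<open>g\<close>
  such that \<open>a\<close> vanishes at \<open>g\<^sup>-\<^sup>1 x\<close> and compare coefficients.\<close>

lemma cohomology_1_torsion_free:
  assumes inf: "infinite (carrier G)" and dom: "domain R"
    and r: "r \<in> carrier R" "r \<noteq> \<zero>" and f: "f \<in> cocycles R G (regular_module RG) 1"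
    and rf: "(\<lambda>gs. Reg.scal r (f gs)) \<in> coboundaries R G (regular_module RG) 1"
  shows "f \<in> coboundaries R G (regular_module RG) 1"
proof -
  interpret D: domain R by fact
  let ?M = "regular_module RG"
  have fc: "f \<in> cochains G ?M 1" using f by (simp add: Reg.cocycles_iff)
  have fR: "f gs \<in> carrier RG" for gs using Reg.cochains_closed'[OF fc] by (simp add: regular_simps)
  obtain m where m: "m \<in> cochains G ?M 0" "(\<lambda>gs. Reg.scal r (f gs)) = coboundary R G ?M 0 m"
    using rf by (auto simp: coboundaries_def)
  define a where "a = m []"
  have a: "a \<in> carrier RG" using Reg.cochains_closed'[OF m(1), of "[]"] by (simp add: regular_simps a_def)
  have actR: "Reg.act g b \<in> carrier RG" if "g \<in> carrier G" "b \<in> carrier RG" for g b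
    using Reg.act_closed[OF that(1)] that(2) by (simp add: regular_simps)
  have eq: "r \<otimes> f [g] x = a (inv\<^bsub>G\<^esub> g \<otimes>\<^bsub>G\<^esub> x) \<ominus> a x" if g: "g \<in> carrier G" and x: "x \<in> carrier G" for g x
  proof -
    have "Reg.scal r (f [g]) = Reg.act g a \<ominus>\<^bsub>?M\<^esub> a"
      using fun_cong[OF m(2), of "[g]"] Reg.coboundary_0[OF m(1) g] by (simp add: a_def)
    then have "(\<lambda>x. r \<otimes> f [g] x) = Reg.act g a \<ominus>\<^bsub>?M\<^esub> a" unfolding regular_scal[OF r(1) fR] .
    from fun_cong[OF this, of x] show ?thesis
      unfolding regular_minus[OF actR[OF g a] a, of x] regular_act[OF g a x] .
  qed
  have "\<exists>c\<in>carrier R. a x = r \<otimes> c" for x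
  proof (cases "x \<in> carrier G")
    case x: True
    obtain y where y: "y \<in> carrier G" "a y = \<zero>" using infinite_supp_complement[OF inf a] .
    let ?g = "x \<otimes>\<^bsub>G\<^esub> inv\<^bsub>G\<^esub> y"
    have g: "?g \<in> carrier G" "inv\<^bsub>G\<^esub> ?g \<otimes>\<^bsub>G\<^esub> x = y"
      using x y by (simp_all add: G.inv_mult_group G.m_assoc)
    have "r \<otimes> f [?g] x = \<ominus> a x" using eq[OF g(1) x] g(2) y a by (simp add: R.minus_eq)
    then have "a x = r \<otimes> (\<ominus> f [?g] x)"
      using r fR a by (metis R.add.inv_inv R.r_minus coeff_closed)
    then show ?thesis by (rule bexI) (simp add: fR)
  next
    case False
    then show ?thesis using coeff_outside[OF a] r by (intro bexI[of _ "\<zero>"]) auto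
  qed
  then obtain c where c: "\<And>x. c x \<in> carrier R" "\<And>x. a x = r \<otimes> c x" by metis
  \<comment> \<open>In a domain, division by the nonzero \<open>r\<close> keeps the support. So
    \<open>c\<close> is finitely supported and lies in the group ring, and its coboundary is
    \<open>f\<close> after cancelling \<open>r\<close>.\<close>
  have c0: "c x = \<zero> \<longleftrightarrow> a x = \<zero>" for x using c r D.integral_iff by auto
  have cR: "c \<in> carrier RG"
    using c(1) c0 coeff_outside[OF a] supp_finite[OF a] by (intro carrier_group_ringI) auto
  define h where "h = (\<lambda>gs :: 'g list. if gs = [] then c else \<zero>\<^bsub>?M\<^esub>)"
  have h: "h \<in> cochains G ?M 0"
    using cR by (auto simp: h_def cochains_def group_tuples_def regular_simps)
  have "f gs = coboundary R G ?M 0 h gs" for gs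
  proof (cases "gs \<in> group_tuples G 1")
    case True
    then obtain g where g: "gs = [g]" "g \<in> carrier G" by (auto simp: group_tuples_def length_Suc_conv)
    have "f [g] x = (Reg.act g c \<ominus>\<^bsub>?M\<^esub> c) x" for x
    proof (cases "x \<in> carrier G")
      case x: True
      have "r \<otimes> f [g] x = r \<otimes> (c (inv\<^bsub>G\<^esub> g \<otimes>\<^bsub>G\<^esub> x) \<ominus> c x)"
        using eq[OF g(2) x] c r by (simp add: R.minus_eq R.r_distr R.r_minus)
      then have "f [g] x = c (inv\<^bsub>G\<^esub> g \<otimes>\<^bsub>G\<^esub> x) \<ominus> c x"
        using D.m_lcancel[OF r(2,1)] fR c by simp
      then show ?thesis using regular_minus[OF actR[OF g(2) cR] cR, of x] regular_act[OF g(2) cR x] by simp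
    next
      case False
      then show ?thesis
        using regular_minus[OF actR[OF g(2) cR] cR, of x] coeff_outside[OF actR[OF g(2) cR]]
          coeff_outside[OF cR] coeff_outside[OF fR] by (simp add: R.minus_eq)
    qed
    then show ?thesis using Reg.coboundary_0[OF h g(2)] by (auto simp: g(1) h_def)
  next
    case False
    then show ?thesis using fc by (simp add: cochains_def coboundary_def)
  qed
  then have "f = coboundary R G ?M 0 h" by auto
  then show ?thesis using h by (simp add: coboundaries_def)
qed

text \<open>A class killed by \<open>r\<close> has a representative \<open>f\<close> for which
  \<open>r f\<close> is a coboundary, so this module is torsion-free by the previous lemma.\<close>

lemma cohomology_1_flat:
  assumes inf: "infinite (carrier G)" and pid: "principal_domain R"
  shows "flat_module TYPE('n) R (group_cohomology R G (regular_module RG) 1)"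
proof -
  let ?Z = "cocycle_module R G (regular_module RG) 1" and ?B = "coboundaries R G (regular_module RG) 1"
  interpret Z: module R ?Z by (rule Reg.cocycle_module_module)
  have sB: "submodule ?B R ?Z" using Reg.coboundaries_submodule[of 0] by simp
  interpret B: submodule ?B R ?Z by (rule sB)
  interpret B: abelian_subgroup ?B ?Z
    by (rule abelian_subgroupI3[OF additive_subgroup.intro[OF B.subgroup_axioms] Z.abelian_group_axioms])
  note Q = quotient_module_module[OF Z.module_axioms sB]
  have dom: "domain R" using pid by (rule principal_domain.axioms)
  show ?thesis unfolding group_cohomology_def
  proof (rule torsion_free_imp_flat[OF pid Q(1)])
    fix r X assume r: "r \<in> carrier R" and "X \<in> carrier (quotient_module ?Z ?B)"
      and rX: "r \<odot>\<^bsub>quotient_module ?Z ?B\<^esub> X = \<zero>\<^bsub>quotient_module ?Z ?B\<^esub>"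
    then obtain f where f: "f \<in> carrier ?Z" "X = ?B +>\<^bsub>?Z\<^esub> f" by (auto simp: quotient_module_def A_RCOSETS_def')
    have fc: "f \<in> cocycles R G (regular_module RG) 1" using f(1) by (simp add: cocycle_module_def)
    have "?B +>\<^bsub>?Z\<^esub> (r \<odot>\<^bsub>?Z\<^esub> f) = ?B" using rX Q(2)[OF f(1) r] f(2) by (simp add: quotient_module_def)
    then have "r \<odot>\<^bsub>?Z\<^esub> f \<in> ?B" using B.a_rcos_self[OF Z.smult_closed[OF r f(1)]] by simp
    then have rf: "(\<lambda>gs. Reg.scal r (f gs)) \<in> ?B"
      using fc r by (simp add: Reg.cocycle_module_smult Reg.cocycles_iff)
    show "r = \<zero> \<or> X = \<zero>\<^bsub>quotient_module ?Z ?B\<^esub>"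
    proof (cases "r = \<zero>")
      case False
      then have "f \<in> ?B" using cohomology_1_torsion_free[OF inf dom r False fc rf] by simp
      then have "?B +>\<^bsub>?Z\<^esub> f = ?B" using B.a_rcos_const by blast
      then show ?thesis using f(2) by (simp add: quotient_module_def)
    qed simp
  qed
qed

end

section \<open>Higher degrees: exhaustion by finite subgroups\<close>

locale exhausted_group_algebra = group_algebra R G
  for R :: "('r, 'x) ring_scheme" (structure) and G :: "('g, 'y) monoid_scheme" +
  fixes K :: "nat \<Rightarrow> 'g set"
  assumes K_subgroup: "\<And>n. subgroup (K n) G"
    and K_finite: "\<And>n. finite (K n)"
    and K_unit: "\<And>n. add_pow R (card (K n)) \<one> \<in> Units R"
    and K_Suc: "\<And>n. K n \<subseteq> K (Suc n)"
    and K_exhausts: "carrier G \<subseteq> (\<Union>n. K n)"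
    and K_0: "K 0 = {\<one>\<^bsub>G\<^esub>}"
begin

lemma K_mono: "m \<le> n \<Longrightarrow> K m \<subseteq> K n"
  using lift_Suc_mono_le[of K m n] K_Suc by blast

lemma K_subset: "K n \<subseteq> carrier G"
  using subgroup.subset[OF K_subgroup] .

lemma finite_subset_K:
  assumes "finite S" "S \<subseteq> carrier G" obtains n where "S \<subseteq> K n"
proof -
  have "\<exists>n. S \<subseteq> K n" using assms
  proof (induction S rule: finite_induct)
    case (insert x S)
    then obtain n where n: "S \<subseteq> K n" by auto
    obtain m where m: "x \<in> K m" using insert.prems K_exhausts by blast
    have "insert x S \<subseteq> K (max m n)" using n m K_mono[of n "max m n"] K_mono[of m "max m n"] by auto
    then show ?case by blast
  qed simp
  then show thesis using that by blast
qed

text \<open>Cochains that bound a given cocycle on \<open>K n\<close> and on \<open>K (n + 1)\<close> differ on \<open>K n\<close> by a cocycle of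
  positive degree, hence by a coboundary there; so they can be chosen compatibly.\<close>

lemma cocycle_is_coboundary:
  fixes M :: "('g \<Rightarrow> 'r, 'm) module"
  assumes M: "group_algebra_module R G M" and f: "f \<in> cocycles R G M (Suc (Suc m))"
  shows "f \<in> coboundaries R G M (Suc (Suc m))"
proof -
  interpret L: group_algebra_module R G M by fact
  have fc: "f \<in> cochains G M (Suc (Suc m))" and f0: "coboundary R G M (Suc (Suc m)) f = (\<lambda>gs. \<zero>\<^bsub>M\<^esub>)"
    using f by (simp_all add: L.cocycles_iff)
  note acyclic = L.finite_subgroup_acyclic[OF K_subgroup K_finite K_unit]
  have Km: "x \<otimes>\<^bsub>G\<^esub> y \<in> K n" if "x \<in> K n" "y \<in> K n" for x y n
    using subgroup.m_closed[OF K_subgroup that] .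
  define P where "P = (\<lambda>n h. h \<in> cochains G M (Suc m) \<and>
    (\<forall>gs\<in>L.tuples (K n) (Suc (Suc m)). coboundary R G M (Suc m) h gs = f gs))"
  define Q where "Q = (\<lambda>n (h :: 'g list \<Rightarrow> 'm) h'. \<forall>gs\<in>L.tuples (K n) (Suc m). h' gs = h gs)"
  have ex: "\<exists>h. P n h" for n
    using acyclic[OF fc, of n] f0 by (auto simp: P_def)
  \<comment> \<open>\<open>P\<close> says that a cochain bounds \<open>f\<close> on
    \<open>K n\<close>, \<open>Q\<close> that two cochains agree there. Any bounding cochain
    \<open>k\<close> on \<open>K (Suc n)\<close> will be corrected until it extends
    \<open>h\<close>.\<close>
  have step: "\<exists>h'. P (Suc n) h' \<and> Q n h h'" if h: "P n h" for n h
  proof -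
    obtain k where k: "P (Suc n) k" using ex by blast
    have hk: "h \<in> cochains G M (Suc m)" "k \<in> cochains G M (Suc m)" using h k by (auto simp: P_def)
    define c where "c = (\<lambda>gs. k gs \<ominus>\<^bsub>M\<^esub> h gs)"
    have c: "c \<in> cochains G M (Suc m)" unfolding c_def using hk by (simp add: L.cochains_diff)
    have "coboundary R G M (Suc m) c gs = \<zero>\<^bsub>M\<^esub>" if gs: "gs \<in> L.tuples (K n) (Suc (Suc m))" for gs
    proof -
      have "coboundary R G M (Suc m) k gs = f gs" "coboundary R G M (Suc m) h gs = f gs"
        using h k gs K_Suc[of n] by (auto simp: P_def)
      then show ?thesis using L.cochains_closed'[OF fc]
        unfolding c_def L.coboundary_diff[OF hk(2,1)] by (simp add: L.M.minus_eq L.M.r_neg)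
    qed
    \<comment> \<open>Here the degree of \<open>f\<close> must be at least two: \<open>c\<close> has
      degree \<open>m + 1 >= 1\<close>, so acyclicity over \<open>K n\<close> applies to it.\<close>
    then obtain u where u: "u \<in> cochains G M m" "\<forall>gs\<in>L.tuples (K n) (Suc m). coboundary R G M m u gs = c gs"
      using acyclic[OF c, of n] by blast
    \<comment> \<open>Subtracting a coboundary keeps the coboundary of \<open>k\<close> everywhere,
      and on \<open>K n\<close> it replaces \<open>k\<close> by
      \<open>k - (k - h) = h\<close>.\<close>
    define h' where "h' = (\<lambda>gs. k gs \<ominus>\<^bsub>M\<^esub> coboundary R G M m u gs)"
    have h': "h' \<in> cochains G M (Suc m)"
      unfolding h'_def using hk L.coboundary_closed[OF u(1)] by (simp add: L.cochains_diff)
    have "coboundary R G M (Suc m) h' gs = coboundary R G M (Suc m) k gs" for gs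
      unfolding h'_def L.coboundary_diff[OF hk(2) L.coboundary_closed[OF u(1)]] L.coboundary_coboundary[OF u(1)]
      using L.cochains_closed'[OF L.coboundary_closed[OF hk(2)]] by (simp add: L.M.minus_eq)
    then have "P (Suc n) h'" using h' k by (simp add: P_def)
    moreover have "h' gs = h gs" if gs: "gs \<in> L.tuples (K n) (Suc m)" for gs
    proof -
      have x: "k gs \<in> carrier M" "h gs \<in> carrier M" using L.cochains_closed' hk by auto
      have "h' gs = k gs \<ominus>\<^bsub>M\<^esub> (k gs \<ominus>\<^bsub>M\<^esub> h gs)" using u(2) gs by (simp add: h'_def c_def)
      also have "\<dots> = h gs" using x by (simp add: L.M.minus_eq L.M.minus_add L.M.a_assoc[symmetric] L.M.r_neg)
      finally show ?thesis .
    qed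
    ultimately show ?thesis by (auto simp: Q_def)
  qed
  have "\<exists>h. \<forall>n. P n (h n) \<and> Q n (h n) (h (Suc n))"
    by (rule dependent_nat_choice) (use ex step in blast)+
  then obtain h where h: "\<And>n. P n (h n)" "\<And>n. Q n (h n) (h (Suc n))" by blast
  have hc: "h n \<in> cochains G M (Suc m)" for n using h(1) by (simp add: P_def)
  \<comment> \<open>Each tuple is evaluated at the first stage that contains it; by \<open>Q\<close>
    every later stage gives the same value.\<close>
  define s where "s = (\<lambda>gs. if gs \<in> L.tuples (carrier G) (Suc m) then h (LEAST n. set gs \<subseteq> K n) gs else \<zero>\<^bsub>M\<^esub>)"
  have s: "s \<in> cochains G M (Suc m)"
    using L.cochains_closed'[OF hc] by (auto simp: s_def cochains_def group_tuples_def)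
  have sh: "s gs = h n gs" if gs: "gs \<in> L.tuples (K n) (Suc m)" for gs n
  proof -
    let ?N = "LEAST n. set gs \<subseteq> K n"
    have n: "set gs \<subseteq> K n" using gs by simp
    have N: "set gs \<subseteq> K ?N" "?N \<le> n"
      using LeastI[of "\<lambda>n. set gs \<subseteq> K n", OF n] Least_le[of "\<lambda>n. set gs \<subseteq> K n", OF n] by simp_all
    define k where "k = ?N"
    have "h i gs = h k gs" if "k \<le> i" for i
      using that
    proof (induction i rule: dec_induct)
      case (step i)
      have "set gs \<subseteq> K i" using N(1) K_mono[OF step.hyps(1)] unfolding k_def by (rule subset_trans)
      then have "h (Suc i) gs = h i gs" using h(2)[of i] gs unfolding Q_def by simp
      then show ?case using step.IH by (rule trans)
    qed simp
    from this[of n] have "h n gs = h ?N gs" using N(2) unfolding k_def by simp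
    moreover have "set gs \<subseteq> carrier G" using n K_subset by (rule subset_trans)
    ultimately show ?thesis using gs unfolding s_def by simp
  qed
  have "coboundary R G M (Suc m) s gs = f gs" for gs
  proof (cases "gs \<in> L.tuples (carrier G) (Suc (Suc m))")
    case True
    obtain n where n: "set gs \<subseteq> K n" using finite_subset_K[of "set gs"] True by auto
    then have gs: "gs \<in> L.tuples (K n) (Suc (Suc m))" using True by simp
    \<comment> \<open>On a tuple from \<open>K n\<close>, all values entering the coboundary are
      those of \<open>h n\<close>.\<close>
    have "coboundary R G M (Suc m) s gs = coboundary R G M (Suc m) (h n) gs"
      by (rule L.coboundary_cong[OF s hc Km K_subset gs sh])
    then show ?thesis using h(1)[of n] gs by (simp add: P_def)
  next
    case False
    show ?thesis unfolding L.coboundary_outside[OF False]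
      using fc False by (simp add: cochains_def group_tuples_def)
  qed
  then have "f = coboundary R G M (Suc m) s" by auto
  then show ?thesis using s by (simp add: coboundaries_def)
qed

lemma cohomology_higher_zero:
  assumes M: "group_algebra_module R G M"
  shows "zero_module (group_cohomology R G M (Suc (Suc m)))"
proof -
  interpret L: group_algebra_module R G M by fact
  interpret Z: module R "cocycle_module R G M (Suc (Suc m))" by (rule L.cocycle_module_module)
  have "coboundaries R G M (Suc (Suc m)) \<subseteq> cocycles R G M (Suc (Suc m))"
    using L.coboundary_closed L.coboundary_coboundary by (auto simp: coboundaries_def L.cocycles_iff)
  then have "carrier (cocycle_module R G M (Suc (Suc m))) = coboundaries R G M (Suc (Suc m))"
    using cocycle_is_coboundary[OF M] by (auto simp: cocycle_module_def)
  then show ?thesis unfolding group_cohomology_def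
    by (rule zero_module_quotientI[OF Z.abelian_group_axioms])
qed

end

section \<open>A projective resolution of length one\<close>

lemma linear_mapsD:
  assumes "f \<in> linear_maps A M N"
  shows "x \<in> carrier M \<Longrightarrow> f x \<in> carrier N"
    and "x \<in> carrier M \<Longrightarrow> y \<in> carrier M \<Longrightarrow> f (x \<oplus>\<^bsub>M\<^esub> y) = f x \<oplus>\<^bsub>N\<^esub> f y"
    and "a \<in> carrier A \<Longrightarrow> x \<in> carrier M \<Longrightarrow> f (a \<odot>\<^bsub>M\<^esub> x) = a \<odot>\<^bsub>N\<^esub> f x"
  using assms by (auto simp: linear_maps_def)

lemma linear_mapsI:
  assumes "\<And>x. x \<in> carrier M \<Longrightarrow> f x \<in> carrier N"
    and "\<And>x y. x \<in> carrier M \<Longrightarrow> y \<in> carrier M \<Longrightarrow> f (x \<oplus>\<^bsub>M\<^esub> y) = f x \<oplus>\<^bsub>N\<^esub> f y"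
    and "\<And>a x. a \<in> carrier A \<Longrightarrow> x \<in> carrier M \<Longrightarrow> f (a \<odot>\<^bsub>M\<^esub> x) = a \<odot>\<^bsub>N\<^esub> f x"
  shows "f \<in> linear_maps A M N"
  using assms by (auto simp: linear_maps_def)

lemma linear_maps_zero:
  assumes M: "left_module A M" and N: "left_module A N" and f: "f \<in> linear_maps A M N"
  shows "f \<zero>\<^bsub>M\<^esub> = \<zero>\<^bsub>N\<^esub>"
proof -
  interpret M: left_module A M by fact
  interpret N: left_module A N by fact
  have "f (\<zero>\<^bsub>A\<^esub> \<odot>\<^bsub>M\<^esub> \<zero>\<^bsub>M\<^esub>) = \<zero>\<^bsub>A\<^esub> \<odot>\<^bsub>N\<^esub> f \<zero>\<^bsub>M\<^esub>" by (rule linear_mapsD(3)[OF f]) simp_all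
  then show ?thesis using linear_mapsD(1)[OF f M.M.zero_closed] by (simp add: M.smult_l_null N.smult_l_null)
qed

lemma linear_maps_finsum:
  assumes M: "left_module A M" and N: "left_module A N" and f: "f \<in> linear_maps A M N"
    and I: "finite I" and x: "\<And>i. i \<in> I \<Longrightarrow> x i \<in> carrier M"
  shows "f (\<Oplus>\<^bsub>M\<^esub>i\<in>I. x i) = (\<Oplus>\<^bsub>N\<^esub>i\<in>I. f (x i))"
  using I x
proof (induction I rule: finite_induct)
  case empty
  interpret M: left_module A M by fact
  interpret N: left_module A N by fact
  show ?case using linear_maps_zero[OF M N f] by simp
next
  case (insert i I)
  interpret M: left_module A M by fact
  interpret N: left_module A N by fact
  have c: "x j \<in> carrier M" "f (x j) \<in> carrier N" if "j \<in> insert i I" for j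
    using insert.prems that linear_mapsD(1)[OF f] by blast+
  have "(\<Oplus>\<^bsub>M\<^esub>i\<in>insert i I. x i) = x i \<oplus>\<^bsub>M\<^esub> (\<Oplus>\<^bsub>M\<^esub>i\<in>I. x i)"
    using insert.hyps c by (intro M.M.finsum_insert) auto
  moreover have "(\<Oplus>\<^bsub>N\<^esub>i\<in>insert i I. f (x i)) = f (x i) \<oplus>\<^bsub>N\<^esub> (\<Oplus>\<^bsub>N\<^esub>i\<in>I. f (x i))"
    using insert.hyps c by (intro N.M.finsum_insert) auto
  moreover have "(\<Oplus>\<^bsub>M\<^esub>i\<in>I. x i) \<in> carrier M" using c by (intro M.M.finsum_closed) auto
  ultimately show ?case using insert.IH insert.prems linear_mapsD(2)[OF f] c by simp
qed

text \<open>The dual basis lemma for a countable family: \<open>i\<close> records the coordinates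
  \<open>c n\<close>, and \<open>p\<close> forms the combination of the \<open>x n\<close>. The
  injection \<open>b\<close> only provides names for the basis elements, because
  \<open>projective_module\<close> takes bases inside the type of the module; the \<open>x n\<close>
  may repeat.\<close>

lemma projective_module_dual_basis:
  fixes M :: "('a, 'm) module" and b x :: "nat \<Rightarrow> 'm"
  assumes M: "left_module A M" and b: "inj b"
    and x: "\<And>n. x n \<in> carrier M" and c: "\<And>n. c n \<in> linear_maps A M (regular_module A)"
    and expand: "\<And>y. y \<in> carrier M \<Longrightarrow> \<exists>N. (\<forall>n\<ge>N. c n y = \<zero>\<^bsub>A\<^esub>) \<and> y = (\<Oplus>\<^bsub>M\<^esub>n\<in>{..<N}. c n y \<odot>\<^bsub>M\<^esub> x n)"
  shows "projective_module A M"
proof -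
  interpret M: left_module A M by fact
  let ?F = "free_module A (range b)"
  define i where "i = (\<lambda>y s. if s \<in> range b then c (inv_into UNIV b s) y else \<zero>\<^bsub>A\<^esub>)"
  define p where "p = (\<lambda>f. \<Oplus>\<^bsub>M\<^esub>n\<in>{n. f (b n) \<noteq> \<zero>\<^bsub>A\<^esub>}. f (b n) \<odot>\<^bsub>M\<^esub> x n)"
  have ib: "i y (b n) = c n y" for y n using b by (simp add: i_def)
  have cc: "c n y \<in> carrier A" if "y \<in> carrier M" for n y
    using linear_mapsD(1)[OF c that] by (simp add: regular_module_def)
  have iF: "i y \<in> carrier ?F" if y: "y \<in> carrier M" for y
  proof -
    obtain N where N: "\<forall>n\<ge>N. c n y = \<zero>\<^bsub>A\<^esub>" using expand[OF y] by blast
    have "{s. i y s \<noteq> \<zero>\<^bsub>A\<^esub>} \<subseteq> b ` {..<N}"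
    proof
      fix s assume s: "s \<in> {s. i y s \<noteq> \<zero>\<^bsub>A\<^esub>}"
      then have "s \<in> range b" by (auto simp: i_def split: if_splits)
      then obtain n where n: "s = b n" by blast
      then have "c n y \<noteq> \<zero>\<^bsub>A\<^esub>" using s ib by simp
      then have "n < N" using N by (meson not_le)
      then show "s \<in> b ` {..<N}" using n by simp
    qed
    then have "finite {s. i y s \<noteq> \<zero>\<^bsub>A\<^esub>}" by (rule finite_subset) simp
    moreover have "i y s \<in> carrier A" for s using cc[OF y] by (simp add: i_def)
    moreover have "i y s = \<zero>\<^bsub>A\<^esub>" if "s \<notin> range b" for s using that by (simp add: i_def)
    ultimately show ?thesis by (simp add: free_module_def)
  qed
  have i: "i \<in> linear_maps A M ?F"
  proof (rule linear_mapsI[OF iF])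
    fix y z assume y: "y \<in> carrier M" and z: "z \<in> carrier M"
    show "i (y \<oplus>\<^bsub>M\<^esub> z) = i y \<oplus>\<^bsub>?F\<^esub> i z"
      using linear_mapsD(2)[OF c y z] by (auto simp: free_module_def i_def regular_module_def)
  next
    fix a y assume "a \<in> carrier A" "y \<in> carrier M"
    then show "i (a \<odot>\<^bsub>M\<^esub> y) = a \<odot>\<^bsub>?F\<^esub> i y"
      using linear_mapsD(3)[OF c] by (auto simp: free_module_def i_def regular_module_def)
  qed
  have fA: "f s \<in> carrier A" if "f \<in> carrier ?F" for f s using that by (simp add: free_module_def)
  have fin: "finite {n. f (b n) \<noteq> \<zero>\<^bsub>A\<^esub>}" if "f \<in> carrier ?F" for f
  proof -
    have "finite {s. f s \<noteq> \<zero>\<^bsub>A\<^esub>}" using that by (simp add: free_module_def)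
    then have "finite (b -` {s. f s \<noteq> \<zero>\<^bsub>A\<^esub>})" using b by (rule finite_vimageI)
    then show ?thesis by (simp add: vimage_def)
  qed
  have term_closed: "f (b n) \<odot>\<^bsub>M\<^esub> x n \<in> carrier M" if "f \<in> carrier ?F" for f n
    using fA[OF that] x by (rule M.smult_closed)
  \<comment> \<open>As for products in the group ring, sums over larger finite index sets make the
    values at different \<open>f\<close> comparable.\<close>
  have p_eq: "p f = (\<Oplus>\<^bsub>M\<^esub>n\<in>H. f (b n) \<odot>\<^bsub>M\<^esub> x n)"
    if f: "f \<in> carrier ?F" and H: "finite H" "{n. f (b n) \<noteq> \<zero>\<^bsub>A\<^esub>} \<subseteq> H" for f H
    unfolding p_def
  proof (rule M.M.add.finprod_mono_neutral_cong_left[OF H])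
    fix n assume "n \<in> H - {n. f (b n) \<noteq> \<zero>\<^bsub>A\<^esub>}"
    then have "f (b n) = \<zero>\<^bsub>A\<^esub>" by simp
    then show "f (b n) \<odot>\<^bsub>M\<^esub> x n = \<zero>\<^bsub>M\<^esub>" using x by (simp add: M.smult_l_null)
  qed (use term_closed[OF f] in auto)
  have p: "p \<in> linear_maps A ?F M"
  proof (rule linear_mapsI)
    fix f assume f: "f \<in> carrier ?F"
    show "p f \<in> carrier M" unfolding p_def by (rule M.M.finsum_closed) (use term_closed[OF f] in auto)
    show "p (a \<odot>\<^bsub>?F\<^esub> f) = a \<odot>\<^bsub>M\<^esub> p f" if a: "a \<in> carrier A" for a
    proof -
      let ?H = "{n. f (b n) \<noteq> \<zero>\<^bsub>A\<^esub>}"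
      have s: "(a \<odot>\<^bsub>?F\<^esub> f) = (\<lambda>s. a \<otimes>\<^bsub>A\<^esub> f s)" by (simp add: free_module_def)
      have "{s. a \<otimes>\<^bsub>A\<^esub> f s \<noteq> \<zero>\<^bsub>A\<^esub>} \<subseteq> {s. f s \<noteq> \<zero>\<^bsub>A\<^esub>}" using a by auto
      then have af: "a \<odot>\<^bsub>?F\<^esub> f \<in> carrier ?F"
        using f a finite_subset unfolding s by (auto simp: free_module_def)
      have "p (a \<odot>\<^bsub>?F\<^esub> f) = (\<Oplus>\<^bsub>M\<^esub>n\<in>?H. (a \<odot>\<^bsub>?F\<^esub> f) (b n) \<odot>\<^bsub>M\<^esub> x n)"
        by (rule p_eq[OF af fin[OF f]]) (use a in \<open>auto simp: s\<close>)
      also have "\<dots> = (\<Oplus>\<^bsub>M\<^esub>n\<in>?H. a \<odot>\<^bsub>M\<^esub> (f (b n) \<odot>\<^bsub>M\<^esub> x n))"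
        by (rule M.M.finsum_cong') (use a x fA[OF f] in \<open>auto simp: s M.smult_assoc intro!: M.smult_closed\<close>)
      also have "\<dots> = a \<odot>\<^bsub>M\<^esub> p f"
        unfolding p_def by (rule M.smult_finsum[symmetric, OF a]) (use term_closed[OF f] in auto)
      finally show ?thesis .
    qed
    fix g assume g: "g \<in> carrier ?F"
    show "p (f \<oplus>\<^bsub>?F\<^esub> g) = p f \<oplus>\<^bsub>M\<^esub> p g"
    proof -
      let ?H = "{n. f (b n) \<noteq> \<zero>\<^bsub>A\<^esub>} \<union> {n. g (b n) \<noteq> \<zero>\<^bsub>A\<^esub>}"
      have H: "finite ?H" using fin f g by simp
      have s: "(f \<oplus>\<^bsub>?F\<^esub> g) = (\<lambda>s. f s \<oplus>\<^bsub>A\<^esub> g s)" by (simp add: free_module_def)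
      have "{s. f s \<oplus>\<^bsub>A\<^esub> g s \<noteq> \<zero>\<^bsub>A\<^esub>} \<subseteq> {s. f s \<noteq> \<zero>\<^bsub>A\<^esub>} \<union> {s. g s \<noteq> \<zero>\<^bsub>A\<^esub>}" by auto
      moreover have "finite ({s. f s \<noteq> \<zero>\<^bsub>A\<^esub>} \<union> {s. g s \<noteq> \<zero>\<^bsub>A\<^esub>})" using f g by (simp add: free_module_def)
      ultimately have "finite {s. f s \<oplus>\<^bsub>A\<^esub> g s \<noteq> \<zero>\<^bsub>A\<^esub>}" by (rule finite_subset)
      then have fg: "f \<oplus>\<^bsub>?F\<^esub> g \<in> carrier ?F"
        using f g unfolding s by (simp add: free_module_def)
      have "p (f \<oplus>\<^bsub>?F\<^esub> g) = (\<Oplus>\<^bsub>M\<^esub>n\<in>?H. (f \<oplus>\<^bsub>?F\<^esub> g) (b n) \<odot>\<^bsub>M\<^esub> x n)"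
        by (rule p_eq[OF fg H]) (auto simp: s)
      also have "\<dots> = (\<Oplus>\<^bsub>M\<^esub>n\<in>?H. f (b n) \<odot>\<^bsub>M\<^esub> x n \<oplus>\<^bsub>M\<^esub> g (b n) \<odot>\<^bsub>M\<^esub> x n)"
        by (rule M.M.finsum_cong') (use term_closed f g x fA in \<open>auto simp: s M.smult_l_distr\<close>)
      also have "\<dots> = (\<Oplus>\<^bsub>M\<^esub>n\<in>?H. f (b n) \<odot>\<^bsub>M\<^esub> x n) \<oplus>\<^bsub>M\<^esub> (\<Oplus>\<^bsub>M\<^esub>n\<in>?H. g (b n) \<odot>\<^bsub>M\<^esub> x n)"
        by (rule M.M.finsum_addf) (use term_closed f g in auto)
      also have "\<dots> = p f \<oplus>\<^bsub>M\<^esub> p g"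
        using p_eq[OF f H] p_eq[OF g H] by simp
      finally show ?thesis .
    qed
  qed
  have "p (i y) = y" if y: "y \<in> carrier M" for y
  proof -
    obtain N where N: "\<forall>n\<ge>N. c n y = \<zero>\<^bsub>A\<^esub>" "y = (\<Oplus>\<^bsub>M\<^esub>n\<in>{..<N}. c n y \<odot>\<^bsub>M\<^esub> x n)" using expand[OF y] by blast
    have "{n. i y (b n) \<noteq> \<zero>\<^bsub>A\<^esub>} \<subseteq> {..<N}" using N(1) by (auto simp: ib not_le[symmetric])
    then have "p (i y) = (\<Oplus>\<^bsub>M\<^esub>n\<in>{..<N}. i y (b n) \<odot>\<^bsub>M\<^esub> x n)" by (intro p_eq[OF iF[OF y]]) simp_all
    then show ?thesis using N(2) by (simp add: ib)
  qed
  then show ?thesis unfolding projective_module_def using M i p by blast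
qed

text \<open>A copy of \<open>M\<close> along an injection with left inverse \<open>\<psi>\<close>.
  The modules arising naturally consist of functions on the group, while the definitions of
  dimension and finiteness type ask for functions on words.\<close>

definition transport_module :: "('m \<Rightarrow> 'p) \<Rightarrow> ('p \<Rightarrow> 'm) \<Rightarrow> ('a, 'm) module \<Rightarrow> ('a, 'p) module" where
  "transport_module \<phi> \<psi> M = \<lparr>carrier = \<phi> ` carrier M, monoid.mult = undefined, monoid.one = undefined,
     zero = \<phi> \<zero>\<^bsub>M\<^esub>, add = (\<lambda>x y. \<phi> (\<psi> x \<oplus>\<^bsub>M\<^esub> \<psi> y)), smult = (\<lambda>a x. \<phi> (a \<odot>\<^bsub>M\<^esub> \<psi> x))\<rparr>"

context
  fixes \<phi> :: "'m \<Rightarrow> 'p" and \<psi> :: "'p \<Rightarrow> 'm"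
  assumes inverse: "\<And>x. \<psi> (\<phi> x) = x"
begin

lemma transport_left_module:
  assumes "left_module A M" shows "left_module A (transport_module \<phi> \<psi> M)"
proof -
  interpret M: left_module A M by fact
  let ?P = "transport_module \<phi> \<psi> M"
  have ag: "abelian_group ?P"
  proof (rule abelian_groupI)
    fix x assume "x \<in> carrier ?P"
    then obtain u where u: "x = \<phi> u" "u \<in> carrier M" by (auto simp: transport_module_def)
    show "\<exists>y\<in>carrier ?P. y \<oplus>\<^bsub>?P\<^esub> x = \<zero>\<^bsub>?P\<^esub>"
      using u by (intro bexI[of _ "\<phi> (\<ominus>\<^bsub>M\<^esub> u)"]) (simp_all add: transport_module_def inverse M.M.l_neg)
  qed (auto simp: transport_module_def inverse M.M.a_ac)
  show ?thesis
    unfolding left_module_def left_module_axioms_def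
    using ag M.A.ring_axioms
    by (auto simp: transport_module_def inverse M.smult_closed M.smult_l_distr M.smult_r_distr M.smult_assoc M.smult_one)
qed

lemma transport_linear:
  "\<phi> \<in> linear_maps A M (transport_module \<phi> \<psi> M)" "\<psi> \<in> linear_maps A (transport_module \<phi> \<psi> M) M"
  if "left_module A M"
proof -
  interpret M: left_module A M by fact
  show "\<phi> \<in> linear_maps A M (transport_module \<phi> \<psi> M)" "\<psi> \<in> linear_maps A (transport_module \<phi> \<psi> M) M"
    by (auto simp: linear_maps_def transport_module_def inverse M.smult_closed)
qed

text \<open>The dual basis is given on \<open>M\<close> itself; only \<open>b\<close> takes values
  in the new type, since projectivity of the copy refers to bases there.\<close>

lemma transport_projective:
  fixes M :: "('a, 'm) module" and b :: "nat \<Rightarrow> 'p" and x :: "nat \<Rightarrow> 'm"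
  assumes M: "left_module A M" and b: "inj b"
    and x: "\<And>n. x n \<in> carrier M" and c: "\<And>n. c n \<in> linear_maps A M (regular_module A)"
    and expand: "\<And>y. y \<in> carrier M \<Longrightarrow> \<exists>N. (\<forall>n\<ge>N. c n y = \<zero>\<^bsub>A\<^esub>) \<and> y = (\<Oplus>\<^bsub>M\<^esub>n\<in>{..<N}. c n y \<odot>\<^bsub>M\<^esub> x n)"
  shows "projective_module A (transport_module \<phi> \<psi> M)"
proof (rule projective_module_dual_basis[where b = b and x = "\<lambda>n. \<phi> (x n)" and c = "\<lambda>n y. c n (\<psi> y)"])
  interpret M: left_module A M by fact
  let ?P = "transport_module \<phi> \<psi> M"
  show P: "left_module A ?P" by (rule transport_left_module[OF M])
  note \<phi> = transport_linear(1)[OF M] and \<psi> = transport_linear(2)[OF M]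
  show "\<phi> (x n) \<in> carrier ?P" for n using linear_mapsD(1)[OF \<phi> x] .
  show "(\<lambda>y. c n (\<psi> y)) \<in> linear_maps A ?P (regular_module A)" for n
  proof (rule linear_mapsI)
    fix y assume y: "y \<in> carrier ?P"
    show "c n (\<psi> y) \<in> carrier (regular_module A)" by (rule linear_mapsD(1)[OF c linear_mapsD(1)[OF \<psi> y]])
    show "c n (\<psi> (a \<odot>\<^bsub>?P\<^esub> y)) = a \<odot>\<^bsub>regular_module A\<^esub> c n (\<psi> y)" if "a \<in> carrier A" for a
      unfolding linear_mapsD(3)[OF \<psi> that y] by (rule linear_mapsD(3)[OF c that linear_mapsD(1)[OF \<psi> y]])
    show "c n (\<psi> (y \<oplus>\<^bsub>?P\<^esub> z)) = c n (\<psi> y) \<oplus>\<^bsub>regular_module A\<^esub> c n (\<psi> z)" if "z \<in> carrier ?P" for z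
      unfolding linear_mapsD(2)[OF \<psi> y that]
      by (rule linear_mapsD(2)[OF c linear_mapsD(1)[OF \<psi> y] linear_mapsD(1)[OF \<psi> that]])
  qed
  fix y assume "y \<in> carrier ?P"
  then obtain z where z: "z \<in> carrier M" "y = \<phi> z" by (auto simp: transport_module_def)
  obtain N where N: "\<forall>n\<ge>N. c n z = \<zero>\<^bsub>A\<^esub>" "z = (\<Oplus>\<^bsub>M\<^esub>n\<in>{..<N}. c n z \<odot>\<^bsub>M\<^esub> x n)" using expand[OF z(1)] by blast
  have cc: "c n z \<in> carrier A" for n using linear_mapsD(1)[OF c z(1)] by (simp add: regular_module_def)
  have "\<phi> (\<Oplus>\<^bsub>M\<^esub>n\<in>{..<N}. c n z \<odot>\<^bsub>M\<^esub> x n) = (\<Oplus>\<^bsub>?P\<^esub>n\<in>{..<N}. \<phi> (c n z \<odot>\<^bsub>M\<^esub> x n))"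
    by (rule linear_maps_finsum[OF M P \<phi>]) (use cc x M.smult_closed in auto)
  also have "\<dots> = (\<Oplus>\<^bsub>?P\<^esub>n\<in>{..<N}. c n z \<odot>\<^bsub>?P\<^esub> \<phi> (x n))"
    using linear_mapsD(3)[OF \<phi> cc x] by simp
  finally have "y = (\<Oplus>\<^bsub>?P\<^esub>n\<in>{..<N}. c n (\<psi> y) \<odot>\<^bsub>?P\<^esub> \<phi> (x n))"
    unfolding z(2) inverse N(2)[symmetric] .
  moreover have "\<forall>n\<ge>N. c n (\<psi> y) = \<zero>\<^bsub>A\<^esub>" using N(1) by (simp add: z(2) inverse)
  ultimately show "\<exists>N. (\<forall>n\<ge>N. c n (\<psi> y) = \<zero>\<^bsub>A\<^esub>) \<and> y = (\<Oplus>\<^bsub>?P\<^esub>n\<in>{..<N}. c n (\<psi> y) \<odot>\<^bsub>?P\<^esub> \<phi> (x n))"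
    by blast
qed (rule b)

end

lemma left_module_submodule:
  assumes M: "left_module A M" and H: "H \<subseteq> carrier M" "\<zero>\<^bsub>M\<^esub> \<in> H"
    and add: "\<And>x y. x \<in> H \<Longrightarrow> y \<in> H \<Longrightarrow> x \<oplus>\<^bsub>M\<^esub> y \<in> H"
    and smult: "\<And>a x. a \<in> carrier A \<Longrightarrow> x \<in> H \<Longrightarrow> a \<odot>\<^bsub>M\<^esub> x \<in> H"
  shows "left_module A (M\<lparr>carrier := H\<rparr>)"
proof -
  interpret M: left_module A M by fact
  have Hc: "x \<in> carrier M" if "x \<in> H" for x using that H by auto
  have neg: "\<ominus>\<^bsub>M\<^esub> x \<in> H" if "x \<in> H" for x
    using smult[of "\<ominus>\<^bsub>A\<^esub> \<one>\<^bsub>A\<^esub>" x] that Hc[OF that] by (simp add: M.smult_l_minus M.smult_one)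
  have "abelian_group (M\<lparr>carrier := H\<rparr>)"
  proof (rule abelian_groupI)
    fix x assume "x \<in> carrier (M\<lparr>carrier := H\<rparr>)"
    then show "\<exists>y\<in>carrier (M\<lparr>carrier := H\<rparr>). y \<oplus>\<^bsub>M\<lparr>carrier := H\<rparr>\<^esub> x = \<zero>\<^bsub>M\<lparr>carrier := H\<rparr>\<^esub>"
      using neg[of x] Hc[of x] by (intro bexI[of _ "\<ominus>\<^bsub>M\<^esub> x"]) (simp_all add: M.M.l_neg)
  qed (simp_all add: H add Hc M.M.a_ac)
  then show ?thesis
    unfolding left_module_def left_module_axioms_def
    by (simp add: M.A.ring_axioms smult Hc M.smult_l_distr M.smult_r_distr M.smult_assoc M.smult_one)
qed

section \<open>Averaging idempotents and the augmentation ideal\<close>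

context exhausted_group_algebra
begin

definition weight :: "nat \<Rightarrow> 'r" where
  "weight n = inv (add_pow R (card (K n)) \<one>)"

definition idem :: "nat \<Rightarrow> 'g \<Rightarrow> 'r" where
  "idem n = (\<lambda>g. if g \<in> K n then weight n else \<zero>)"

lemma weight_closed: "weight n \<in> carrier R"
  unfolding weight_def by (rule R.Units_inv_closed[OF K_unit])

lemma idem_closed: "idem n \<in> carrier RG"
proof (rule carrier_group_ringI)
  show "idem n g \<in> carrier R" for g by (simp add: idem_def weight_closed)
  show "idem n g = \<zero>" if "g \<notin> carrier G" for g using that K_subset[of n] by (auto simp: idem_def)
  have "supp (idem n) \<subseteq> K n" by (auto simp: idem_def)
  then show "finite (supp (idem n))" using K_finite by (rule finite_subset)
qed

lemma supp_idem: "supp (idem n) \<subseteq> K n"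
  by (auto simp: idem_def)

lemma augmentation_idem: "augmentation (idem n) = \<one>"
proof -
  have "augmentation (idem n) = (\<Oplus>g\<in>K n. idem n g)"
    by (rule augmentation_eq[OF idem_closed K_finite supp_idem])
  also have "\<dots> = (\<Oplus>g\<in>K n. weight n)"
    by (rule R.finsum_cong') (auto simp: idem_def weight_closed)
  also have "\<dots> = add_pow R (card (K n)) (weight n)"
    by (rule R.add.finprod_const[OF weight_closed])
  also have "\<dots> = add_pow R (card (K n)) \<one> \<otimes> weight n"
    using R.add_pow_ldistr[OF R.one_closed weight_closed] weight_closed by simp
  also have "\<dots> = \<one>" unfolding weight_def by (rule R.Units_r_inv[OF K_unit])
  finally show ?thesis .
qed

text \<open>Here \<open>K 0\<close> is the trivial subgroup: the telescoping sum for
  \<open>y\<close> has to start at \<open>y\<close> times the unit.\<close>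

lemma idem_0: "idem 0 = \<one>\<^bsub>RG\<^esub>"
proof -
  have "weight 0 = inv (add_pow R (1 :: nat) \<one>)" by (simp add: weight_def K_0)
  also have "add_pow R (1 :: nat) \<one> = \<one>" by simp
  finally have "weight 0 = \<one>" by simp
  then show ?thesis by (auto simp: idem_def K_0 group_ring_one ring_single_def fun_eq_iff)
qed

text \<open>Each element of \<open>K n\<close> fixes the average from the left, so \<open>y\<close>
  acts on it through its augmentation. Both the absorption law for \<open>m <= n\<close> and the
  annihilation of elements of augmentation zero follow.\<close>

lemma mult_idem:
  assumes y: "y \<in> carrier RG" and s: "supp y \<subseteq> K n"
  shows "y \<otimes>\<^bsub>RG\<^esub> idem n = (\<lambda>g. augmentation y \<otimes> idem n g)"
proof
  fix g
  show "(y \<otimes>\<^bsub>RG\<^esub> idem n) g = augmentation y \<otimes> idem n g"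
  proof (cases "g \<in> carrier G")
    case g: True
    have "(y \<otimes>\<^bsub>RG\<^esub> idem n) g = (\<Oplus>h\<in>K n. y h \<otimes> idem n (inv\<^bsub>G\<^esub> h \<otimes>\<^bsub>G\<^esub> g))"
      by (rule group_ring_mult[OF y idem_closed g K_finite s])
    also have "\<dots> = (\<Oplus>h\<in>K n. y h \<otimes> idem n g)"
    proof (rule R.finsum_cong')
      fix h assume h: "h \<in> K n"
      interpret H: subgroup "K n" G by (rule K_subgroup)
      have "inv\<^bsub>G\<^esub> h \<otimes>\<^bsub>G\<^esub> g \<in> K n \<longleftrightarrow> g \<in> K n"
      proof
        assume "inv\<^bsub>G\<^esub> h \<otimes>\<^bsub>G\<^esub> g \<in> K n"
        then have "h \<otimes>\<^bsub>G\<^esub> (inv\<^bsub>G\<^esub> h \<otimes>\<^bsub>G\<^esub> g) \<in> K n" using h by simp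
        then show "g \<in> K n" using h g H.subset by (auto simp: G.m_assoc[symmetric])
      qed (use h in simp)
      then show "y h \<otimes> idem n (inv\<^bsub>G\<^esub> h \<otimes>\<^bsub>G\<^esub> g) = y h \<otimes> idem n g" by (simp add: idem_def)
    qed (use y idem_closed in auto)
    also have "\<dots> = (\<Oplus>h\<in>K n. y h) \<otimes> idem n g"
      by (rule R.finsum_ldistr[symmetric]) (use y idem_closed K_finite in auto)
    also have "(\<Oplus>h\<in>K n. y h) = augmentation y"
      by (rule augmentation_eq[OF y K_finite s, symmetric])
    finally show ?thesis .
  next
    case False
    then show ?thesis
      using coeff_outside[OF idem_closed] augmentation_closed[OF y] by (simp add: group_ring_mult_outside)
  qed
qed

lemma idem_mult_idem: "m \<le> n \<Longrightarrow> idem m \<otimes>\<^bsub>RG\<^esub> idem n = idem n"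
  using mult_idem[OF idem_closed subset_trans[OF supp_idem K_mono], of m n] idem_closed
  by (simp add: augmentation_idem)

abbreviation aug_ideal where "aug_ideal \<equiv> {a \<in> carrier RG. augmentation a = \<zero>}"

abbreviation aug_module where "aug_module \<equiv> (regular_module RG)\<lparr>carrier := aug_ideal\<rparr>"

lemma augmentation_zero: "augmentation \<zero>\<^bsub>RG\<^esub> = \<zero>"
  unfolding augmentation_def by (rule R.add.finprod_one_eqI) (simp add: group_ring_zero)

lemma aug_module_left_module: "left_module RG aug_module"
proof (rule left_module_submodule[OF regular_module_left_module[OF group_ring_ring]])
  show "aug_ideal \<subseteq> carrier (regular_module RG)" by (auto simp: regular_simps)
  show "\<zero>\<^bsub>regular_module RG\<^esub> \<in> aug_ideal" by (simp add: regular_simps augmentation_zero)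
  show "x \<oplus>\<^bsub>regular_module RG\<^esub> y \<in> aug_ideal" if "x \<in> aug_ideal" "y \<in> aug_ideal" for x y
    using that by (simp add: regular_simps augmentation_add)
  show "a \<odot>\<^bsub>regular_module RG\<^esub> x \<in> aug_ideal" if "a \<in> carrier RG" "x \<in> aug_ideal" for a x
    using that augmentation_closed by (simp add: regular_simps augmentation_mult)
qed

lemma augmentation_minus:
  assumes "a \<in> carrier RG" "b \<in> carrier RG"
  shows "augmentation (a \<ominus>\<^bsub>RG\<^esub> b) = augmentation a \<ominus> augmentation b"
proof -
  have c: "a \<ominus>\<^bsub>RG\<^esub> b \<in> carrier RG" using assms by simp
  have "augmentation (a \<ominus>\<^bsub>RG\<^esub> b) \<oplus> augmentation b = augmentation (a \<ominus>\<^bsub>RG\<^esub> b \<oplus>\<^bsub>RG\<^esub> b)"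
    by (rule augmentation_add[OF c assms(2), symmetric])
  also have "a \<ominus>\<^bsub>RG\<^esub> b \<oplus>\<^bsub>RG\<^esub> b = a" using assms by (simp add: RG.minus_eq RG.a_assoc RG.l_neg)
  finally have "augmentation (a \<ominus>\<^bsub>RG\<^esub> b) \<oplus> augmentation b = augmentation a" .
  then show ?thesis
    using augmentation_closed[OF c] augmentation_closed[OF assms(1)] augmentation_closed[OF assms(2)]
    by (metis R.add.inv_solve_right R.minus_eq)
qed

text \<open>The idempotents \<open>e\<^sub>n\<close> of the subgroups \<open>K n\<close> satisfy \<open>e\<^sub>m e\<^sub>n = e\<^sub>n\<close> for \<open>m \<le> n\<close>, and every \<open>y\<close> of
  augmentation zero is killed by almost all of them. So \<open>y\<close> is the finite telescoping sum of the
  \<open>(y e\<^sub>n) (e\<^sub>n - e\<^sub>n\<^sub>+\<^sub>1)\<close>, which exhibits the augmentation ideal as a projective module.\<close>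

lemma aug_ideal_expansion:
  assumes y: "y \<in> aug_ideal"
  shows "\<exists>N. (\<forall>n\<ge>N. y \<otimes>\<^bsub>RG\<^esub> idem n = \<zero>\<^bsub>RG\<^esub>) \<and>
    y = (\<Oplus>\<^bsub>aug_module\<^esub>n\<in>{..<N}. (y \<otimes>\<^bsub>RG\<^esub> idem n) \<odot>\<^bsub>aug_module\<^esub> (idem n \<ominus>\<^bsub>RG\<^esub> idem (Suc n)))"
proof -
  interpret I: left_module RG aug_module by (rule aug_module_left_module)
  have yc: "y \<in> carrier RG" and y0: "augmentation y = \<zero>" using y by auto
  have ec: "idem n \<in> carrier RG" for n by (rule idem_closed)
  have yec: "y \<otimes>\<^bsub>RG\<^esub> idem n \<in> carrier RG" for n using yc ec by simp
  have step: "(y \<otimes>\<^bsub>RG\<^esub> idem n) \<otimes>\<^bsub>RG\<^esub> (idem n \<ominus>\<^bsub>RG\<^esub> idem (Suc n)) = y \<otimes>\<^bsub>RG\<^esub> idem n \<ominus>\<^bsub>RG\<^esub> y \<otimes>\<^bsub>RG\<^esub> idem (Suc n)" for n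
  proof -
    have "(y \<otimes>\<^bsub>RG\<^esub> idem n) \<otimes>\<^bsub>RG\<^esub> (idem n \<ominus>\<^bsub>RG\<^esub> idem (Suc n))
      = y \<otimes>\<^bsub>RG\<^esub> (idem n \<otimes>\<^bsub>RG\<^esub> idem n \<ominus>\<^bsub>RG\<^esub> idem n \<otimes>\<^bsub>RG\<^esub> idem (Suc n))"
      using yc ec by (simp add: RG.m_assoc RG.minus_eq RG.r_distr RG.r_minus)
    also have "\<dots> = y \<otimes>\<^bsub>RG\<^esub> (idem n \<ominus>\<^bsub>RG\<^esub> idem (Suc n))" by (simp add: idem_mult_idem)
    finally show ?thesis using yc ec by (simp add: RG.minus_eq RG.r_distr RG.r_minus)
  qed
  let ?t = "\<lambda>n. (y \<otimes>\<^bsub>RG\<^esub> idem n) \<odot>\<^bsub>aug_module\<^esub> (idem n \<ominus>\<^bsub>RG\<^esub> idem (Suc n))"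
  \<comment> \<open>Both idempotents have augmentation one, so their difference lies in the ideal;
    sums in \<open>aug_module\<close> therefore make sense.\<close>
  have t: "?t n \<in> aug_ideal" for n
    using yec[of n] ec augmentation_closed[OF yec[of n]]
    by (simp add: regular_simps augmentation_mult[OF yec] augmentation_minus augmentation_idem R.minus_eq R.r_neg)
  have te: "?t n = y \<otimes>\<^bsub>RG\<^esub> idem n \<ominus>\<^bsub>RG\<^esub> y \<otimes>\<^bsub>RG\<^esub> idem (Suc n)" for n by (simp add: regular_simps step)
  have partial: "(\<Oplus>\<^bsub>aug_module\<^esub>n\<in>{..<N}. ?t n) = y \<ominus>\<^bsub>RG\<^esub> y \<otimes>\<^bsub>RG\<^esub> idem N" for N
  proof (induction N)
    case 0
    then show ?case using yc by (simp add: regular_simps idem_0 RG.minus_eq RG.r_neg)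
  next
    case (Suc N)
    have "(\<Oplus>\<^bsub>aug_module\<^esub>n\<in>{..<Suc N}. ?t n) = ?t N \<oplus>\<^bsub>aug_module\<^esub> (\<Oplus>\<^bsub>aug_module\<^esub>n\<in>{..<N}. ?t n)"
      unfolding lessThan_Suc using t by (intro I.M.finsum_insert) auto
    also have "\<dots> = (y \<otimes>\<^bsub>RG\<^esub> idem N \<ominus>\<^bsub>RG\<^esub> y \<otimes>\<^bsub>RG\<^esub> idem (Suc N)) \<oplus>\<^bsub>RG\<^esub> (y \<ominus>\<^bsub>RG\<^esub> y \<otimes>\<^bsub>RG\<^esub> idem N)"
      unfolding Suc.IH te[of N] by (simp add: regular_simps)
    also have "\<dots> = y \<ominus>\<^bsub>RG\<^esub> y \<otimes>\<^bsub>RG\<^esub> idem (Suc N)"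
      using yc yec[of N] yec[of "Suc N"]
      by (simp add: RG.minus_eq RG.a_ac RG.r_neg1 RG.r_neg2 RG.r_neg)
    finally show ?case .
  qed
  obtain N where N: "supp y \<subseteq> K N" using finite_subset_K[OF supp_finite[OF yc] supp_subset[OF yc]] .
  \<comment> \<open>Once \<open>K n\<close> contains the support of \<open>y\<close>, the product is
    the augmentation of \<open>y\<close>, which is zero, times the idempotent.\<close>
  have z: "y \<otimes>\<^bsub>RG\<^esub> idem n = \<zero>\<^bsub>RG\<^esub>" if "N \<le> n" for n
    using mult_idem[OF yc, of n] N K_mono[OF that] y0 idem_closed by (auto simp: group_ring_zero)
  have "(\<Oplus>\<^bsub>aug_module\<^esub>n\<in>{..<N}. ?t n) = y" using yc unfolding partial z[OF order_refl] by (simp add: RG.minus_eq)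
  then show ?thesis using z by (intro exI[of _ N]) simp
qed

section \<open>The resolution, realised in functions on words\<close>

definition word_embedding :: "('g \<Rightarrow> 'r) \<Rightarrow> 'g list \<Rightarrow> 'r" where
  "word_embedding a = (\<lambda>l. case l of [g] \<Rightarrow> a g | _ \<Rightarrow> \<zero>)"

definition word_restriction :: "('g list \<Rightarrow> 'r) \<Rightarrow> 'g \<Rightarrow> 'r" where
  "word_restriction f = (\<lambda>g. f [g])"

lemma word_restriction_embedding: "word_restriction (word_embedding a) = a"
  by (simp add: word_embedding_def word_restriction_def)

abbreviation transport where "transport \<equiv> transport_module word_embedding word_restriction"

text \<open>Supplies the injection of the natural numbers demanded by the dual basis lemma. Words of
  every length exist, so these functions differ as soon as one and zero do.\<close>

definition length_indicator :: "nat \<Rightarrow> 'g list \<Rightarrow> 'r" where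
  "length_indicator n = (\<lambda>l. if length l = n then \<one> else \<zero>)"

lemma inj_length_indicator:
  assumes "\<one> \<noteq> \<zero>" shows "inj length_indicator"
proof (rule injI)
  fix m n assume "length_indicator m = length_indicator n"
  from fun_cong[OF this, of "replicate n undefined"] show "m = n"
    using assms by (auto simp: length_indicator_def split: if_splits)
qed

text \<open>The complex \<open>0 -> I -> RG\<close> over the trivial module, where \<open>I\<close>
  is the augmentation ideal, continued by zero modules.\<close>

definition resolution :: "nat \<Rightarrow> ('g \<Rightarrow> 'r, 'g list \<Rightarrow> 'r) module" where
  "resolution n = (if n = 0 then transport (regular_module RG)
     else if n = 1 then transport aug_module
     else transport ((regular_module RG)\<lparr>carrier := {\<zero>\<^bsub>RG\<^esub>}\<rparr>))"

text \<open>The ideal and the group ring are copied by the same embedding, so the inclusion between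
  the copies is the identity on underlying functions.\<close>

definition differential :: "nat \<Rightarrow> ('g list \<Rightarrow> 'r) \<Rightarrow> 'g list \<Rightarrow> 'r" where
  "differential n = (if n = 0 then (\<lambda>x. x) else (\<lambda>x. word_embedding \<zero>\<^bsub>RG\<^esub>))"

lemma zero_left_module: "left_module RG ((regular_module RG)\<lparr>carrier := {\<zero>\<^bsub>RG\<^esub>}\<rparr>)"
  by (rule left_module_submodule[OF regular_module_left_module[OF group_ring_ring]])
    (auto simp: regular_simps)

lemma resolution_projective:
  assumes nz: "\<one> \<noteq> \<zero>"
  shows "projective_module RG (resolution n)"
proof -
  note tp = transport_projective[where \<phi> = word_embedding and \<psi> = word_restriction, OF word_restriction_embedding _ inj_length_indicator[OF nz]]
  have zero_map: "(\<lambda>y. \<zero>\<^bsub>RG\<^esub>) \<in> linear_maps RG M (regular_module RG)" for M :: "('g \<Rightarrow> 'r, 'g \<Rightarrow> 'r) module"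
    by (auto simp: linear_maps_def regular_simps)
  consider "n = 0" | "n = 1" | "n > 1" by linarith
  then show ?thesis
  proof cases
    case 1
    interpret L: left_module RG "regular_module RG" by (rule regular_module_left_module[OF group_ring_ring])
    have "projective_module RG (transport (regular_module RG))"
    \<comment> \<open>The regular module is free on the unit: coordinate 0 is \<open>y\<close>
      itself and the others vanish, so \<open>N = 1\<close> works.\<close>
    proof (rule tp[where x = "\<lambda>n. \<one>\<^bsub>RG\<^esub>" and c = "\<lambda>n y. if n = 0 then y else \<zero>\<^bsub>RG\<^esub>"])
      show "left_module RG (regular_module RG)" by (rule L.left_module_axioms)
      show "\<one>\<^bsub>RG\<^esub> \<in> carrier (regular_module RG)" by (simp add: regular_simps)
      show "(\<lambda>y. if n = 0 then y else \<zero>\<^bsub>RG\<^esub>) \<in> linear_maps RG (regular_module RG) (regular_module RG)" for n :: nat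
        by (auto simp: linear_maps_def regular_simps)
      fix y assume "y \<in> carrier (regular_module RG)"
      then have y: "y \<in> carrier RG" by (simp add: regular_simps)
      have "(\<Oplus>\<^bsub>regular_module RG\<^esub>n\<in>{..<1 :: nat}. (if n = 0 then y else \<zero>\<^bsub>RG\<^esub>) \<odot>\<^bsub>regular_module RG\<^esub> \<one>\<^bsub>RG\<^esub>) = y"
        using y by (simp add: lessThan_Suc regular_simps)
      then show "\<exists>N :: nat. (\<forall>n\<ge>N. (if n = 0 then y else \<zero>\<^bsub>RG\<^esub>) = \<zero>\<^bsub>RG\<^esub>) \<and>
          y = (\<Oplus>\<^bsub>regular_module RG\<^esub>n\<in>{..<N}. (if n = 0 then y else \<zero>\<^bsub>RG\<^esub>) \<odot>\<^bsub>regular_module RG\<^esub> \<one>\<^bsub>RG\<^esub>)"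
        by (intro exI[of _ "1 :: nat"] conjI) auto
    qed
    then show ?thesis using 1 by (simp add: resolution_def)
  next
    case 2
    have "projective_module RG (transport aug_module)"
    \<comment> \<open>The coordinates are right multiplications by the idempotents, which are linear
      for the left module structure.\<close>
    proof (rule tp[where x = "\<lambda>n. idem n \<ominus>\<^bsub>RG\<^esub> idem (Suc n)" and c = "\<lambda>n y. y \<otimes>\<^bsub>RG\<^esub> idem n"])
      show "left_module RG aug_module" by (rule aug_module_left_module)
      show "idem n \<ominus>\<^bsub>RG\<^esub> idem (Suc n) \<in> carrier aug_module" for n
        using idem_closed by (simp add: augmentation_minus augmentation_idem R.minus_eq R.r_neg)
      show "(\<lambda>y. y \<otimes>\<^bsub>RG\<^esub> idem n) \<in> linear_maps RG aug_module (regular_module RG)" for n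
        using idem_closed by (auto simp: linear_maps_def regular_simps RG.l_distr RG.m_assoc)
      show "\<exists>N. (\<forall>n\<ge>N. y \<otimes>\<^bsub>RG\<^esub> idem n = \<zero>\<^bsub>RG\<^esub>) \<and>
          y = (\<Oplus>\<^bsub>aug_module\<^esub>n\<in>{..<N}. (y \<otimes>\<^bsub>RG\<^esub> idem n) \<odot>\<^bsub>aug_module\<^esub> (idem n \<ominus>\<^bsub>RG\<^esub> idem (Suc n)))"
        if "y \<in> carrier aug_module" for y
        using aug_ideal_expansion[of y] that by simp
    qed
    then show ?thesis using 2 by (simp add: resolution_def)
  next
    case 3
    let ?Z = "(regular_module RG)\<lparr>carrier := {\<zero>\<^bsub>RG\<^esub>}\<rparr>"
    interpret Z: left_module RG ?Z by (rule zero_left_module)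
    have "projective_module RG (transport ?Z)"
    proof (rule tp[where x = "\<lambda>n. \<zero>\<^bsub>RG\<^esub>" and c = "\<lambda>n y. \<zero>\<^bsub>RG\<^esub>"])
      show "\<exists>N :: nat. (\<forall>n\<ge>N. \<zero>\<^bsub>RG\<^esub> = \<zero>\<^bsub>RG\<^esub>) \<and> y = (\<Oplus>\<^bsub>?Z\<^esub>n\<in>{..<N}. \<zero>\<^bsub>RG\<^esub> \<odot>\<^bsub>?Z\<^esub> \<zero>\<^bsub>RG\<^esub>)" if "y \<in> carrier ?Z" for y
        using that by (intro exI[of _ "0 :: nat"]) (simp add: regular_simps)
    qed (simp_all add: zero_map zero_left_module)
    then show ?thesis using 3 by (simp add: resolution_def)
  qed
qed

lemma resolution_resolves:
  assumes nz: "\<one> \<noteq> \<zero>"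
  shows "projective_resolution RG (trivial_module R G) resolution differential (\<lambda>x. augmentation (word_restriction x))"
  unfolding projective_resolution_def
proof (intro conjI allI)
  note inv = word_restriction_embedding
  have triv: "trivial_module R G = \<lparr>carrier = carrier R, monoid.mult = undefined, monoid.one = undefined,
      zero = \<zero>, add = (\<oplus>), smult = (\<lambda>a x. augmentation a \<otimes> x)\<rparr>"
    by (simp add: trivial_module_def augmentation_def)
  have c0: "carrier (resolution 0) = word_embedding ` carrier RG"
    by (simp add: resolution_def transport_module_def regular_simps)
  have c1: "carrier (resolution (Suc 0)) = word_embedding ` aug_ideal"
    by (simp add: resolution_def transport_module_def)
  have c2: "carrier (resolution (Suc (Suc n))) = {word_embedding \<zero>\<^bsub>RG\<^esub>}" for n
    by (simp add: resolution_def transport_module_def)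
  have z: "\<zero>\<^bsub>resolution n\<^esub> = word_embedding \<zero>\<^bsub>RG\<^esub>" for n
    by (simp add: resolution_def transport_module_def regular_simps)
  have ad: "x \<oplus>\<^bsub>resolution n\<^esub> y = word_embedding (word_restriction x \<oplus>\<^bsub>RG\<^esub> word_restriction y)" for n x y
    by (simp add: resolution_def transport_module_def regular_simps)
  have sm: "a \<odot>\<^bsub>resolution n\<^esub> x = word_embedding (a \<otimes>\<^bsub>RG\<^esub> word_restriction x)" for n a x
    by (simp add: resolution_def transport_module_def regular_simps)
  show "left_module RG (trivial_module R G)" by (rule trivial_module_left_module)
  show "projective_module RG (resolution n)" for n by (rule resolution_projective[OF nz])
  show "(\<lambda>x. augmentation (word_restriction x)) \<in> linear_maps RG (resolution 0) (trivial_module R G)"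
    by (auto simp: linear_maps_def c0 triv ad sm inv augmentation_closed augmentation_add augmentation_mult)
  show "differential n \<in> linear_maps RG (resolution (Suc n)) (resolution n)" for n
  proof (cases n)
    case 0
    then show ?thesis by (auto simp: linear_maps_def differential_def c0 c1 ad sm)
  next
    case (Suc m)
    have "word_embedding \<zero>\<^bsub>RG\<^esub> \<in> carrier (resolution n)"
      using Suc by (cases m) (auto simp: c1 c2 augmentation_zero)
    then show ?thesis using Suc by (auto simp: linear_maps_def differential_def ad sm inv)
  qed
  show "(\<lambda>x. augmentation (word_restriction x)) ` carrier (resolution 0) = carrier (trivial_module R G)"
  proof
    show "(\<lambda>x. augmentation (word_restriction x)) ` carrier (resolution 0) \<subseteq> carrier (trivial_module R G)"
      by (auto simp: c0 triv inv augmentation_closed)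
    show "carrier (trivial_module R G) \<subseteq> (\<lambda>x. augmentation (word_restriction x)) ` carrier (resolution 0)"
    proof
      fix r assume "r \<in> carrier (trivial_module R G)"
      then have r: "r \<in> carrier R" by (simp add: triv)
      have s: "ring_single R \<one>\<^bsub>G\<^esub> r \<in> carrier RG" using r by (simp add: ring_single_closed)
      have "augmentation (ring_single R \<one>\<^bsub>G\<^esub> r) = (\<Oplus>g\<in>{\<one>\<^bsub>G\<^esub>}. ring_single R \<one>\<^bsub>G\<^esub> r g)"
        by (rule augmentation_eq[OF s]) (auto simp: ring_single_def)
      then have "r = augmentation (word_restriction (word_embedding (ring_single R \<one>\<^bsub>G\<^esub> r)))"
        using r by (simp add: inv ring_single_def)
      then show "r \<in> (\<lambda>x. augmentation (word_restriction x)) ` carrier (resolution 0)"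
        unfolding c0 using s by blast
    qed
  qed
  show "differential 0 ` carrier (resolution 1) = a_kernel (resolution 0) (trivial_module R G) (\<lambda>x. augmentation (word_restriction x))"
    by (auto simp: differential_def c0 c1 a_kernel_def' triv inv)
  \<comment> \<open>For \<open>n = 0\<close> this is injectivity of the inclusion of the ideal; for
    larger \<open>n\<close> both sides consist of the zero element alone.\<close>
  show "differential (Suc n) ` carrier (resolution (Suc (Suc n)))
      = a_kernel (resolution (Suc n)) (resolution n) (differential n)" for n
    by (cases n) (auto simp: differential_def c1 c2 a_kernel_def' z augmentation_zero)
qed

lemma resolution_0_finitely_generated: "finitely_generated_module RG (resolution 0)"
proof -
  note inv = word_restriction_embedding
  interpret P: left_module RG "resolution 0"
    unfolding resolution_def
    using transport_left_module[where \<phi> = word_embedding and \<psi> = word_restriction, OF word_restriction_embedding regular_module_left_module[OF group_ring_ring]] by simp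
  have c0: "carrier (resolution 0) = word_embedding ` carrier RG"
    by (simp add: resolution_def transport_module_def regular_simps)
  have sm: "a \<odot>\<^bsub>resolution 0\<^esub> x = word_embedding (a \<otimes>\<^bsub>RG\<^esub> word_restriction x)" for a x
    by (simp add: resolution_def transport_module_def regular_simps)
  have "\<exists>c\<in>{word_embedding \<one>\<^bsub>RG\<^esub>} \<rightarrow> carrier RG.
      x = (\<Oplus>\<^bsub>resolution 0\<^esub>s\<in>{word_embedding \<one>\<^bsub>RG\<^esub>}. c s \<odot>\<^bsub>resolution 0\<^esub> s)"
    if x: "x \<in> carrier (resolution 0)" for x
  proof -
    obtain a where a: "a \<in> carrier RG" "x = word_embedding a" using x c0 by blast
    then show ?thesis using x by (intro bexI[of _ "\<lambda>s. a"]) (simp_all add: sm inv)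
  qed
  then show ?thesis
    unfolding finitely_generated_module_def
    by (intro exI[of _ "{word_embedding \<one>\<^bsub>RG\<^esub>}"]) (simp add: c0)
qed

lemma cohomological_dimension_le_1:
  assumes "\<one> \<noteq> \<zero>" shows "cohomological_dimension R G \<le> enat 1"
proof -
  have "zero_module (resolution i)" if "i > 1" for i
    using that by (simp add: resolution_def zero_module_def transport_module_def regular_simps)
  then show ?thesis
    unfolding cohomological_dimension_def
    by (intro Inf_lower CollectI exI[of _ "1 :: nat"] conjI refl)
      (intro exI[of _ resolution] exI[of _ differential] exI[of _ "\<lambda>x. augmentation (word_restriction x)"] conjI
        resolution_resolves[OF assms], blast)
qed

lemma type_FP_0:
  assumes "\<one> \<noteq> \<zero>" shows "type_FP R G 0"
  unfolding type_FP_def using resolution_resolves[OF assms] resolution_0_finitely_generated by blast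

theorem semiduality_group_1:
  assumes inf: "infinite (carrier G)" and pid: "principal_domain R"
  shows "semiduality_group TYPE('n) R G 1"
proof -
  interpret P: principal_domain R by fact
  have nz: "\<one> \<noteq> \<zero>" by simp
  have "zero_module (group_cohomology R G (regular_module RG) k)" if "k \<noteq> 1" for k
  proof (cases k)
    case 0
    then show ?thesis using cohomology_0_zero[OF inf] by simp
  next
    case (Suc j)
    with that obtain m where "k = Suc (Suc m)" by (cases j) auto
    then show ?thesis using cohomology_higher_zero[OF regular_module] by simp
  qed
  then show ?thesis
    unfolding semiduality_group_def
    using R.is_cring G.group_axioms cohomological_dimension_le_1[OF nz] type_FP_0[OF nz]
      cohomology_1_flat[OF inf pid] by simp
qed

end

section \<open>Sums of finite groups\<close>

text \<open>Multiples of one multiply like the integers, and units are closed under products. The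
  orders of the finite stages are such products.\<close>

lemma (in cring) add_pow_prod_unit:
  assumes "\<And>i. add_pow R (m i :: nat) \<one> \<in> Units R"
  shows "add_pow R (\<Prod>i<n :: nat. m i) \<one> \<in> Units R"
proof (induction n)
  case (Suc n)
  let ?k = "\<Prod>i<n. m i"
  have "add_pow R (\<Prod>i<Suc n. m i) \<one> = add_pow R (m n) (add_pow R ?k \<one>)"
    using add.nat_pow_pow[of \<one> "m n" ?k] by (simp add: mult.commute)
  also have "\<dots> = add_pow R (m n) \<one> \<otimes> add_pow R ?k \<one>"
    using add_pow_ldistr[of \<one> "add_pow R ?k \<one>" "m n"] by simp
  finally show ?case using Suc assms by simp
qed simp

context
  fixes F :: "nat \<Rightarrow> 'a monoid"
  assumes F_group: "\<And>i. group (F i)" and F_finite: "\<And>i. finite (carrier (F i))"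
begin

lemma sum_group_carrier_iff:
  "x \<in> carrier (sum_group UNIV F) \<longleftrightarrow> (\<forall>i. x i \<in> carrier (F i)) \<and> finite {i. x i \<noteq> \<one>\<^bsub>F i\<^esub>}"
  using carrier_sum_group[of UNIV F] F_group by (auto simp: PiE_def)

text \<open>The sum of the first \<open>n\<close> groups inside the whole sum. Indexing by
  \<open>n\<close> bounds the coordinates strictly, so stage 0 is trivial as the locale
  demands.\<close>

definition initial_sum :: "nat \<Rightarrow> (nat \<Rightarrow> 'a) set" where
  "initial_sum n = {x. (\<forall>i. x i \<in> carrier (F i)) \<and> (\<forall>i\<ge>n. x i = \<one>\<^bsub>F i\<^esub>)}"

lemma initial_sum_subset: "initial_sum n \<subseteq> carrier (sum_group UNIV F)"
proof
  fix x assume x: "x \<in> initial_sum n"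
  then have "{i. x i \<noteq> \<one>\<^bsub>F i\<^esub>} \<subseteq> {..<n}" by (force simp: initial_sum_def not_le[symmetric])
  then have "finite {i. x i \<noteq> \<one>\<^bsub>F i\<^esub>}" by (rule finite_subset) simp
  then show "x \<in> carrier (sum_group UNIV F)" using x unfolding sum_group_carrier_iff by (simp add: initial_sum_def)
qed

lemma initial_sum_subgroup: "subgroup (initial_sum n) (sum_group UNIV F)"
proof -
  interpret G: group "sum_group UNIV F" using F_group by simp
  show ?thesis
  proof (rule G.subgroupI)
    show "initial_sum n \<subseteq> carrier (sum_group UNIV F)" by (rule initial_sum_subset)
    have "(\<lambda>i. \<one>\<^bsub>F i\<^esub>) \<in> initial_sum n" using F_group by (simp add: initial_sum_def group.is_monoid)
    then show "initial_sum n \<noteq> {}" by blast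
    fix x assume x: "x \<in> initial_sum n"
    have "inv\<^bsub>sum_group UNIV F\<^esub> x = (\<lambda>i. inv\<^bsub>F i\<^esub> x i)"
      using inv_sum_group[of UNIV F x, OF _ subsetD[OF initial_sum_subset x]] F_group by (simp add: restrict_def)
    then show "inv\<^bsub>sum_group UNIV F\<^esub> x \<in> initial_sum n"
      using x F_group by (simp add: initial_sum_def group.inv_closed group.is_monoid monoid.inv_one)
    fix y assume y: "y \<in> initial_sum n"
    show "x \<otimes>\<^bsub>sum_group UNIV F\<^esub> y \<in> initial_sum n"
      using x y F_group by (simp add: initial_sum_def group.is_monoid monoid.m_closed)
  qed
qed

text \<open>Reduces finiteness and order of a stage to those of a finite product; the inverse
  extends by identity elements.\<close>

lemma initial_sum_bij: "bij_betw (\<lambda>x. restrict x {..<n}) (initial_sum n) (\<Pi>\<^sub>E i\<in>{..<n}. carrier (F i))"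
proof (rule bij_betw_byWitness[where f' = "\<lambda>y i. if i < n then y i else \<one>\<^bsub>F i\<^esub>"])
  show "\<forall>x\<in>initial_sum n. (\<lambda>i. if i < n then restrict x {..<n} i else \<one>\<^bsub>F i\<^esub>) = x"
    by (auto simp: initial_sum_def fun_eq_iff)
  show "\<forall>y\<in>\<Pi>\<^sub>E i\<in>{..<n}. carrier (F i). restrict (\<lambda>i. if i < n then y i else \<one>\<^bsub>F i\<^esub>) {..<n} = y"
    by (auto simp: fun_eq_iff PiE_def extensional_def)
  show "(\<lambda>x. restrict x {..<n}) ` initial_sum n \<subseteq> (\<Pi>\<^sub>E i\<in>{..<n}. carrier (F i))"
    by (auto simp: initial_sum_def PiE_def extensional_def)
  show "(\<lambda>y i. if i < n then y i else \<one>\<^bsub>F i\<^esub>) ` (\<Pi>\<^sub>E i\<in>{..<n}. carrier (F i)) \<subseteq> initial_sum n"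
    using F_group by (auto simp: initial_sum_def PiE_def Pi_iff group.is_monoid)
qed

lemma initial_sum_finite: "finite (initial_sum n)"
  using bij_betw_finite[OF initial_sum_bij] F_finite by (simp add: finite_PiE)

lemma initial_sum_card: "card (initial_sum n) = (\<Prod>i<n. order (F i))"
  using bij_betw_same_card[OF initial_sum_bij, of n] by (simp add: card_PiE order_def)

text \<open>A nontrivial element from each nontrivial factor, placed in its own coordinate, gives
  infinitely many distinct elements.\<close>

lemma sum_group_infinite:
  assumes "infinite {i. order (F i) \<noteq> 1}"
  shows "infinite (carrier (sum_group UNIV F))"
proof -
  let ?I = "{i. order (F i) \<noteq> 1}"
  have "\<exists>a. a \<in> carrier (F i) \<and> a \<noteq> \<one>\<^bsub>F i\<^esub>" if "i \<in> ?I" for i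
  proof (rule ccontr)
    assume "\<not> ?thesis"
    then have "carrier (F i) = {\<one>\<^bsub>F i\<^esub>}" using F_group[of i] by (auto simp: group.is_monoid)
    then show False using that by (simp add: order_def)
  qed
  then obtain a where a: "\<And>i. i \<in> ?I \<Longrightarrow> a i \<in> carrier (F i) \<and> a i \<noteq> \<one>\<^bsub>F i\<^esub>" by metis
  define e where "e = (\<lambda>i j. if j = i then a i else \<one>\<^bsub>F j\<^esub>)"
  have "inj_on e ?I"
  proof (rule inj_onI)
    fix i j assume i: "i \<in> ?I" and "e i = e j"
    from fun_cong[OF this(2), of i] show "i = j" using a[OF i] by (auto simp: e_def split: if_splits)
  qed
  moreover have "e ` ?I \<subseteq> carrier (sum_group UNIV F)"
  proof
    fix x assume "x \<in> e ` ?I"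
    then obtain i where i: "i \<in> ?I" "x = e i" by blast
    have "{j. e i j \<noteq> \<one>\<^bsub>F j\<^esub>} \<subseteq> {i}" by (auto simp: e_def)
    then have "finite {j. e i j \<noteq> \<one>\<^bsub>F j\<^esub>}" by (rule finite_subset) simp
    then show "x \<in> carrier (sum_group UNIV F)"
      unfolding sum_group_carrier_iff i(2) using a[OF i(1)] F_group by (auto simp: e_def group.is_monoid)
  qed
  ultimately show ?thesis using assms inj_on_finite by blast
qed

lemma sum_group_semiduality:
  fixes R :: "'r ring"
  assumes inf: "infinite {i. order (F i) \<noteq> 1}" and pid: "principal_domain R"
    and unit: "\<And>i. add_pow R (order (F i)) \<one>\<^bsub>R\<^esub> \<in> Units R"
  shows "semiduality_group TYPE('n) R (sum_group UNIV F) 1"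
proof -
  interpret R: principal_domain R by fact
  interpret G: group "sum_group UNIV F" using F_group by simp
  interpret exhausted_group_algebra R "sum_group UNIV F" initial_sum
  proof (intro exhausted_group_algebra.intro group_algebra.intro exhausted_group_algebra_axioms.intro)
    show "cring R" by (rule R.is_cring)
    show "group (sum_group UNIV F)" by (rule G.group_axioms)
    show "subgroup (initial_sum n) (sum_group UNIV F)" for n by (rule initial_sum_subgroup)
    show "finite (initial_sum n)" for n by (rule initial_sum_finite)
    show "add_pow R (card (initial_sum n)) \<one>\<^bsub>R\<^esub> \<in> Units R" for n
      unfolding initial_sum_card by (rule R.add_pow_prod_unit[OF unit])
    show "initial_sum n \<subseteq> initial_sum (Suc n)" for n by (auto simp: initial_sum_def)
    show "carrier (sum_group UNIV F) \<subseteq> (\<Union>n. initial_sum n)"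
    proof
      fix x assume x: "x \<in> carrier (sum_group UNIV F)"
      then obtain n where "\<forall>i\<in>{i. x i \<noteq> \<one>\<^bsub>F i\<^esub>}. i < n"
        unfolding sum_group_carrier_iff using finite_nat_set_iff_bounded by blast
      then have "x i = \<one>\<^bsub>F i\<^esub>" if "n \<le> i" for i using that by (meson leD mem_Collect_eq)
      then have "x \<in> initial_sum n" using x unfolding sum_group_carrier_iff by (simp add: initial_sum_def)
      then show "x \<in> (\<Union>n. initial_sum n)" by blast
    qed
    show "initial_sum 0 = {\<one>\<^bsub>sum_group UNIV F\<^esub>}"
      using F_group by (auto simp: initial_sum_def fun_eq_iff group.is_monoid)
  qed
  show ?thesis by (rule semiduality_group_1[OF sum_group_infinite[OF inf] pid])
qed

end

lemma rational_ring_field: "field rational_ring"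
proof -
  have "cring rational_ring"
  proof (rule cringI)
    show "abelian_group rational_ring"
      by (rule abelian_groupI) (auto simp: rational_ring_def intro: exI[of _ "- x" for x])
    show "comm_monoid rational_ring"
      by (rule comm_monoidI) (auto simp: rational_ring_def)
  qed (simp add: rational_ring_def distrib_right)
  moreover have "Units rational_ring = carrier rational_ring - {\<zero>\<^bsub>rational_ring\<^esub>}"
  proof -
    have "\<exists>y. y * x = 1 \<and> x * y = 1" if "x \<noteq> 0" for x :: rat
      using that by (intro exI[of _ "1 / x"]) simp
    then show ?thesis by (auto simp: Units_def rational_ring_def)
  qed
  ultimately show ?thesis by (rule cring.cring_fieldI)
qed

lemma rational_add_pow: "add_pow rational_ring (n :: nat) \<one>\<^bsub>rational_ring\<^esub> = of_nat n"
proof -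
  interpret Q: field rational_ring by (rule rational_ring_field)
  show ?thesis
  proof (induction n)
    case 0
    show ?case using Q.add.nat_pow_0 by (simp add: rational_ring_def)
  next
    case (Suc n)
    then show ?case using Q.add.nat_pow_Suc[of n "\<one>\<^bsub>rational_ring\<^esub>"] by (simp add: rational_ring_def)
  qed
qed

theorem mainTheorem6:
  fixes F :: "nat \<Rightarrow> 'a monoid" and R :: "'r ring"
  assumes "\<And>i. group (F i)"
    and "\<And>i. finite (carrier (F i))"
    and "infinite {i. order (F i) \<noteq> 1}"
  shows "(principal_domain R \<and> (\<forall>i. [order (F i)] \<cdot>\<^bsub>R\<^esub> \<one>\<^bsub>R\<^esub> \<in> Units R)
            \<longrightarrow> semiduality_group TYPE('n) R (sum_group UNIV F) 1)
       \<and> semiduality_group TYPE('n) rational_ring (sum_group UNIV F) 1"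
proof (intro conjI impI)
  assume "principal_domain R \<and> (\<forall>i. [order (F i)] \<cdot>\<^bsub>R\<^esub> \<one>\<^bsub>R\<^esub> \<in> Units R)"
  then show "semiduality_group TYPE('n) R (sum_group UNIV F) 1"
    using sum_group_semiduality[OF assms(1,2,3)] by blast
next
  interpret Q: field rational_ring by (rule rational_ring_field)
  have "add_pow rational_ring (order (F i)) \<one>\<^bsub>rational_ring\<^esub> \<in> Units rational_ring" for i
  proof -
    interpret group "F i" by fact
    \<comment> \<open>A finite group has positive order, so the corresponding multiple of one is a
      nonzero rational and hence a unit.\<close>
    have "order (F i) \<noteq> 0" using assms(2)[of i] by (simp add: order_gt_0_iff_finite[symmetric])
    then show ?thesis
      unfolding rational_add_pow Q.field_Units by (simp add: rational_ring_def)
  qed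
  then show "semiduality_group TYPE('n) rational_ring (sum_group UNIV F) 1"
    using sum_group_semiduality[OF assms(1,2,3) Q.principal_domain_axioms] by blast
qed

end
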